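(* Let $A=(a_{ij})$ be a symmetric, invertible $n\times n$ matrix (with generic entries $a_{ij}=a_{ji}$), and let $\omega_A^{2n-1}=\operatorname{tr}((A^{-1}\mathrm{d}A)^{2n-1})$. If $n=m+1>1$ is odd, then $$\omega_A^{2n-1}=(2n-1)\sum_{\substack{\mathcal{E}\subseteq\{(i,j):1\le i<j\le n\}\\|\mathcal{E}|=m}}\ \sum_{k=1}^{m/2}(-2)^kk!\,\frac{Q_k(A,\mathcal{E})}{\det(A)^{k+1}}\;\omega_{\mathrm{diag}_n\cup\mathcal{E}}(A)\;+\;\bigl(\text{terms of degree}<n\text{ in }\mathrm{d}a_{11},\mathrm{d}a_{22},\dots,\mathrm{d}a_{nn}\bigr),$$ where $Q_k(A,\mathcal{E})\in\mathbb{Z}[a_{ij}]$ are the polynomials $$Q_k(A,\mathcal{E})=\sum_{\{\{I_1,J_1\},\dots,\{I_k,J_k\}\}\in\mathcal{D}_m^k}\ \prod_{l=1}^k\sigma(\mathcal{E}_{I_l})\,\sigma(\mathcal{E}_{J_l})\det A^{\mathcal{E}_{I_l},\mathcal{E}_{J_l}}.$$ If $n$ is even then all terms in $\omega_A^{2n-1}$ are of degree $<n$ in $\mathrm{d}a_{11},\dots,\mathrm{d}a_{nn}$.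
   Context: "Terms of degree $<n$ in $\mathrm{d}a_{11},\dots,\mathrm{d}a_{nn}$" means a linear combination of wedge monomials in the $\mathrm{d}a_{ij}$ ($i\le j$) each involving fewer than $n$ of the diagonal forms $\mathrm{d}a_{ii}$. $\mathrm{diag}_n=\{(1,1),\dots,(n,n)\}$. For a set $\nu$ of $2n-1$ pairs $(i,j)$ with $1\le i,j\le n$, choose an ordering $\nu=((i_1,j_1),\dots,(i_{2n-1},j_{2n-1}))$; let $M_\nu$ be the $(2n-1)\times2n$ matrix whose $k$-th row has $-1$ in column $i_k$, $1$ in column $n+j_k$, zeros elsewhere, and let $M_\nu^{\emptyset,k}$ be $M_\nu$ with column $k$ deleted. Then $\omega_\nu(A)=(-1)^{\binom n2+k-1}\det(M_\nu^{\emptyset,k})\,\mathrm{d}a_{i_1j_1}\wedge\dots\wedge\mathrm{d}a_{i_{2n-1}j_{2n-1}}$, for any $1\le k\le 2n$; it is independent of the ordering and of $k$. Fix an ordering of $\mathcal{E}=\{(s_1,t_1),\dots,(s_m,t_m)\}$. For $I=\{i_1<\dots<i_k\}\subset\{1,\dots,m\}$ let $\mathcal{E}_I=(s_{i_1},t_{i_1},\dots,s_{i_k},t_{i_k})$. $\mathcal{D}_m^k$ ($m$ even) is the set of unordered $k$-tuples of unordered pairs $\{I_l,J_l\}$ of non-empty sets with $|I_l|=|J_l|$ such that $\{1,\dots,m\}$ is the disjoint union of all the $I_l$ and $J_l$. For a tuple $K=(k_1,\dots,k_p)$ of distinct elements of $\{1,\dots,n\}$, $\sigma(K)=(-1)^{k_1+\dots+k_p}\operatorname{sgn}(\pi_K)$,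 where $\pi_K$ is the permutation putting $K$ in increasing order; if $K$ has repeated entries, $\sigma(K)=0$ (and the corresponding term is zero). $A^{K,L}$ is the matrix obtained from $A$ by deleting the rows indexed by $K$ and the columns indexed by $L$. *)

theory Defs
  imports
    "Jordan_Normal_Form.Determinant"
    "Jordan_Normal_Form.Gauss_Jordan_Elimination"
    "Jordan_Normal_Form.DL_Submatrix"
    "HOL-Combinatorics.Permutations"
    "HOL-Library.Disjoint_Sets"
begin

section \<open>Exterior algebra on the symbols attached to pairs of naturals\<close>

text \<open>
  The exterior algebra over \<open>'a\<close> that is free on generators indexed by pairs \<open>(i, j)\<close>.
  An element is given by its coordinates in the basis of monomials \<open>e\<^sub>S\<close>, where \<open>S\<close>
  is a finite set of pairs and \<open>e\<^sub>S\<close> is the wedge product of the generators in \<open>S\<close>, taken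
  in increasing order for the lexicographic order \<open>pair_less\<close>.
  The wedge product is the multiplication \<open>*\<close> of the type.
\<close>

typedef (overloaded) 'a form =
  "{f :: (nat \<times> nat) set \<Rightarrow> 'a::zero. finite {S. f S \<noteq> 0} \<and> (\<forall>S. infinite S \<longrightarrow> f S = 0)}"
  morphisms form_coeff Abs_form
  by (rule exI[of _ "\<lambda>_. 0"]) simp

setup_lifting type_definition_form

lemma form_coeff_infinite [simp]: "infinite S \<Longrightarrow> form_coeff f S = 0"
  using form_coeff[of f] by auto

lemma finite_form_coeff [simp]: "finite {S. form_coeff f S \<noteq> 0}"
  using form_coeff[of f] by auto

lemma form_eqI: "(\<And>S. finite S \<Longrightarrow> form_coeff f S = form_coeff g S) \<Longrightarrow> f = g"
  by (metis form_coeff_infinite form_coeff_inject ext)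

text \<open>
  For disjoint \<open>T\<close> and \<open>U\<close> one has \<open>e\<^sub>T * e\<^sub>U = shuffle_sign T U * e\<^bsub>T \<union> U\<^esub>\<close>: the exponent is
  the number of transpositions needed to sort the concatenation.
\<close>

definition shuffle_sign :: "(nat \<times> nat) set \<Rightarrow> (nat \<times> nat) set \<Rightarrow> 'a::comm_ring_1" where
  "shuffle_sign T U = (- 1) ^ card {(t, u). t \<in> T \<and> u \<in> U \<and> (u, t) \<in> pair_less}"

lemma shuffle_sign_empty [simp]: "shuffle_sign {} U = 1" "shuffle_sign T {} = 1"
  by (simp_all add: shuffle_sign_def)

lemma finite_inversions:
  "finite T \<Longrightarrow> finite U \<Longrightarrow> finite {(t, u). t \<in> T \<and> u \<in> U \<and> (u, t) \<in> pair_less}"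
  by (rule finite_subset[of _ "T \<times> U"]) auto

lemma shuffle_sign_Un_left:
  assumes "finite T" "finite T'" "finite U" "T \<inter> T' = {}"
  shows "shuffle_sign (T \<union> T') U = shuffle_sign T U * shuffle_sign T' U"
proof -
  have "{(t, u). t \<in> T \<union> T' \<and> u \<in> U \<and> (u, t) \<in> pair_less} =
    {(t, u). t \<in> T \<and> u \<in> U \<and> (u, t) \<in> pair_less} \<union>
    {(t, u). t \<in> T' \<and> u \<in> U \<and> (u, t) \<in> pair_less}" by auto
  moreover have "{(t, u). t \<in> T \<and> u \<in> U \<and> (u, t) \<in> pair_less} \<inter>
    {(t, u). t \<in> T' \<and> u \<in> U \<and> (u, t) \<in> pair_less} = {}" using assms(4) by auto
  ultimately show ?thesis
    unfolding shuffle_sign_def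
    by (simp add: card_Un_disjoint finite_inversions assms power_add)
qed

lemma shuffle_sign_Un_right:
  assumes "finite T" "finite U" "finite U'" "U \<inter> U' = {}"
  shows "shuffle_sign T (U \<union> U') = shuffle_sign T U * shuffle_sign T U'"
proof -
  have "{(t, u). t \<in> T \<and> u \<in> U \<union> U' \<and> (u, t) \<in> pair_less} =
    {(t, u). t \<in> T \<and> u \<in> U \<and> (u, t) \<in> pair_less} \<union>
    {(t, u). t \<in> T \<and> u \<in> U' \<and> (u, t) \<in> pair_less}" by auto
  moreover have "{(t, u). t \<in> T \<and> u \<in> U \<and> (u, t) \<in> pair_less} \<inter>
    {(t, u). t \<in> T \<and> u \<in> U' \<and> (u, t) \<in> pair_less} = {}" using assms(4) by auto
  ultimately show ?thesis
    unfolding shuffle_sign_def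
    by (simp add: card_Un_disjoint finite_inversions assms power_add)
qed

instantiation form :: (comm_ring_1) ring_1
begin

lift_definition zero_form :: "'a form" is "\<lambda>_. 0"
  by simp

lift_definition one_form :: "'a form" is "\<lambda>S. if S = {} then 1 else 0"
  by auto

lift_definition plus_form :: "'a form \<Rightarrow> 'a form \<Rightarrow> 'a form" is "\<lambda>f g S. f S + g S"
proof -
  fix f g :: "(nat \<times> nat) set \<Rightarrow> 'a"
  assume "finite {S. f S \<noteq> 0} \<and> (\<forall>S. infinite S \<longrightarrow> f S = 0)"
    and "finite {S. g S \<noteq> 0} \<and> (\<forall>S. infinite S \<longrightarrow> g S = 0)"
  then show "finite {S. f S + g S \<noteq> 0} \<and> (\<forall>S. infinite S \<longrightarrow> f S + g S = 0)"
    by (auto intro: finite_subset[of _ "{S. f S \<noteq> 0} \<union> {S. g S \<noteq> 0}"])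
qed

lift_definition uminus_form :: "'a form \<Rightarrow> 'a form" is "\<lambda>f S. - f S"
  by simp

lift_definition minus_form :: "'a form \<Rightarrow> 'a form \<Rightarrow> 'a form" is "\<lambda>f g S. f S - g S"
proof -
  fix f g :: "(nat \<times> nat) set \<Rightarrow> 'a"
  assume "finite {S. f S \<noteq> 0} \<and> (\<forall>S. infinite S \<longrightarrow> f S = 0)"
    and "finite {S. g S \<noteq> 0} \<and> (\<forall>S. infinite S \<longrightarrow> g S = 0)"
  then show "finite {S. f S - g S \<noteq> 0} \<and> (\<forall>S. infinite S \<longrightarrow> f S - g S = 0)"
    by (auto intro: finite_subset[of _ "{S. f S \<noteq> 0} \<union> {S. g S \<noteq> 0}"])
qed

lift_definition times_form :: "'a form \<Rightarrow> 'a form \<Rightarrow> 'a form" is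
  "\<lambda>f g S. \<Sum>T\<in>Pow S. shuffle_sign T (S - T) * f T * g (S - T)"
proof -
  fix f g :: "(nat \<times> nat) set \<Rightarrow> 'a"
  assume f: "finite {S. f S \<noteq> 0} \<and> (\<forall>S. infinite S \<longrightarrow> f S = 0)"
    and g: "finite {S. g S \<noteq> 0} \<and> (\<forall>S. infinite S \<longrightarrow> g S = 0)"
  let ?h = "\<lambda>S. \<Sum>T\<in>Pow S. shuffle_sign T (S - T) * f T * g (S - T)"
  have "{S. ?h S \<noteq> 0} \<subseteq> (\<lambda>(T, U). T \<union> U) ` ({S. f S \<noteq> 0} \<times> {S. g S \<noteq> 0})"
  proof
    fix S assume "S \<in> {S. ?h S \<noteq> 0}"
    then obtain T where T: "T \<in> Pow S" "shuffle_sign T (S - T) * f T * g (S - T) \<noteq> 0"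
      by (auto elim: sum.not_neutral_contains_not_neutral)
    then have "f T \<noteq> 0" "g (S - T) \<noteq> 0" "S = T \<union> (S - T)" by auto
    then show "S \<in> (\<lambda>(T, U). T \<union> U) ` ({S. f S \<noteq> 0} \<times> {S. g S \<noteq> 0})"
      by (intro image_eqI[of _ _ "(T, S - T)"]) auto
  qed
  then have "finite {S. ?h S \<noteq> 0}"
    using f g by (meson finite_SigmaI finite_imageI finite_subset)
  then show "finite {S. ?h S \<noteq> 0} \<and> (\<forall>S. infinite S \<longrightarrow> ?h S = 0)"
    by (simp add: finite_Pow_iff)
qed

instance
proof
  fix a b c :: "'a form"
  show "a * b * c = a * (b * c)"
  proof (rule form_eqI)
    fix S :: "(nat \<times> nat) set"
    assume S: "finite S"
    let ?s = "shuffle_sign :: _ \<Rightarrow> _ \<Rightarrow> 'a"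
    let ?X = "SIGMA T:Pow S. Pow T"
    let ?Y = "SIGMA U:Pow S. Pow (S - U)"
    have fin: "finite T" if "T \<subseteq> S" for T using S that finite_subset by blast
    have "form_coeff (a * b * c) S =
      (\<Sum>T\<in>Pow S. \<Sum>U\<in>Pow T. ?s T (S - T) * (?s U (T - U) * form_coeff a U *
        form_coeff b (T - U)) * form_coeff c (S - T))"
      by (simp add: times_form.rep_eq sum_distrib_left sum_distrib_right)
    also have "\<dots> = (\<Sum>(T, U)\<in>?X. ?s T (S - T) * (?s U (T - U) * form_coeff a U *
        form_coeff b (T - U)) * form_coeff c (S - T))"
      using S fin by (subst sum.Sigma) auto
    also have "\<dots> = (\<Sum>(U, V)\<in>?Y. ?s U (S - U) * form_coeff a U * (?s V (S - U - V) *
        form_coeff b V * form_coeff c (S - U - V)))"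
    proof (rule sum.reindex_bij_witness[of _ "\<lambda>(U, V). (U \<union> V, U)" "\<lambda>(T, U). (U, T - U)"])
      fix x assume "x \<in> ?X"
      then obtain T U where x: "x = (T, U)" "T \<subseteq> S" "U \<subseteq> T" by auto
      define V W where "V = T - U" and "W = S - T"
      have eqs: "T = U \<union> V" "S - U = V \<union> W" "S - U - V = W" "T - U = V" "S - T = W"
        and disj: "U \<inter> V = {}" "V \<inter> W = {}"
        using x unfolding V_def W_def by auto
      have f: "finite U" "finite V" "finite W"
        using S x unfolding V_def W_def by (auto intro: finite_subset)
      have "?s T W * ?s U V = ?s U (S - U) * ?s V W"
        unfolding eqs(1) eqs(2)
        by (simp add: shuffle_sign_Un_left shuffle_sign_Un_right f disj)
      then show "(case (case x of (T, U) \<Rightarrow> (U, T - U)) of (U, V) \<Rightarrow>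
          ?s U (S - U) * form_coeff a U * (?s V (S - U - V) *
          form_coeff b V * form_coeff c (S - U - V))) =
        (case x of (T, U) \<Rightarrow> ?s T (S - T) * (?s U (T - U) * form_coeff a U *
          form_coeff b (T - U)) * form_coeff c (S - T))"
        unfolding x(1) prod.case eqs(3,4,5)
        by (simp add: algebra_simps)
    qed auto
    also have "\<dots> = (\<Sum>U\<in>Pow S. \<Sum>V\<in>Pow (S - U). ?s U (S - U) * form_coeff a U *
        (?s V (S - U - V) * form_coeff b V * form_coeff c (S - U - V)))"
      using S by (subst sum.Sigma) auto
    also have "\<dots> = form_coeff (a * (b * c)) S"
      by (simp add: times_form.rep_eq sum_distrib_left)
    finally show "form_coeff (a * b * c) S = form_coeff (a * (b * c)) S" .
  qed
  show "a + b + c = a + (b + c)"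
    by (rule form_eqI) (simp add: plus_form.rep_eq)
  show "a + b = b + a"
    by (rule form_eqI) (simp add: plus_form.rep_eq)
  show "0 + a = a"
    by (rule form_eqI) (simp add: plus_form.rep_eq zero_form.rep_eq)
  show "- a + a = 0"
    by (rule form_eqI) (simp add: plus_form.rep_eq uminus_form.rep_eq zero_form.rep_eq)
  show "a - b = a + - b"
    by (rule form_eqI) (simp add: plus_form.rep_eq uminus_form.rep_eq minus_form.rep_eq)
  show "1 * a = a"
  proof (rule form_eqI)
    fix S :: "(nat \<times> nat) set"
    assume S: "finite S"
    have "form_coeff (1 * a) S = (\<Sum>T\<in>{{} :: (nat \<times> nat) set}. form_coeff a S)"
      unfolding times_form.rep_eq one_form.rep_eq
      using S by (intro sum.mono_neutral_cong_right) auto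
    then show "form_coeff (1 * a) S = form_coeff a S" by simp
  qed
  show "a * 1 = a"
  proof (rule form_eqI)
    fix S :: "(nat \<times> nat) set"
    assume S: "finite S"
    have "form_coeff (a * 1) S = (\<Sum>T\<in>{S}. form_coeff a S)"
      unfolding times_form.rep_eq one_form.rep_eq
      using S by (intro sum.mono_neutral_cong_right) auto
    then show "form_coeff (a * 1) S = form_coeff a S" by simp
  qed
  show "(a + b) * c = a * c + b * c"
    by (rule form_eqI) (simp add: plus_form.rep_eq times_form.rep_eq algebra_simps sum.distrib)
  show "a * (b + c) = a * b + a * c"
    by (rule form_eqI) (simp add: plus_form.rep_eq times_form.rep_eq algebra_simps sum.distrib)
  have "form_coeff (0 :: 'a form) {} \<noteq> form_coeff 1 {}"
    by (simp add: zero_form.rep_eq one_form.rep_eq)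
  then show "(0 :: 'a form) \<noteq> 1" by metis
qed

end

lift_definition scalar_form :: "'a::comm_ring_1 \<Rightarrow> 'a form" is "\<lambda>c S. if S = {} then c else 0"
  by auto

lift_definition form_gen :: "nat \<times> nat \<Rightarrow> 'a::comm_ring_1 form" is
  "\<lambda>p S. if S = {p} then 1 else 0"
  by auto

lemma form_gen_squared: "form_gen p * form_gen p = (0 :: 'a::comm_ring_1 form)"
  by (rule form_eqI)
    (auto simp: times_form.rep_eq form_gen.rep_eq zero_form.rep_eq intro!: sum.neutral)

lemma form_gen_anticommute:
  assumes "p \<noteq> q"
  shows "form_gen p * form_gen q = - (form_gen q * form_gen p :: 'a::comm_ring_1 form)"
proof (rule form_eqI)
  have ord: "(p, q) \<in> pair_less \<longleftrightarrow> (q, p) \<notin> pair_less"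
    using assms by (cases p; cases q) (auto simp: pair_less_def)
  have *: "form_coeff (form_gen x * form_gen y :: 'a form) S =
      (if S = {x, y} then shuffle_sign {x} {y} else 0)"
    if "x \<noteq> y" "finite S" for x y S
  proof (cases "S = {x, y}")
    case True
    have "form_coeff (form_gen x * form_gen y :: 'a form) S =
        (\<Sum>T\<in>{{x}}. shuffle_sign {x} {y})"
      unfolding times_form.rep_eq form_gen.rep_eq
      using that True by (intro sum.mono_neutral_cong_right) auto
    then show ?thesis using True by simp
  next
    case False
    then have "\<not> (T = {x} \<and> S - T = {y})" if "T \<in> Pow S" for T using that by auto
    then show ?thesis using False
      by (simp add: times_form.rep_eq form_gen.rep_eq) (rule sum.neutral, auto)
  qed
  have **: "(shuffle_sign {x} {y} :: 'a) = (if (y, x) \<in> pair_less then - 1 else 1)" for x y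
  proof -
    have "{(t, u). t \<in> {x} \<and> u \<in> {y} \<and> (u, t) \<in> pair_less} =
        (if (y, x) \<in> pair_less then {(x, y)} else {})" by auto
    then show ?thesis by (simp add: shuffle_sign_def)
  qed
  fix S :: "(nat \<times> nat) set"
  assume "finite S"
  then show "form_coeff (form_gen p * form_gen q :: 'a form) S =
      form_coeff (- (form_gen q * form_gen p)) S"
    using assms ord by (auto simp: uminus_form.rep_eq * ** insert_commute)
qed

section \<open>The forms on symmetric matrices\<close>

text \<open>
  Rows and columns are numbered from \<open>0\<close>. The differentials of the entries of a generic symmetric
  matrix satisfy \<open>da\<^sub>i\<^sub>j = da\<^sub>j\<^sub>i\<close> and those with \<open>i \<le> j\<close> are linearly independent, so \<open>da i j\<close> is
  the generator indexed by the sorted pair; the generators \<open>form_gen (i, j)\<close> with \<open>i > j\<close> are not used.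
\<close>

definition da :: "nat \<Rightarrow> nat \<Rightarrow> 'a::comm_ring_1 form" where
  "da i j = form_gen (min i j, max i j)"

definition dA :: "nat \<Rightarrow> 'a::comm_ring_1 form mat" where
  "dA n = mat n n (\<lambda>(i, j). da i j)"

definition mat_trace :: "'a::comm_monoid_add mat \<Rightarrow> 'a" where
  "mat_trace M = (\<Sum>i<dim_row M. M $$ (i, i))"

text \<open>\<open>trace_form A r\<close> is \<open>tr ((A\<^sup>-\<^sup>1 dA)\<^sup>r)\<close>, for invertible \<open>A\<close>.\<close>

definition trace_form :: "'a::field mat \<Rightarrow> nat \<Rightarrow> 'a form" where
  "trace_form A r =
    mat_trace ((map_mat scalar_form (the (mat_inverse A)) * dA (dim_row A)) ^\<^sub>m r)"

text \<open>Linear combinations of wedge monomials, each with fewer than \<open>d\<close> diagonal factors.\<close>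

definition diag_degree_less :: "nat \<Rightarrow> nat \<Rightarrow> 'a::comm_ring_1 form set" where
  "diag_degree_less n d = {\<Sum>w\<in>W. scalar_form (c w) * (\<Prod>(i, j)\<leftarrow>w. da i j) | W c.
     finite W \<and>
     (\<forall>w\<in>W. (\<forall>(i, j)\<in>set w. i \<le> j \<and> j < n) \<and> length (filter (\<lambda>(i, j). i = j) w) < d)}"

definition diag_pairs :: "nat \<Rightarrow> (nat \<times> nat) set" where
  "diag_pairs n = {(i, i) | i. i < n}"

definition upper_pairs :: "nat \<Rightarrow> (nat \<times> nat) set" where
  "upper_pairs n = {(i, j). i < j \<and> j < n}"

definition incidence_mat :: "nat \<Rightarrow> (nat \<times> nat) list \<Rightarrow> int mat" where
  "incidence_mat n v = mat (length v) (2 * n)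
     (\<lambda>(r, c). if c = fst (v ! r) then - 1 else if c = n + snd (v ! r) then 1 else 0)"

text \<open>
  \<open>omega_seq n v k\<close> is the form attached to the ordering \<open>v\<close> and the deleted column \<open>k\<close>. As \<open>k\<close> is
  counted from \<open>0\<close>, the usual sign exponent \<open>binomial(n, 2) + k - 1\<close> becomes \<open>(n choose 2) + k\<close>.
  The result does not depend on the ordering and the column, so that \<open>omega\<close> may use any choice.
\<close>

definition omega_seq :: "nat \<Rightarrow> (nat \<times> nat) list \<Rightarrow> nat \<Rightarrow> 'a::comm_ring_1 form" where
  "omega_seq n v k =
     of_int ((- 1) ^ ((n choose 2) + k) * det (submatrix (incidence_mat n v) UNIV (- {k}))) *
     (\<Prod>(i, j)\<leftarrow>v. da i j)"

definition omega :: "nat \<Rightarrow> (nat \<times> nat) set \<Rightarrow> 'a::comm_ring_1 form" where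
  "omega n \<nu> = (SOME w. \<exists>v k. distinct v \<and> set v = \<nu> \<and> k < 2 * n \<and> w = omega_seq n v k)"

section \<open>The polynomials \<open>Q\<^sub>k\<close>\<close>

text \<open>
  The sum of the entries is formed with \<open>Suc\<close>, so that \<open>tuple_sign\<close> is
  \<open>(-1) ^ (k\<^sub>1 + \<dots> + k\<^sub>p) * sgn \<pi>\<close> for labels counted from \<open>1\<close>.
\<close>

definition sorting_perm :: "nat list \<Rightarrow> nat \<Rightarrow> nat" where
  "sorting_perm K = (THE \<pi>. \<pi> permutes {..<length K} \<and> sorted (permute_list \<pi> K))"

definition tuple_sign :: "nat list \<Rightarrow> int" where
  "tuple_sign K = (if distinct K then (- 1) ^ sum_list (map Suc K) * sign (sorting_perm K) else 0)"

definition sub_tuple :: "(nat \<times> nat) list \<Rightarrow> nat set \<Rightarrow> nat list" where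
  "sub_tuple E I = concat (map (\<lambda>(s, t). [s, t]) (nths E I))"

definition delete_rows_cols :: "'a mat \<Rightarrow> nat list \<Rightarrow> nat list \<Rightarrow> 'a mat" where
  "delete_rows_cols A K L = submatrix A (- set K) (- set L)"

text \<open>
  An element of \<open>pairings m k\<close> is a set of \<open>k\<close> unordered pairs \<open>{I, J}\<close>. Since the parts are
  non-empty and disjoint, the entries of an unordered \<open>k\<close>-tuple are automatically distinct, as are
  the two sets in a pair.
\<close>

definition pairings :: "nat \<Rightarrow> nat \<Rightarrow> nat set set set set" where
  "pairings m k = {P. card P = k \<and> disjoint P \<and>
     (\<forall>p\<in>P. \<exists>I J. p = {I, J} \<and> I \<noteq> J \<and> card I = card J) \<and> partition_on {..<m} (\<Union>P)}"

text \<open>For symmetric \<open>A\<close> the factor attached to \<open>{I, J}\<close> is symmetric in \<open>I\<close> and \<open>J\<close>.\<close>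

definition pair_factor :: "'a::comm_ring_1 mat \<Rightarrow> (nat \<times> nat) list \<Rightarrow> nat set set \<Rightarrow> 'a" where
  "pair_factor A E p = (let (I, J) = (SOME (I, J). p = {I, J}) in
     of_int (tuple_sign (sub_tuple E I) * tuple_sign (sub_tuple E J)) *
     det (delete_rows_cols A (sub_tuple E I) (sub_tuple E J)))"

definition Q_poly :: "nat \<Rightarrow> 'a::comm_ring_1 mat \<Rightarrow> (nat \<times> nat) list \<Rightarrow> 'a" where
  "Q_poly k A E = (\<Sum>P\<in>pairings (length E) k. \<Prod>p\<in>P. pair_factor A E p)"

text \<open>The subring generated by the entries of \<open>A\<close>; a polynomial ring when these are generic.\<close>

inductive_set int_polys :: "'a::comm_ring_1 mat \<Rightarrow> 'a set" for A where
  entry: "i < dim_row A \<Longrightarrow> j < dim_col A \<Longrightarrow> A $$ (i, j) \<in> int_polys A"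
| const: "of_int c \<in> int_polys A"
| add: "p \<in> int_polys A \<Longrightarrow> q \<in> int_polys A \<Longrightarrow> p + q \<in> int_polys A"
| mult: "p \<in> int_polys A \<Longrightarrow> q \<in> int_polys A \<Longrightarrow> p * q \<in> int_polys A"

end

theory Submission
  imports Defs "HOL-Computational_Algebra.Formal_Power_Series"
begin

text \<open>
  Write \<open>B\<close> for the inverse of \<open>A\<close>, \<open>D\<close> for the matrix of differentials, \<open>X = B D\<close> and \<open>m = n - 1\<close>.

  The entries of \<open>X\<close> are odd, those of \<open>Y = X\<^sup>2 = B (D B D)\<close> are even, so \<open>Y\<close> is a matrix over a
  commutative ring. As in Rosset's proof of the theorem of Amitsur and Levitzki, moving odd forms
  cyclically shows that every positive power of \<open>Y\<close> has trace zero. In characteristic \<open>0\<close> this makes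
  \<open>det (A - t D B D)\<close> constant in \<open>t\<close>, and the coefficient of \<open>t\<^bsup>n-1\<^esup>\<close> in the adjugate of this pencil
  expresses \<open>X\<^bsup>2n-2\<^esup> = Y\<^bsup>n-1\<^esup>\<close> by the adjugate of \<open>D B D\<close> (\<open>adj_mat_pencil\<close>). Therefore the trace of
  \<open>X\<^bsup>2n-1\<^esup>\<close> is, up to sign, \<open>1 / det A\<close> times the sum of all \<open>da\<^sub>j\<^sub>k adj (D B D)\<^sub>k\<^sub>j\<close>
  (\<open>trace_form_eq_adj\<close>). The matrix \<open>D B D\<close> is antisymmetric. If \<open>n\<close> is even, so is its adjugate, and
  the sum vanishes because \<open>D\<close> is symmetric.

  Let \<open>n\<close> be odd. Only monomials with all \<open>n\<close> diagonal differentials and one differential for each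
  edge of a set \<open>E\<close> of \<open>m\<close> edges have to be studied. Expand the cofactors: each row index carries a left
  factor and each column index a right factor of \<open>D B D\<close>. Sorting the anticommuting right factors
  cancels the signs of the permutations, so that the entries of \<open>B\<close> combine to a permanent. It
  depends on the multisets of its row and column labels only; these are the heads and the tails of
  the edges, so the permanent is a common factor (\<open>slot_sum_eq\<close>). The remaining signed count is the
  sum of the Laplace expansions of an incidence determinant along each of its \<open>2n - 1\<close> rows, with a
  deleted column that depends on the row. The deleted column changes nothing but a sign, as the
  rows of the incidence matrix sum to zero. This explains the factor \<open>2n - 1\<close> and the form \<open>omega\<close>.
  Finally \<open>da\<^sub>s\<^sub>t = da\<^sub>t\<^sub>s\<close> means that all orientations of the edges have to be added; reversing an edge
  negates the incidence determinant. The coefficient is \<open>(2n - 1) P(E) / det A\<close>, where \<open>P(E)\<close> is the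
  signed sum over all orientations of \<open>E\<close> of the permanents of \<open>B\<close> (\<open>adj_trace_top_coeff\<close>).

  It remains to write \<open>P\<close> by minors. Let \<open>Q(E)\<close> be the sum of the minors of \<open>B\<close> with rows \<open>E\<^sub>I\<close> and
  columns \<open>E\<^sub>J\<close> over all ways to split \<open>E\<close> into \<open>I\<close> and \<open>J\<close>. Expansions along a row give \<open>P\<close> and \<open>Q\<close>
  the same recursion, with opposite signs when an edge is added, so the convolution of \<open>P\<close> and \<open>Q\<close>
  vanishes on non-empty sets (\<open>split_minors_convolution\<close>). In other words, with commuting variables
  \<open>\<theta>\<^sub>e\<close> of square zero and \<open>S\<close> the antisymmetric matrix with the entries \<open>\<theta>\<^sub>e\<close> at the edges, the
  generating functions of \<open>Q\<close> and \<open>P\<close> are \<open>det (1 + S B)\<close> and its reciprocal. If \<open>2 F\<close> is the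
  non-constant part of the former, with \<open>F\<close> running over unordered pairs, then
  \<open>1 / (1 + 2 F) = \<Sum> (- 2)\<^sup>k F\<^sup>k\<close>, and \<open>F\<^sup>k\<close> counts each unordered \<open>k\<close>-tuple \<open>k!\<close> times
  (\<open>convolution_inverse\<close>). Jacobi's identity turns the minors of \<open>B\<close> into complementary minors of \<open>A\<close>
  (\<open>complementary_minor\<close>), at the cost of one factor \<open>1 / det A\<close> for each pair.
\<close>

section \<open>Coefficients and scalars\<close>

lemmas form_rep_eq = plus_form.rep_eq uminus_form.rep_eq minus_form.rep_eq zero_form.rep_eq

lemma form_coeff_sum: "form_coeff (sum f X) S = (\<Sum>x\<in>X. form_coeff (f x) S)"
  by (induction X rule: infinite_finite_induct) (simp_all add: form_rep_eq)

lemma form_coeff_scalar_times: "form_coeff (scalar_form c * f) S = c * form_coeff f S"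
proof (cases "finite S")
  case True
  have "form_coeff (scalar_form c * f) S =
      (\<Sum>T\<in>{{} :: (nat \<times> nat) set}. c * form_coeff f S)"
    unfolding times_form.rep_eq scalar_form.rep_eq
    using True by (intro sum.mono_neutral_cong_right) auto
  then show ?thesis by simp
qed simp

lemma form_coeff_times_scalar: "form_coeff (f * scalar_form c) S = c * form_coeff f S"
proof (cases "finite S")
  case True
  have "form_coeff (f * scalar_form c) S = (\<Sum>T\<in>{S}. c * form_coeff f S)"
    unfolding times_form.rep_eq scalar_form.rep_eq
    using True by (intro sum.mono_neutral_cong_right) auto
  then show ?thesis by simp
qed simp

lemma scalar_form_commute: "scalar_form c * f = f * scalar_form c"
  by (rule form_eqI) (simp add: form_coeff_scalar_times form_coeff_times_scalar)

lemma scalar_form_0 [simp]: "scalar_form 0 = 0"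
  and scalar_form_1 [simp]: "scalar_form 1 = 1"
  by (rule form_eqI; simp add: scalar_form.rep_eq zero_form.rep_eq one_form.rep_eq)+

lemma scalar_form_add: "scalar_form (a + b) = scalar_form a + scalar_form b"
  by (rule form_eqI) (simp add: scalar_form.rep_eq plus_form.rep_eq)

lemma scalar_form_minus: "scalar_form (- a) = - scalar_form a"
  by (rule form_eqI) (simp add: scalar_form.rep_eq uminus_form.rep_eq)

lemma scalar_form_mult: "scalar_form (a * b) = scalar_form a * scalar_form b"
  by (rule form_eqI) (simp add: form_coeff_scalar_times, simp add: scalar_form.rep_eq)

lemma of_nat_form: "of_nat k = scalar_form (of_nat k)"
  by (induction k) (simp_all add: scalar_form_add)

lemma of_int_form: "of_int k = scalar_form (of_int k)"
  by (cases k rule: int_cases2) (simp_all add: of_nat_form scalar_form_minus)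

section \<open>Homogeneous forms and their supports\<close>

definition homogeneous :: "(nat \<times> nat) set \<Rightarrow> nat \<Rightarrow> 'a::comm_ring_1 form \<Rightarrow> bool" where
  "homogeneous V d f \<longleftrightarrow> (\<forall>S. form_coeff f S \<noteq> 0 \<longrightarrow> S \<subseteq> V \<and> card S = d)"

lemma homogeneous_0 [simp]: "homogeneous V d 0"
  by (simp add: homogeneous_def zero_form.rep_eq)

lemma homogeneous_scalar: "homogeneous V 0 (scalar_form c)"
  by (simp add: homogeneous_def scalar_form.rep_eq)

lemma homogeneous_gen: "p \<in> V \<Longrightarrow> homogeneous V 1 (form_gen p)"
  by (simp add: homogeneous_def form_gen.rep_eq)

lemma homogeneous_sum:
  "(\<And>x. x \<in> X \<Longrightarrow> homogeneous V d (f x)) \<Longrightarrow> homogeneous V d (sum f X)"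
  unfolding homogeneous_def form_coeff_sum
    by (metis (mono_tags, lifting) sum.not_neutral_contains_not_neutral)

lemma form_coeff_mult_nonzero:
  assumes "form_coeff (f * g) S \<noteq> 0"
  obtains T where "T \<subseteq> S" "form_coeff f T \<noteq> 0" "form_coeff g (S - T) \<noteq> 0"
    "card S = card T + card (S - T)"
proof -
  have fin: "finite S" using assms by (metis form_coeff_infinite)
  from assms obtain T where T: "T \<subseteq> S" "form_coeff f T \<noteq> 0" "form_coeff g (S - T) \<noteq> 0"
    unfolding times_form.rep_eq
    by (metis (no_types, lifting) PowD mult_zero_left mult_zero_right
        sum.not_neutral_contains_not_neutral)
  have "card S = card T + card (S - T)"
    using T(1) fin by (metis card_Diff_subset card_mono finite_subset le_add_diff_inverse)
  with T show ?thesis by (rule that)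
qed

lemma homogeneous_mult:
  assumes "homogeneous V d f" "homogeneous V e g"
  shows "homogeneous V (d + e) (f * g)"
  using assms unfolding homogeneous_def
  by (metis Diff_partition Un_least form_coeff_mult_nonzero)

text \<open>
  Of the pairs \<open>(t, u)\<close> and \<open>(u, t)\<close> exactly one is out of order, so the two inversion counts add up
  to \<open>card T * card U\<close>.
\<close>

lemma shuffle_sign_commute:
  fixes T U :: "(nat \<times> nat) set"
  assumes "finite T" "finite U" "T \<inter> U = {}"
  shows "shuffle_sign T U = (- 1) ^ (card T * card U) * (shuffle_sign U T :: 'a::comm_ring_1)"
proof -
  let ?a = "{(t, u). t \<in> T \<and> u \<in> U \<and> (u, t) \<in> pair_less}"
  let ?b = "{(u, t). u \<in> U \<and> t \<in> T \<and> (t, u) \<in> pair_less}"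
  have ord: "(p, q) \<in> pair_less \<longleftrightarrow> (q, p) \<notin> pair_less" if "p \<noteq> q" for p q :: "nat \<times> nat"
    using that by (cases p; cases q) (auto simp: pair_less_def)
  have swap: "x \<in> prod.swap ` ?b \<longleftrightarrow> fst x \<in> T \<and> snd x \<in> U \<and> x \<in> pair_less" for x
    by (cases x) force
  have neq: "fst x \<noteq> snd x" if "fst x \<in> T" "snd x \<in> U" for x :: "(nat \<times> nat) \<times> (nat \<times> nat)"
    using that assms(3) by auto
  have un: "T \<times> U = ?a \<union> prod.swap ` ?b"
  proof (rule Set.set_eqI)
    fix x show "x \<in> T \<times> U \<longleftrightarrow> x \<in> ?a \<union> prod.swap ` ?b"
      unfolding Un_iff swap using ord[OF neq[of x]] by (cases x) auto
  qed
  have dj: "?a \<inter> prod.swap ` ?b = {}"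
  proof (rule ccontr)
    assume "?a \<inter> prod.swap ` ?b \<noteq> {}"
    then obtain x where "x \<in> ?a" "x \<in> prod.swap ` ?b" by blast
    then show False unfolding swap using ord[OF neq[of x]] by (cases x) auto
  qed
  have fin: "finite ?a" "finite ?b" using finite_inversions assms by auto
  have "card T * card U = card ?a + card ?b"
    unfolding card_cartesian_product[symmetric] un
    using fin dj by (subst card_Un_disjoint) (auto simp: card_image)
  then have "(- 1) ^ (card T * card U) * (shuffle_sign U T :: 'a) =
      (- 1) ^ card ?a * ((- 1) ^ card ?b * (- 1) ^ card ?b)"
    by (simp add: shuffle_sign_def power_add mult.assoc)
  also have "((- 1) ^ card ?b * (- 1) ^ card ?b :: 'a) = 1"
    by (simp flip: power_add)
  finally show ?thesis by (simp add: shuffle_sign_def)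
qed

text \<open>
  The common source of graded commutativity and of the commutativity of even forms: two forms
  commute up to the sign by which all their monomials do.
\<close>

lemma form_mult_swap:
  fixes f g :: "'a::comm_ring_1 form"
  assumes "\<And>T U. form_coeff f T \<noteq> 0 \<Longrightarrow> form_coeff g U \<noteq> 0 \<Longrightarrow> (- 1) ^ (card T * card U) = c"
  shows "f * g = scalar_form c * (g * f)"
proof (rule form_eqI)
  fix S :: "(nat \<times> nat) set"
  assume S: "finite S"
  have "form_coeff (f * g) S =
      (\<Sum>T\<in>Pow S. c * (shuffle_sign (S - T) T * form_coeff g (S - T) * form_coeff f T))"
    unfolding times_form.rep_eq
  proof (rule sum.cong)
    fix T assume "T \<in> Pow S"
    then have T: "T \<subseteq> S" "finite T" using S finite_subset by auto
    show "shuffle_sign T (S - T) * form_coeff f T * form_coeff g (S - T) =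
       c * (shuffle_sign (S - T) T * form_coeff g (S - T) * form_coeff f T)"
    proof (cases "form_coeff f T = 0 \<or> form_coeff g (S - T) = 0")
      case False
      then have "(- 1) ^ (card T * card (S - T)) = c" using assms by blast
      then show ?thesis
        using shuffle_sign_commute[of T "S - T", where ?'a = 'a] T S by (simp add: mult_ac)
    qed auto
  qed simp
  also have "\<dots> = (\<Sum>T\<in>Pow S. c * (shuffle_sign T (S - T) * form_coeff g T * form_coeff f (S - T)))"
    by (rule sum.reindex_bij_witness[of _ "\<lambda>T. S - T" "\<lambda>T. S - T"])
      (auto simp: double_diff)
  also have "\<dots> = form_coeff (scalar_form c * (g * f)) S"
    unfolding form_coeff_scalar_times by (simp add: times_form.rep_eq sum_distrib_left)
  finally show "form_coeff (f * g) S = form_coeff (scalar_form c * (g * f)) S" .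
qed

lemma minus_one_power_form: "((- 1) ^ k :: 'a::comm_ring_1 form) = scalar_form ((- 1) ^ k)"
  by (cases "even k") (simp_all add: scalar_form_minus)

lemma graded_commute:
  assumes "homogeneous V d f" "homogeneous W e g"
  shows "f * g = (- 1) ^ (d * e) * (g * f :: 'a::comm_ring_1 form)"
  unfolding minus_one_power_form
  by (rule form_mult_swap) (use assms in \<open>simp add: homogeneous_def\<close>)

section \<open>The commutative ring of even forms\<close>

definition even_form :: "'a::comm_ring_1 form \<Rightarrow> bool" where
  "even_form f \<longleftrightarrow> (\<forall>S. form_coeff f S \<noteq> 0 \<longrightarrow> even (card S))"

lemma even_form_mult: "even_form f \<Longrightarrow> even_form g \<Longrightarrow> even_form (f * g)"
  unfolding even_form_def by (metis even_add form_coeff_mult_nonzero)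

lemma even_form_commute:
  assumes "even_form f" "even_form g"
  shows "f * g = g * f"
  using form_mult_swap[of f g 1] assms by (simp add: even_form_def)

text \<open>
  Determinants and adjugates need commutative entries. The entries of \<open>dA B dA\<close> lie in this ring.
\<close>

typedef (overloaded) 'a eform = "{f :: 'a::comm_ring_1 form. even_form f}"
  morphisms form_of_even even_of_form
  by (rule exI[of _ 0]) (simp add: even_form_def zero_form.rep_eq)

setup_lifting type_definition_eform

instantiation eform :: (comm_ring_1) comm_ring_1
begin

lift_definition zero_eform :: "'a eform" is 0
  by (simp add: even_form_def zero_form.rep_eq)

lift_definition one_eform :: "'a eform" is 1
  by (simp add: even_form_def one_form.rep_eq)

lift_definition plus_eform :: "'a eform \<Rightarrow> 'a eform \<Rightarrow> 'a eform" is "(+)"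
  by (simp add: even_form_def plus_form.rep_eq) (metis add.right_neutral)

lift_definition uminus_eform :: "'a eform \<Rightarrow> 'a eform" is uminus
  by (simp add: even_form_def uminus_form.rep_eq)

lift_definition minus_eform :: "'a eform \<Rightarrow> 'a eform \<Rightarrow> 'a eform" is "(-)"
  by (simp add: even_form_def minus_form.rep_eq) (metis diff_zero diff_self)

lift_definition times_eform :: "'a eform \<Rightarrow> 'a eform \<Rightarrow> 'a eform" is "(*)"
  by (rule even_form_mult)

instance
  by standard (transfer; simp add: algebra_simps even_form_commute)+

end

lift_definition even_scalar :: "'a::comm_ring_1 \<Rightarrow> 'a eform" is scalar_form
  by (simp add: even_form_def scalar_form.rep_eq)

lemma form_of_even_sum: "form_of_even (sum f X) = (\<Sum>x\<in>X. form_of_even (f x))"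
  by (induction X rule: infinite_finite_induct) (simp_all add: zero_eform.rep_eq plus_eform.rep_eq)

lemma form_of_even_prod:
  "form_of_even (\<Prod>i = 0..<m. f i) = prod_list (map (\<lambda>i. form_of_even (f i)) [0..<m])"
  by (induction m) (simp_all add: one_eform.rep_eq times_eform.rep_eq)

lemma form_of_even_minus_one_power:
  "form_of_even ((- 1) ^ k) = (- 1) ^ k"
  by (induction k) (simp_all add: one_eform.rep_eq times_eform.rep_eq uminus_eform.rep_eq)

interpretation even_scalar: comm_ring_hom "even_scalar :: 'a::comm_ring_1 \<Rightarrow> 'a eform"
  by unfold_locales (transfer; simp add: scalar_form_add scalar_form_mult)+

interpretation form_of_even: ring_hom "form_of_even :: 'a::comm_ring_1 eform \<Rightarrow> 'a form"
  by unfold_locales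
    (simp_all add: zero_eform.rep_eq one_eform.rep_eq plus_eform.rep_eq times_eform.rep_eq)

lemma form_torsion_free:
  fixes f :: "'a::field_char_0 form"
  assumes "of_nat k * f = 0" "k \<noteq> 0"
  shows "f = 0"
proof (rule form_eqI)
  fix S :: "(nat \<times> nat) set"
  have "of_nat k * form_coeff f S = form_coeff (of_nat k * f) S"
    unfolding of_nat_form by (simp add: form_coeff_scalar_times)
  then show "form_coeff f S = form_coeff 0 S"
    using assms by (simp add: zero_form.rep_eq)
qed

lemma eform_torsion_free:
  fixes f :: "'a::field_char_0 eform"
  assumes "of_nat k * f = 0" "k \<noteq> 0"
  shows "f = 0"
proof -
  have "of_nat k * form_of_even f = 0"
    using arg_cong[OF assms(1), of form_of_even]
    by (simp add: times_eform.rep_eq zero_eform.rep_eq form_of_even.hom_of_nat)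
  then show ?thesis
    using form_torsion_free[OF _ assms(2)] by (metis form_of_even_inject zero_eform.rep_eq)
qed

section \<open>Adjugates of matrices with vanishing power traces\<close>

lemma fps_deriv_prod:
  fixes f :: "'b \<Rightarrow> 'r::comm_ring_1 fps"
  assumes "finite S"
  shows "fps_deriv (prod f S) = (\<Sum>a\<in>S. fps_deriv (f a) * prod f (S - {a}))"
  using assms
proof (induction S)
  case (insert x S)
  have "(\<Sum>a\<in>S. fps_deriv (f a) * prod f (insert x S - {a})) =
      (\<Sum>a\<in>S. fps_deriv (f a) * prod f (S - {a})) * f x"
    unfolding sum_distrib_right
  proof (rule sum.cong)
    fix a assume "a \<in> S"
    then have "insert x S - {a} = insert x (S - {a})" using insert.hyps by auto
    then show "fps_deriv (f a) * prod f (insert x S - {a}) = fps_deriv (f a) * prod f (S - {a}) * f x"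
      using insert.hyps by (simp add: mult_ac)
  qed simp
  then show ?case using insert by (simp add: algebra_simps)
qed simp

lemma fps_deriv_signof: "fps_deriv (signof p * f) = signof p * fps_deriv (f :: 'r::comm_ring_1 fps)"
  by (cases p rule: sign_cases) simp_all

text \<open>
  Jacobi's formula. The Leibniz rule differentiates one row at a time, and the determinant with row
  \<open>i\<close> differentiated expands along this row with the cofactors of the original matrix.
\<close>

lemma fps_deriv_det:
  fixes M :: "'r::comm_ring_1 fps mat"
  assumes M: "M \<in> carrier_mat n n"
  shows "fps_deriv (det M) = (\<Sum>i<n. \<Sum>j<n. fps_deriv (M $$ (i, j)) * cofactor M i j)"
proof -
  define R where "R i = mat n n (\<lambda>(l, j). if l = i then fps_deriv (M $$ (l, j)) else M $$ (l, j))" for i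
  have R: "R i \<in> carrier_mat n n" for i by (simp add: R_def)
  let ?P = "{p. p permutes {0..<n}}"
  have lt: "p i < n" if "p permutes {0..<n}" "i < n" for p i
    using permutes_in_image[OF that(1), of i] that(2) by simp
  have "fps_deriv (det M) =
      (\<Sum>p\<in>?P. \<Sum>i<n. signof p * (fps_deriv (M $$ (i, p i)) * (\<Prod>l\<in>{0..<n} - {i}. M $$ (l, p l))))"
    by (simp add: det_def'[OF M] fps_deriv_sum fps_deriv_signof fps_deriv_prod sum_distrib_left
        lessThan_atLeast0)
  also have "\<dots> = (\<Sum>i<n. \<Sum>p\<in>?P. signof p * (\<Prod>l\<in>{0..<n}. R i $$ (l, p l)))"
  proof (subst sum.swap, intro sum.cong refl)
    fix i p assume i: "i \<in> {..<n}" and p: "p \<in> ?P"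
    have "(\<Prod>l\<in>{0..<n}. R i $$ (l, p l)) = R i $$ (i, p i) * (\<Prod>l\<in>{0..<n} - {i}. R i $$ (l, p l))"
      using i by (subst prod.remove[of _ i]) auto
    also have "\<dots> = fps_deriv (M $$ (i, p i)) * (\<Prod>l\<in>{0..<n} - {i}. M $$ (l, p l))"
      using i p lt by (auto simp: R_def intro!: arg_cong2[where f = "(*)"] prod.cong)
    finally show "signof p * (fps_deriv (M $$ (i, p i)) * (\<Prod>l\<in>{0..<n} - {i}. M $$ (l, p l))) =
        signof p * (\<Prod>l\<in>{0..<n}. R i $$ (l, p l))" by simp
  qed
  also have "\<dots> = (\<Sum>i<n. det (R i))"
    by (simp add: det_def'[OF R])
  also have "\<dots> = (\<Sum>i<n. \<Sum>j<n. fps_deriv (M $$ (i, j)) * cofactor M i j)"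
  proof (intro sum.cong refl)
    fix i assume i: "i \<in> {..<n}"
    have "cofactor (R i) i j = cofactor M i j" if "j < n" for j
    proof -
      have "mat_delete (R i) i j = mat_delete M i j"
        using M i that by (intro eq_matI) (auto simp: mat_delete_def R_def)
      then show ?thesis by (simp add: cofactor_def)
    qed
    then show "det (R i) = (\<Sum>j<n. fps_deriv (M $$ (i, j)) * cofactor M i j)"
      using i by (subst laplace_expansion_row[OF R, of i]) (auto simp: R_def)
  qed
  finally show ?thesis .
qed

text \<open>
  The top coefficient of a product of linear factors. Applied to each term of a determinant it shows
  that the top coefficient of a minor of a pencil \<open>A - t C\<close> is the same minor of \<open>- C\<close>.
\<close>

lemma fps_nth_prod_linear:
  fixes a b :: "'b \<Rightarrow> 'r::comm_ring_1"
  assumes "finite I" "k \<ge> card I"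
  shows "fps_nth (\<Prod>i\<in>I. fps_const (a i) - fps_const (b i) * fps_X) k =
    (if k = card I then \<Prod>i\<in>I. - b i else 0)"
  using assms
proof (induction I arbitrary: k)
  case (insert x I)
  then obtain k' where k: "k = Suc k'" by (cases k) auto
  let ?p = "\<Prod>i\<in>I. fps_const (a i) - fps_const (b i) * fps_X"
  have "fps_nth (\<Prod>i\<in>insert x I. fps_const (a i) - fps_const (b i) * fps_X) k =
      fps_nth (fps_const (a x) * ?p - fps_const (b x) * (fps_X * ?p)) k"
    using insert.hyps by (simp add: algebra_simps)
  also have "\<dots> = a x * fps_nth ?p k - b x * fps_nth ?p k'"
    unfolding fps_sub_nth fps_mult_left_const_nth by (simp add: k)
  finally show ?case
    using insert k by auto
qed auto

lemma pow_mat_Suc_left: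
  assumes "Y \<in> carrier_mat n n"
  shows "Y ^\<^sub>m Suc k = Y * Y ^\<^sub>m k"
proof (induction k)
  case (Suc k)
  have "Y ^\<^sub>m Suc (Suc k) = Y * Y ^\<^sub>m k * Y" using Suc by simp
  also have "\<dots> = Y * Y ^\<^sub>m Suc k"
    using assms by (simp add: assoc_mult_mat[of _ n n _ n _ n])
  finally show ?case .
qed (use assms in simp)

lemma mat_trace_mult:
  assumes "P \<in> carrier_mat n n" "Q \<in> carrier_mat n n"
  shows "mat_trace (P * Q) = (\<Sum>i<n. \<Sum>j<n. P $$ (i, j) * Q $$ (j, i))"
  using assms
  by (auto simp: mat_trace_def times_mat_def scalar_prod_def lessThan_atLeast0 intro!: sum.cong)

lemma mat_trace_commute:
  fixes P Q :: "'r::comm_ring_1 mat"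
  assumes "P \<in> carrier_mat n n" "Q \<in> carrier_mat n n"
  shows "mat_trace (P * Q) = mat_trace (Q * P)"
  unfolding mat_trace_mult[OF assms] mat_trace_mult[OF assms(2,1)]
  by (subst sum.swap) (simp add: mult.commute)

text \<open>
  Put \<open>Y = B C\<close> and \<open>M = A - t C = A (1 - t Y)\<close>, which is invertible over the power series. By Jacobi's
  formula the derivative of \<open>det M\<close> is \<open>- det M\<close> times the series of the traces of the powers of \<open>Y\<close>,
  so \<open>det M\<close> is constant. Then the adjugate of \<open>M\<close> is \<open>det A\<close> times the inverse of \<open>M\<close>, and the claim
  compares the coefficients of \<open>t\<^bsup>n-1\<^esup>\<close>.
\<close>

lemma adj_mat_pencil:
  fixes A B C :: "'r::comm_ring_1 mat"
  assumes torsion_free: "\<And>k (x :: 'r). of_nat k * x = 0 \<Longrightarrow> k \<noteq> 0 \<Longrightarrow> x = 0"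
    and A: "A \<in> carrier_mat n n" and B: "B \<in> carrier_mat n n" and C: "C \<in> carrier_mat n n"
    and AB: "A * B = 1\<^sub>m n"
    and tr: "\<And>k. mat_trace ((B * C) ^\<^sub>m Suc k) = 0"
    and n: "n \<ge> 1"
  shows "(- 1) ^ (n - 1) \<cdot>\<^sub>m adj_mat C = det A \<cdot>\<^sub>m ((B * C) ^\<^sub>m (n - 1) * B)"
proof -
  define Y where "Y = B * C"
  have Y: "Y \<in> carrier_mat n n" using B C by (simp add: Y_def)
  have Yk: "Y ^\<^sub>m k \<in> carrier_mat n n" for k using Y by simp
  have YB: "Y ^\<^sub>m k * B \<in> carrier_mat n n" for k by (rule mult_carrier_mat[OF Yk B])
  define M where "M = mat n n (\<lambda>(i, j). fps_const (A $$ (i, j)) - fps_const (C $$ (i, j)) * fps_X)"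
  \<comment> \<open>The inverse of the pencil is the geometric series in \<open>t Y\<close>, times \<open>B\<close>.\<close>
  define G where "G = mat n n (\<lambda>(i, j). Abs_fps (\<lambda>k. (Y ^\<^sub>m k * B) $$ (i, j)))"
  have M: "M \<in> carrier_mat n n" and G: "G \<in> carrier_mat n n" by (simp_all add: M_def G_def)
  have AY: "A * (Y ^\<^sub>m Suc k * B) = C * (Y ^\<^sub>m k * B)" for k
  proof -
    have "A * (Y ^\<^sub>m Suc k * B) = A * (Y * Y ^\<^sub>m k * B)"
      by (simp only: pow_mat_Suc_left[OF Y])
    also have "\<dots> = (A * Y) * (Y ^\<^sub>m k * B)"
      by (simp only: assoc_mult_mat[OF Y Yk B] assoc_mult_mat[OF A Y YB])
    also have "A * Y = C"
      using AB C by (simp add: Y_def flip: assoc_mult_mat[OF A B C])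
    finally show ?thesis .
  qed
  have entry: "(P * Q) $$ (i, j) = (\<Sum>l<n. P $$ (i, l) * Q $$ (l, j))"
    if "P \<in> carrier_mat n n" "Q \<in> carrier_mat n n" "i < n" "j < n"
    for P Q :: "'s::comm_ring_1 mat" and i j
    using that by (auto simp: times_mat_def scalar_prod_def lessThan_atLeast0 intro!: sum.cong)
  have MG: "M * G = 1\<^sub>m n"
  proof (rule eq_matI)
    fix i j assume "i < dim_row (1\<^sub>m n :: 'r fps mat)" "j < dim_col (1\<^sub>m n :: 'r fps mat)"
    then have ij: "i < n" "j < n" by auto
    have "fps_nth ((M * G) $$ (i, j)) k = fps_nth (1\<^sub>m n $$ (i, j)) k" for k
    proof (cases k)
      case 0
      have "fps_nth ((M * G) $$ (i, j)) 0 = (A * B) $$ (i, j)"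
        unfolding entry[OF M G ij] entry[OF A B ij] fps_sum_nth
        using ij B Y by (intro sum.cong refl) (simp add: M_def G_def)
      then show ?thesis using ij by (simp add: AB 0)
    next
      case (Suc k')
      have "fps_nth ((M * G) $$ (i, j)) k =
          (A * (Y ^\<^sub>m Suc k' * B)) $$ (i, j) - (C * (Y ^\<^sub>m k' * B)) $$ (i, j)"
        unfolding entry[OF M G ij] entry[OF A YB ij] entry[OF C YB ij] fps_sum_nth
          sum_subtractf[symmetric]
      proof (intro sum.cong refl)
        fix l assume "l \<in> {..<n}"
        then have "M $$ (i, l) * G $$ (l, j) = fps_const (A $$ (i, l)) * G $$ (l, j) -
            fps_const (C $$ (i, l)) * (fps_X * G $$ (l, j))"
          using ij by (simp add: M_def algebra_simps)
        then show "fps_nth (M $$ (i, l) * G $$ (l, j)) k =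
            A $$ (i, l) * (Y ^\<^sub>m Suc k' * B) $$ (l, j) - C $$ (i, l) * (Y ^\<^sub>m k' * B) $$ (l, j)"
          using \<open>l \<in> {..<n}\<close> ij unfolding fps_sub_nth fps_mult_left_const_nth
          by (simp add: Suc G_def del: pow_mat.simps)
      qed
      then show ?thesis using ij by (simp add: AY Suc del: pow_mat.simps)
    qed
    then show "(M * G) $$ (i, j) = 1\<^sub>m n $$ (i, j)" by (simp add: fps_eq_iff)
  qed (use M G in auto)
  have adjM: "adj_mat M = det M \<cdot>\<^sub>m G"
  proof -
    note adj = adj_mat[OF M]
    have "adj_mat M = adj_mat M * (M * G)" using adj(1) by (simp add: MG)
    also have "\<dots> = (adj_mat M * M) * G" using adj(1) M G by simp
    also have "\<dots> = det M \<cdot>\<^sub>m G"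
      unfolding adj(3) using G by (simp add: mult_smult_assoc_mat[of _ n n _ n])
    finally show ?thesis .
  qed
  have trace0: "(\<Sum>i<n. \<Sum>j<n. C $$ (i, j) * (Y ^\<^sub>m k * B) $$ (j, i)) = 0" for k
  proof -
    have "(\<Sum>i<n. \<Sum>j<n. C $$ (i, j) * (Y ^\<^sub>m k * B) $$ (j, i)) = mat_trace (C * (Y ^\<^sub>m k * B))"
      by (rule mat_trace_mult[OF C YB, symmetric])
    also have "\<dots> = mat_trace ((Y ^\<^sub>m k * B) * C)" by (rule mat_trace_commute[OF C YB])
    also have "(Y ^\<^sub>m k * B) * C = Y ^\<^sub>m Suc k"
      using assoc_mult_mat[OF Yk B C] by (simp add: Y_def)
    finally show ?thesis using tr[of k] by (simp add: Y_def)
  qed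
  have "fps_deriv (det M) = 0"
  proof -
    have "fps_deriv (det M) = (\<Sum>i<n. \<Sum>j<n. - fps_const (C $$ (i, j)) * adj_mat M $$ (j, i))"
      unfolding fps_deriv_det[OF M] using M
      by (intro sum.cong refl) (auto simp: M_def adj_mat_def)
    also have "\<dots> = (\<Sum>i<n. \<Sum>j<n. - fps_const (C $$ (i, j)) * (det M * G $$ (j, i)))"
      unfolding adjM using G by simp
    also have "\<dots> = - det M * (\<Sum>i<n. \<Sum>j<n. fps_const (C $$ (i, j)) * G $$ (j, i))"
      by (simp add: sum_distrib_left sum_negf mult_ac del: fps_const_neg)
    also have "(\<Sum>i<n. \<Sum>j<n. fps_const (C $$ (i, j)) * G $$ (j, i)) = 0"
      by (rule fps_ext) (simp add: fps_sum_nth G_def trace0)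
    finally show ?thesis by simp
  qed
  then have high: "fps_nth (det M) (Suc k) = 0" for k
    using torsion_free[of "Suc k" "fps_nth (det M) (Suc k)"]
    by (metis Suc_eq_plus1 fps_deriv_nth fps_zero_nth nat.distinct(1))
  have hom0: "comm_ring_hom (\<lambda>f :: 'r fps. fps_nth f 0)"
    by unfold_locales simp_all
  have "fps_nth (det M) 0 = det (map_mat (\<lambda>f. fps_nth f 0) M)"
    by (rule comm_ring_hom.hom_det[OF hom0, symmetric])
  also have "map_mat (\<lambda>f. fps_nth f 0) M = A"
    using A by (intro eq_matI) (auto simp: M_def)
  finally have detM: "det M = fps_const (det A)"
    by (intro fps_ext) (metis high fps_nth_fps_const not0_implies_Suc)
  define Z where "Z = (B * C) ^\<^sub>m (n - 1) * B"
  have Z: "Z \<in> carrier_mat n n" using YB by (simp add: Z_def Y_def)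
  have "(- 1) ^ (n - 1) \<cdot>\<^sub>m adj_mat C = det A \<cdot>\<^sub>m Z"
  proof (rule eq_matI)
    fix i j
    assume "i < dim_row (det A \<cdot>\<^sub>m Z)" "j < dim_col (det A \<cdot>\<^sub>m Z)"
    then have ij: "i < n" "j < n" using Z by auto
    let ?N = "mat_delete M j i" and ?C = "mat_delete C j i"
    have N: "?N \<in> carrier_mat (n - 1) (n - 1)" and C': "?C \<in> carrier_mat (n - 1) (n - 1)"
      using M C by (auto intro: mat_delete_carrier)
    have top: "fps_nth (det ?N) (n - 1) = (- 1) ^ (n - 1) * det ?C"
    proof -
      have "fps_nth (det ?N) (n - 1) =
          (\<Sum>p | p permutes {0..<n - 1}. signof p * (\<Prod>l = 0..<n - 1. - ?C $$ (l, p l)))"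
        unfolding det_def'[OF N] fps_sum_nth
      proof (intro sum.cong refl)
        fix p assume p: "p \<in> {p. p permutes {0..<n - 1}}"
        define i' where "i' l = insert_index j l" for l
        define j' where "j' l = insert_index i l" for l
        have lt: "p l < n - 1" if "l < n - 1" for l
          using permutes_in_image[of p "{0..<n - 1}" l] p that by auto
        have ins: "insert_index a l < n" if "l < n - 1" for a l
          using that by (auto simp: insert_index_def)
        have "(\<Prod>l = 0..<n - 1. ?N $$ (l, p l)) =
            (\<Prod>l = 0..<n - 1. fps_const (A $$ (i' l, j' (p l))) - fps_const (?C $$ (l, p l)) * fps_X)"
        proof (intro prod.cong refl)
          fix l assume l: "l \<in> {0..<n - 1}"
          show "?N $$ (l, p l) = fps_const (A $$ (i' l, j' (p l))) - fps_const (?C $$ (l, p l)) * fps_X"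
            using mat_delete_index[of M "n - 1" j i l "p l"] mat_delete_index[of C "n - 1" j i l "p l"]
              M C l lt[of l] ij n ins[of l j] ins[of "p l" i]
            by (simp add: i'_def j'_def) (simp add: M_def)
        qed
        then have prod: "fps_nth (\<Prod>l = 0..<n - 1. ?N $$ (l, p l)) (n - 1) =
            (\<Prod>l = 0..<n - 1. - ?C $$ (l, p l))"
          by (simp add: fps_nth_prod_linear)
        show "fps_nth (signof p * (\<Prod>l = 0..<n - 1. ?N $$ (l, p l))) (n - 1) =
            signof p * (\<Prod>l = 0..<n - 1. - ?C $$ (l, p l))"
          unfolding prod[symmetric] by (cases p rule: sign_cases) simp_all
      qed
      also have "\<dots> = (- 1) ^ (n - 1) * det ?C"
        unfolding det_def'[OF C'] sum_distrib_left by (simp add: prod_uminus mult_ac)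
      finally show ?thesis .
    qed
    have sgn: "fps_nth ((- 1) ^ e * f) k = (- 1) ^ e * fps_nth f k" for e k and f :: "'r fps"
      by (cases "even e") simp_all
    have "fps_nth (adj_mat M $$ (i, j)) (n - 1) = (- 1) ^ (n - 1) * adj_mat C $$ (i, j)"
    proof -
      have "fps_nth (adj_mat M $$ (i, j)) (n - 1) = (- 1) ^ (j + i) * fps_nth (det ?N) (n - 1)"
        using ij M by (simp add: adj_mat_def cofactor_def sgn)
      then show ?thesis
        unfolding top using ij C by (simp add: adj_mat_def cofactor_def)
    qed
    moreover have "fps_nth (adj_mat M $$ (i, j)) (n - 1) = det A * Z $$ (i, j)"
      using ij unfolding adjM detM by (simp add: G_def Z_def Y_def)
    ultimately show "((- 1) ^ (n - 1) \<cdot>\<^sub>m adj_mat C) $$ (i, j) = (det A \<cdot>\<^sub>m Z) $$ (i, j)"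
      using ij adj_mat(1)[OF C] Z by simp
  qed (use adj_mat(1)[OF C] Z in auto)
  then show ?thesis by (simp only: Z_def)
qed

section \<open>The trace form as an adjugate\<close>

interpretation scalar_form: ring_hom "scalar_form :: 'a::comm_ring_1 \<Rightarrow> 'a form"
  by unfold_locales (simp_all add: scalar_form_add scalar_form_mult)

definition sym_pairs :: "nat \<Rightarrow> (nat \<times> nat) set" where
  "sym_pairs n = {(i, j). i \<le> j \<and> j < n}"

lemma homogeneous_da: "i < n \<Longrightarrow> j < n \<Longrightarrow> homogeneous (sym_pairs n) 1 (da i j)"
  unfolding da_def by (rule homogeneous_gen) (auto simp: sym_pairs_def)

lift_definition da_pair :: "nat \<Rightarrow> nat \<Rightarrow> nat \<Rightarrow> nat \<Rightarrow> 'a::comm_ring_1 eform" is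
  "\<lambda>i j k l. da i j * da k l"
proof -
  fix i j k l :: nat
  have "homogeneous UNIV (1 + 1) (da i j * da k l :: 'a form)"
    unfolding da_def by (intro homogeneous_mult homogeneous_gen) auto
  then show "even_form (da i j * da k l :: 'a form)"
    by (auto simp: homogeneous_def even_form_def)
qed

text \<open>
  This is the product \<open>dA B dA\<close>.
\<close>

definition quad_mat :: "nat \<Rightarrow> 'a::comm_ring_1 mat \<Rightarrow> 'a eform mat" where
  "quad_mat n B = mat n n (\<lambda>(a, b). \<Sum>p<n. \<Sum>q<n. even_scalar (B $$ (p, q)) * da_pair a p q b)"

lemma mat_mult_entry:
  assumes "P \<in> carrier_mat n m" "Q \<in> carrier_mat m l" "i < n" "j < l"
  shows "(P * Q) $$ (i, j) = (\<Sum>k<m. P $$ (i, k) * Q $$ (k, j))"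
  using assms by (auto simp: times_mat_def scalar_prod_def lessThan_atLeast0 intro!: sum.cong)

lemma homogeneous_mat_pow:
  fixes X :: "'a::comm_ring_1 form mat"
  assumes X: "X \<in> carrier_mat n n" and h: "\<And>i j. i < n \<Longrightarrow> j < n \<Longrightarrow> homogeneous V 1 (X $$ (i, j))"
    and ij: "i < n" "j < n"
  shows "homogeneous V k ((X ^\<^sub>m k) $$ (i, j))"
  using ij
proof (induction k arbitrary: i j)
  case 0
  then show ?case using X homogeneous_scalar[of V "1::'a"] by simp
next
  case (Suc k)
  have Xk: "X ^\<^sub>m k \<in> carrier_mat n n" using X by simp
  show ?case
    unfolding pow_mat.simps mat_mult_entry[OF Xk X Suc.prems]
  proof (rule homogeneous_sum)
    fix l assume "l \<in> {..<n}"
    then show "homogeneous V (Suc k) ((X ^\<^sub>m k) $$ (i, l) * X $$ (l, j))"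
      using homogeneous_mult[OF Suc.IH[of i l] h[of l j]] Suc.prems by simp
  qed
qed

lemma pow_mat_square:
  assumes X: "X \<in> carrier_mat n n"
  shows "(X * X) ^\<^sub>m k = X ^\<^sub>m (2 * k)"
proof (induction k)
  case (Suc k)
  have "(X * X) ^\<^sub>m Suc k = X ^\<^sub>m (2 * k) * (X * X)" using Suc by simp
  also have "\<dots> = X ^\<^sub>m (2 * k) * X * X"
    using X by (simp add: assoc_mult_mat[of _ n n _ n _ n])
  finally show ?case by simp
qed (use X in simp)

lemma form_eq_uminus_imp_zero:
  fixes f :: "'a::field_char_0 form"
  assumes "f = - f"
  shows "f = 0"
proof (rule form_torsion_free[of 2])
  have "f + f = 0" using assms by (metis add.right_inverse)
  then show "of_nat 2 * f = 0" by (simp add: mult_2)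
qed simp

text \<open>
  Moving an odd factor cyclically past an odd power changes the sign, so this trace is its own
  negative.
\<close>

lemma trace_even_power_zero:
  fixes X :: "'a::field_char_0 form mat"
  assumes X: "X \<in> carrier_mat n n" and h: "\<And>i j. i < n \<Longrightarrow> j < n \<Longrightarrow> homogeneous V 1 (X $$ (i, j))"
  shows "mat_trace (X ^\<^sub>m (2 * Suc k)) = 0"
proof -
  define W where "W = X ^\<^sub>m (2 * k + 1)"
  have W: "W \<in> carrier_mat n n" using X unfolding W_def by (rule pow_carrier_mat)
  have WX: "X ^\<^sub>m (2 * Suc k) = W * X" by (simp add: W_def)
  have XW: "X ^\<^sub>m (2 * Suc k) = X * W"
    using pow_mat_Suc_left[OF X, of "2 * k + 1"] by (simp add: W_def)
  have "mat_trace (W * X) = (\<Sum>i<n. \<Sum>j<n. - (X $$ (j, i) * W $$ (i, j)))"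
    unfolding mat_trace_mult[OF W X]
  proof (intro sum.cong refl)
    fix i j assume ij: "i \<in> {..<n}" "j \<in> {..<n}"
    then have hW: "homogeneous V (2 * k + 1) (W $$ (i, j))"
      unfolding W_def using homogeneous_mat_pow[OF X h] by blast
    show "W $$ (i, j) * X $$ (j, i) = - (X $$ (j, i) * W $$ (i, j))"
      using graded_commute[OF hW h[of j i]] ij by simp
  qed
  also have "\<dots> = - mat_trace (X * W)"
    unfolding mat_trace_mult[OF X W] by (subst sum.swap) (simp add: sum_negf)
  finally have "mat_trace (X ^\<^sub>m (2 * Suc k)) = - mat_trace (X ^\<^sub>m (2 * Suc k))"
    unfolding WX[symmetric] XW[symmetric] .
  then show ?thesis by (rule form_eq_uminus_imp_zero)
qed

lemma mat_trace_hom: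
  "form_of_even (mat_trace P) = mat_trace (map_mat form_of_even P)" if "P \<in> carrier_mat n n"
  using that by (simp add: mat_trace_def form_of_even_sum)

lemma homogeneous_scalar_mult_dA:
  fixes B :: "'a::comm_ring_1 mat"
  assumes B: "B \<in> carrier_mat n n" and ij: "i < n" "j < n"
  shows "homogeneous (sym_pairs n) 1 ((map_mat scalar_form B * dA n) $$ (i, j))"
proof -
  have b: "map_mat scalar_form B \<in> carrier_mat n n" and D: "dA n \<in> carrier_mat n n"
    using B by (auto simp: dA_def)
  show ?thesis
    unfolding mat_mult_entry[OF b D ij]
  proof (rule homogeneous_sum)
    fix k assume "k \<in> {..<n}"
    then show "homogeneous (sym_pairs n) 1 (map_mat scalar_form B $$ (i, k) * dA n $$ (k, j))"
      using homogeneous_mult[OF homogeneous_scalar homogeneous_da, of k n j "B $$ (i, k)"] ij B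
      by (simp add: dA_def)
  qed
qed

text \<open>
  Here \<open>X = B dA\<close> has odd entries, and its square \<open>Y = B C\<close> with \<open>C = dA B dA\<close> is a matrix over the even
  forms to which \<open>adj_mat_pencil\<close> applies. The trace of \<open>X\<^bsup>2n-2\<^esup> X\<close> then simplifies by \<open>A B = 1\<close>.
\<close>

lemma trace_form_eq_adj:
  fixes A B :: "'a::field_char_0 mat"
  assumes A: "A \<in> carrier_mat n n" and B: "B \<in> carrier_mat n n"
    and AB: "A * B = 1\<^sub>m n" and BA: "B * A = 1\<^sub>m n" and inv: "mat_inverse A = Some B"
    and n: "n \<ge> 1"
  shows "scalar_form (det A) * trace_form A (2 * n - 1) =
    (- 1) ^ (n - 1) * (\<Sum>k<n. \<Sum>j<n. form_of_even (adj_mat (quad_mat n B) $$ (k, j)) * da j k)"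
proof -
  let ?A = "map_mat even_scalar A" and ?B = "map_mat even_scalar B"
  let ?a = "map_mat scalar_form A" and ?b = "map_mat scalar_form B"
  define C where "C = quad_mat n B"
  define X where "X = ?b * dA n"
  define Y where "Y = ?B * C"
  have C: "C \<in> carrier_mat n n" by (simp add: C_def quad_mat_def)
  have D: "dA n \<in> carrier_mat n n" for n by (simp add: dA_def)
  have A': "?A \<in> carrier_mat n n" and B': "?B \<in> carrier_mat n n"
    and a: "?a \<in> carrier_mat n n" and b: "?b \<in> carrier_mat n n" using A B by auto
  have X: "X \<in> carrier_mat n n" unfolding X_def by (rule mult_carrier_mat[OF b D])
  have Y: "Y \<in> carrier_mat n n" unfolding Y_def by (rule mult_carrier_mat[OF B' C])
  have hX: "homogeneous (sym_pairs n) 1 (X $$ (i, j))" if "i < n" "j < n" for i j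
    unfolding X_def by (rule homogeneous_scalar_mult_dA[OF B that])
  have evC: "map_mat form_of_even C = dA n * X"
  proof (rule eq_matI)
    fix i j assume "i < dim_row (dA n * X)" "j < dim_col (dA n * X)"
    then have ij: "i < n" "j < n" using D X by (auto simp: dA_def)
    have "(dA n * X) $$ (i, j) = (\<Sum>p<n. \<Sum>q<n. scalar_form (B $$ (p, q)) * (da i p * da q j))"
      unfolding mat_mult_entry[OF D X ij]
    proof (rule sum.cong)
      fix p assume p: "p \<in> {..<n}"
      have "dA n $$ (i, p) * X $$ (p, j) = (\<Sum>q<n. da i p * (scalar_form (B $$ (p, q)) * da q j))"
        unfolding X_def using p ij B
        by (subst mat_mult_entry[OF b D]) (auto simp: dA_def sum_distrib_left)
      also have "\<dots> = (\<Sum>q<n. scalar_form (B $$ (p, q)) * (da i p * da q j))"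
        by (intro sum.cong refl) (metis mult.assoc scalar_form_commute)
      finally show "dA n $$ (i, p) * X $$ (p, j) = \<dots>" .
    qed simp
    then show "map_mat form_of_even C $$ (i, j) = (dA n * X) $$ (i, j)"
      using ij by (simp add: C_def quad_mat_def form_of_even_sum times_eform.rep_eq
          even_scalar.rep_eq da_pair.rep_eq)
  qed (use C X in \<open>auto simp: dA_def\<close>)
  have "map_mat form_of_even ?B = ?b"
    using B by (intro eq_matI) (auto simp: even_scalar.rep_eq)
  then have evY: "map_mat form_of_even Y = X * X"
    unfolding Y_def form_of_even.mat_hom_mult[OF B' C] evC
    by (simp add: X_def assoc_mult_mat[OF b D mult_carrier_mat[OF b D]])
  have evYk: "map_mat form_of_even (Y ^\<^sub>m k) = X ^\<^sub>m (2 * k)" for k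
    unfolding form_of_even.mat_hom_pow[OF Y] evY by (rule pow_mat_square[OF X])
  have trY: "mat_trace (Y ^\<^sub>m Suc k) = 0" for k
  proof -
    have "form_of_even (mat_trace (Y ^\<^sub>m Suc k)) = mat_trace (X ^\<^sub>m (2 * Suc k))"
      by (subst mat_trace_hom[OF pow_carrier_mat[OF Y]]) (simp only: evYk)
    also have "\<dots> = 0" by (rule trace_even_power_zero[OF X hX])
    finally show ?thesis by (metis form_of_even_inject zero_eform.rep_eq)
  qed
  have AB': "?A * ?B = 1\<^sub>m n" and BA': "?B * ?A = 1\<^sub>m n"
    by (simp_all add: AB BA even_scalar.mat_hom_one flip: even_scalar.mat_hom_mult[OF A B]
        even_scalar.mat_hom_mult[OF B A])
  have ab: "?a * ?b = 1\<^sub>m n"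
    by (simp add: AB scalar_form.mat_hom_one flip: scalar_form.mat_hom_mult[OF A B])
  have adj: "adj_mat C \<in> carrier_mat n n" by (rule adj_mat(1)[OF C])
  have "(- 1) ^ (n - 1) \<cdot>\<^sub>m adj_mat C = det ?A \<cdot>\<^sub>m (Y ^\<^sub>m (n - 1) * ?B)"
    unfolding Y_def
    by (rule adj_mat_pencil[OF eform_torsion_free A' B' C AB' trY[unfolded Y_def] n])
  then have "((- 1) ^ (n - 1) \<cdot>\<^sub>m adj_mat C) * ?A = (det ?A \<cdot>\<^sub>m (Y ^\<^sub>m (n - 1) * ?B)) * ?A"
    by simp
  then have "(- 1) ^ (n - 1) \<cdot>\<^sub>m (adj_mat C * ?A) = det ?A \<cdot>\<^sub>m (Y ^\<^sub>m (n - 1) * ?B * ?A)"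
    by (simp only: mult_smult_assoc_mat[OF adj A'] mult_smult_assoc_mat[OF mult_carrier_mat[OF pow_carrier_mat[OF Y] B'] A'])
  also have "Y ^\<^sub>m (n - 1) * ?B * ?A = Y ^\<^sub>m (n - 1)"
    unfolding assoc_mult_mat[OF pow_carrier_mat[OF Y] B' A'] BA'
    by (rule right_mult_one_mat[OF pow_carrier_mat[OF Y]])
  finally have main: "(- 1) ^ (n - 1) \<cdot>\<^sub>m (adj_mat C * ?A) = even_scalar (det A) \<cdot>\<^sub>m Y ^\<^sub>m (n - 1)"
    by simp
  define W where "W = X ^\<^sub>m (2 * (n - 1))"
  define E where "E = map_mat form_of_even (adj_mat C)"
  have W: "W \<in> carrier_mat n n" unfolding W_def by (rule pow_carrier_mat[OF X])
  have E: "E \<in> carrier_mat n n" using adj by (simp add: E_def)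
  have "map_mat form_of_even ?A = ?a"
    using A by (intro eq_matI) (auto simp: even_scalar.rep_eq)
  then have evEA: "map_mat form_of_even (adj_mat C * ?A) = E * ?a"
    by (simp add: form_of_even.mat_hom_mult[OF adj A'] E_def)
  have entries: "scalar_form (det A) * W $$ (i, j) = (- 1) ^ (n - 1) * (E * ?a) $$ (i, j)"
    if "i < n" "j < n" for i j
  proof -
    have cAA: "adj_mat C * ?A \<in> carrier_mat n n" by (rule mult_carrier_mat[OF adj A'])
    have cY: "Y ^\<^sub>m (n - 1) \<in> carrier_mat n n" by (rule pow_carrier_mat[OF Y])
    have "(- 1) ^ (n - 1) * (adj_mat C * ?A) $$ (i, j) = even_scalar (det A) * (Y ^\<^sub>m (n - 1)) $$ (i, j)"
      using arg_cong[OF main, of "\<lambda>M. M $$ (i, j)"] that cAA cY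
      by (metis carrier_matD index_smult_mat(1))
    then have "form_of_even ((- 1) ^ (n - 1) * (adj_mat C * ?A) $$ (i, j)) =
        form_of_even (even_scalar (det A) * (Y ^\<^sub>m (n - 1)) $$ (i, j))" by simp
    then have "(- 1) ^ (n - 1) * map_mat form_of_even (adj_mat C * ?A) $$ (i, j) =
        scalar_form (det A) * map_mat form_of_even (Y ^\<^sub>m (n - 1)) $$ (i, j)"
      using that cAA cY
      by (metis carrier_matD even_scalar.rep_eq form_of_even_minus_one_power index_map_mat(1)
          times_eform.rep_eq)
    then show ?thesis unfolding evEA evYk W_def by simp
  qed
  have odd: "2 * n - 1 = Suc (2 * (n - 1))" using n by simp
  have "trace_form A (2 * n - 1) = mat_trace (X ^\<^sub>m (2 * n - 1))"
    using A by (simp add: trace_form_def inv X_def)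
  also have "\<dots> = mat_trace (W * X)" by (simp only: odd pow_mat.simps W_def)
  finally have "trace_form A (2 * n - 1) = mat_trace (W * X)" .
  then have "scalar_form (det A) * trace_form A (2 * n - 1) =
      (\<Sum>i<n. \<Sum>j<n. scalar_form (det A) * W $$ (i, j) * X $$ (j, i))"
    by (simp add: mat_trace_mult[OF W X] sum_distrib_left mult.assoc)
  also have "\<dots> = (\<Sum>i<n. \<Sum>j<n. (- 1) ^ (n - 1) * ((E * ?a) $$ (i, j) * X $$ (j, i)))"
    by (simp add: entries mult.assoc)
  also have "\<dots> = (- 1) ^ (n - 1) * mat_trace (E * ?a * X)"
    by (simp add: mat_trace_mult[OF mult_carrier_mat[OF E a] X] sum_distrib_left)
  also have "E * ?a * X = E * (?a * ?b * dA n)"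
    unfolding X_def assoc_mult_mat[OF E a mult_carrier_mat[OF b D]] assoc_mult_mat[OF a b D] ..
  also have "\<dots> = E * dA n" unfolding ab left_mult_one_mat[OF D] ..
  also have "mat_trace (E * dA n) = (\<Sum>k<n. \<Sum>j<n. form_of_even (adj_mat C $$ (k, j)) * da j k)"
    unfolding mat_trace_mult[OF E D] using adj by (simp add: E_def dA_def)
  finally show ?thesis by (simp add: C_def)
qed

lemma homogeneous_trace_form:
  fixes A B :: "'a::field mat"
  assumes A: "A \<in> carrier_mat n n" and B: "B \<in> carrier_mat n n" and inv: "mat_inverse A = Some B"
  shows "homogeneous (sym_pairs n) r (trace_form A r)"
proof -
  let ?b = "map_mat scalar_form B"
  have D: "dA n \<in> carrier_mat n n" for n by (simp add: dA_def)
  have b: "?b \<in> carrier_mat n n" using B by simp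
  define X where "X = ?b * dA n"
  have X: "X \<in> carrier_mat n n" unfolding X_def by (rule mult_carrier_mat[OF b D])
  have hX: "homogeneous (sym_pairs n) 1 (X $$ (i, j))" if "i < n" "j < n" for i j
    unfolding X_def by (rule homogeneous_scalar_mult_dA[OF B that])
  have "trace_form A r = mat_trace (X ^\<^sub>m r)" using A by (simp add: trace_form_def inv X_def)
  also have "\<dots> = (\<Sum>i<n. (X ^\<^sub>m r) $$ (i, i))"
    using pow_carrier_mat[OF X, of r] unfolding mat_trace_def by (metis carrier_matD(1))
  finally show ?thesis using homogeneous_mat_pow[OF X hX] by (auto intro: homogeneous_sum)
qed

text \<open>
  The matrix \<open>dA B dA\<close> is antisymmetric, because transposing a product of odd entries costs a sign. For
  even \<open>n\<close> its adjugate is antisymmetric too, and pairing it with the symmetric \<open>dA\<close> gives zero.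
\<close>

lemma trace_form_even_zero:
  fixes A B :: "'a::field_char_0 mat"
  assumes A: "A \<in> carrier_mat n n" and B: "B \<in> carrier_mat n n"
    and AB: "A * B = 1\<^sub>m n" and BA: "B * A = 1\<^sub>m n" and inv: "mat_inverse A = Some B"
    and sym: "\<And>i j. i < n \<Longrightarrow> j < n \<Longrightarrow> B $$ (i, j) = B $$ (j, i)"
    and n: "n \<ge> 1" "even n" and det: "det A \<noteq> 0"
  shows "trace_form A (2 * n - 1) = 0"
proof -
  define C where "C = quad_mat n B"
  have C: "C \<in> carrier_mat n n" by (simp add: C_def quad_mat_def)
  have adj: "adj_mat C \<in> carrier_mat n n" by (rule adj_mat(1)[OF C])
  have da_sym: "da i j = da j i" for i j by (simp add: da_def min.commute max.commute)
  have swap: "da_pair a p q b = (- da_pair b q p a :: 'a eform)" for a b p q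
  proof -
    have "homogeneous UNIV 1 (da i j :: 'a form)" for i j unfolding da_def
      by (rule homogeneous_gen) simp
    from graded_commute[OF this[of a p] this[of q b]] have "(da a p * da q b :: 'a form) = - (da b q * da p a)"
      by (simp add: da_sym)
    then have "form_of_even (da_pair a p q b :: 'a eform) = form_of_even (- da_pair b q p a)"
      by (simp only: da_pair.rep_eq uminus_eform.rep_eq)
    then show ?thesis by (simp only: form_of_even_inject)
  qed
  have "C\<^sup>T = - 1 \<cdot>\<^sub>m C"
  proof (rule eq_matI)
    fix i j assume "i < dim_row (- 1 \<cdot>\<^sub>m C)" "j < dim_col (- 1 \<cdot>\<^sub>m C)"
    then have ij: "i < n" "j < n" using C by auto
    have "(\<Sum>p<n. \<Sum>q<n. even_scalar (B $$ (p, q)) * da_pair j p q i) =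
        (\<Sum>p<n. \<Sum>q<n. - (even_scalar (B $$ (q, p)) * da_pair i q p j))"
      by (intro sum.cong refl) (simp add: sym swap[of j])
    also have "\<dots> = - (\<Sum>p<n. \<Sum>q<n. even_scalar (B $$ (p, q)) * da_pair i p q j)"
      by (subst sum.swap) (simp add: sum_negf)
    finally show "C\<^sup>T $$ (i, j) = (- 1 \<cdot>\<^sub>m C) $$ (i, j)"
      using ij by (simp add: C_def quad_mat_def)
  qed (use C in auto)
  then have CT: "- 1 \<cdot>\<^sub>m C = C\<^sup>T" ..
  have anti: "adj_mat C $$ (k, j) = - adj_mat C $$ (j, k)" if "k < n" "j < n" for j k
  proof -
    have dim: "mat_delete C k j \<in> carrier_mat (n - 1) (n - 1)"
      by (rule mat_delete_carrier[OF C])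
    have "mat_delete C j k = - 1 \<cdot>\<^sub>m (mat_delete C k j)\<^sup>T"
    proof (rule eq_matI)
      fix a b assume ab: "a < dim_row (- 1 \<cdot>\<^sub>m (mat_delete C k j)\<^sup>T)" "b < dim_col (- 1 \<cdot>\<^sub>m (mat_delete C k j)\<^sup>T)"
      have "C $$ (x, y) = - C $$ (y, x)" if "x < n" "y < n" for x y
        using arg_cong[OF CT, of "\<lambda>M. M $$ (y, x)"] that C by simp
      moreover define x y where "x = (if a < j then a else Suc a)" and "y = (if b < k then b else Suc b)"
      moreover have "x < n" "y < n" using ab C by (auto simp: x_def y_def)
      ultimately have "C $$ (x, y) = - C $$ (y, x)" by blast
      moreover have "mat_delete C j k $$ (a, b) = C $$ (x, y)"
        "(- 1 \<cdot>\<^sub>m (mat_delete C k j)\<^sup>T) $$ (a, b) = - C $$ (y, x)"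
        using ab C by (simp_all add: mat_delete_def x_def y_def)
      ultimately show "mat_delete C j k $$ (a, b) = (- 1 \<cdot>\<^sub>m (mat_delete C k j)\<^sup>T) $$ (a, b)"
        by simp
    qed (use C in \<open>auto simp: mat_delete_def\<close>)
    then have "det (mat_delete C j k) = (- 1) ^ (n - 1) * det (mat_delete C k j)"
      using dim C by (simp add: det_transpose[OF dim])
    then show ?thesis using that C n by (simp add: adj_mat_def cofactor_def add.commute)
  qed
  let ?S = "\<Sum>k<n. \<Sum>j<n. form_of_even (adj_mat C $$ (k, j)) * (da j k :: 'a form)"
  have "?S = (\<Sum>k<n. \<Sum>j<n. - (form_of_even (adj_mat C $$ (j, k)) * da k j))"
  proof (intro sum.cong refl)
    fix k j assume "k \<in> {..<n}" "j \<in> {..<n}"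
    then have "k < n" "j < n" by auto
    then have "adj_mat C $$ (k, j) = - adj_mat C $$ (j, k)" by (rule anti)
    then show "form_of_even (adj_mat C $$ (k, j)) * (da j k :: 'a form) =
        - (form_of_even (adj_mat C $$ (j, k)) * da k j)"
      unfolding da_sym[of k j] by (simp only: uminus_eform.rep_eq mult_minus_left)
  qed
  also have "\<dots> = - ?S" by (subst sum.swap) (simp add: sum_negf)
  finally have "?S = 0" by (rule form_eq_uminus_imp_zero)
  then have "scalar_form (det A) * trace_form A (2 * n - 1) = 0"
    using trace_form_eq_adj[OF A B AB BA inv n(1)] by (simp add: C_def)
  then have "scalar_form (inverse (det A) * det A) * trace_form A (2 * n - 1) = 0"
    by (simp add: scalar_form_mult mult.assoc)
  then show ?thesis using det by simp
qed

section \<open>Coefficients of products of generators\<close>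

lemma permutes_lt: "p permutes {0..<n} \<Longrightarrow> i < n \<Longrightarrow> p i < (n::nat)"
  using permutes_in_image[of p "{0..<n}" i] by simp

text \<open>
  For distinct \<open>v\<close> the determinant is the sign of the permutation that rearranges \<open>v\<close> to \<open>xs\<close>, and zero
  if \<open>xs\<close> is no rearrangement of \<open>v\<close>. This makes sums of signs accessible to Laplace expansions.
\<close>

definition match_mat :: "'b list \<Rightarrow> 'b list \<Rightarrow> 'r::comm_ring_1 mat" where
  "match_mat xs v = mat (length v) (length v) (\<lambda>(k, l). if xs ! k = v ! l then 1 else 0)"

lemma match_mat_carrier [simp]: "match_mat xs v \<in> carrier_mat (length v) (length v)"
  by (simp add: match_mat_def)

lemma homogeneous_prod_list:
  assumes "\<And>x. x \<in> set xs \<Longrightarrow> homogeneous V 1 (f x)"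
  shows "homogeneous V (length xs) (prod_list (map f xs))"
  using assms
proof (induction xs)
  case Nil
  then show ?case using homogeneous_scalar[of V 1] by simp
next
  case (Cons x xs)
  then show ?case using homogeneous_mult[of V 1 "f x" "length xs"] by simp
qed

lemma gen_prod_support:
  assumes "form_coeff (prod_list (map form_gen ys) :: 'a::comm_ring_1 form) S \<noteq> 0"
  shows "S = set ys \<and> distinct ys"
proof -
  have "homogeneous (set ys) (length ys) (prod_list (map form_gen ys) :: 'a form)"
    by (intro homogeneous_prod_list homogeneous_gen)
  then have S: "S \<subseteq> set ys" "card S = length ys" using assms by (auto simp: homogeneous_def)
  then have "card (set ys) = length ys"
    by (metis List.finite_set card_length card_mono le_antisym)
  then show ?thesis using S by (metis List.finite_set card_distinct card_subset_eq)
qed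

lemma gen_mult_coeff:
  fixes f :: "'a::comm_ring_1 form"
  assumes "finite S" "x \<in> S"
  shows "form_coeff (form_gen x * f) S = shuffle_sign {x} (S - {x}) * form_coeff f (S - {x})"
proof -
  have "form_coeff (form_gen x * f) S =
      (\<Sum>T\<in>{{x}}. shuffle_sign T (S - T) * form_coeff f (S - T))"
    unfolding times_form.rep_eq form_gen.rep_eq
    using assms by (intro sum.mono_neutral_cong_right) auto
  then show ?thesis by simp
qed

text \<open>
  Reordering anticommuting generators produces a determinant. Both sides satisfy the same recursion:
  moving the first entry \<open>x\<close> of \<open>v\<close> to the front of \<open>ys\<close> costs the sign with which its position enters
  the Laplace expansion along the first column.
\<close>

lemma gen_prod_coeff:
  assumes "distinct v" "length ys = length v"
  shows "form_coeff (prod_list (map form_gen ys)) (set v) =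
    det (match_mat ys v) * form_coeff (prod_list (map form_gen v) :: 'a::comm_ring_1 form) (set v)"
  using assms
proof (induction v arbitrary: ys)
  case Nil
  then show ?case by (simp add: match_mat_def)
next
  case (Cons x v)
  let ?N = "length (x # v)"
  let ?c = "\<lambda>ys S. form_coeff (prod_list (map form_gen ys) :: 'a form) S"
  have len: "length ys = ?N" using Cons.prems by simp
  have laplace: "det (match_mat ys (x # v) :: 'a mat) =
      (\<Sum>i<?N. (if ys ! i = x then cofactor (match_mat ys (x # v)) i 0 else 0))"
    by (subst laplace_expansion_column[of _ ?N 0]) (auto simp: match_mat_def intro!: sum.cong)
  show ?case
  proof (cases "x \<in> set ys")
    case False
    then have "?c ys (set (x # v)) = 0" using gen_prod_support[of ys "set (x # v)"] by auto
    moreover have "det (match_mat ys (x # v) :: 'a mat) = 0"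
      unfolding laplace using False len by (intro sum.neutral) (auto simp: set_conv_nth)
    ultimately show ?thesis by simp
  next
    case True
    then obtain ys1 ys2 where ys: "ys = ys1 @ x # ys2" "x \<notin> set ys1"
      by (meson split_list_first)
    let ?k = "length ys1"
    have nth: "ys ! ?k = x" by (simp add: ys)
    show ?thesis
    proof (cases "x \<in> set ys2")
      case True
      then obtain l where l: "l < length ys2" "ys2 ! l = x" by (auto simp: set_conv_nth)
      have "\<not> distinct ys" using True by (simp add: ys)
      then have "?c ys (set (x # v)) = 0" using gen_prod_support[of ys "set (x # v)"] by auto
      moreover have "det (match_mat ys (x # v) :: 'a mat) = 0"
      proof (rule det_identical_rows[of _ ?N ?k "Suc ?k + l"])
        show "?k < ?N" "Suc ?k + l < ?N" using l len by (auto simp: ys)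
        have "ys ! (Suc ?k + l) = x" using l by (simp add: ys nth_append)
        then show "row (match_mat ys (x # v)) ?k = row (match_mat ys (x # v) :: 'a mat) (Suc ?k + l)"
          using nth \<open>?k < ?N\<close> \<open>Suc ?k + l < ?N\<close> by (intro eq_vecI) (auto simp: match_mat_def)
      qed (auto simp: match_mat_def)
      ultimately show ?thesis by simp
    next
      case False
      define zs where "zs = ys1 @ ys2"
      have zs: "length zs = length v" using len by (simp add: ys zs_def)
      have k: "?k < ?N" using len by (simp add: ys)
      have only: "ys ! i = x \<longleftrightarrow> i = ?k" if "i < ?N" for i
      proof
        assume "ys ! i = x"
        then show "i = ?k"
          using ys False that len
          by (auto simp: nth_append nth_Cons' split: if_splits)
      qed (simp add: nth)
      have "det (match_mat ys (x # v) :: 'a mat) = (\<Sum>i\<in>{?k}. cofactor (match_mat ys (x # v)) i 0)"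
        unfolding laplace using only k by (intro sum.mono_neutral_cong_right) auto
      also have "\<dots> = (- 1) ^ ?k * det (mat_delete (match_mat ys (x # v)) ?k 0)"
        by (simp add: cofactor_def)
      also have "mat_delete (match_mat ys (x # v)) ?k 0 = (match_mat zs v :: 'a mat)"
        using len by (intro eq_matI) (auto simp: mat_delete_def match_mat_def ys zs_def nth_append)
      finally have det: "det (match_mat ys (x # v) :: 'a mat) = (- 1) ^ ?k * det (match_mat zs v)" .
      have "prod_list (map form_gen ys) =
          (prod_list (map form_gen ys1) * form_gen x) * (prod_list (map form_gen ys2) :: 'a form)"
        by (simp add: ys mult.assoc)
      also have "prod_list (map form_gen ys1) * form_gen x =
          (- 1) ^ (?k * 1) * (form_gen x * prod_list (map form_gen ys1) :: 'a form)"
        by (rule graded_commute[of UNIV _ _ UNIV]) (intro homogeneous_prod_list homogeneous_gen UNIV_I)+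
      finally have move: "prod_list (map form_gen ys) =
          (- 1) ^ ?k * (form_gen x * (prod_list (map form_gen zs) :: 'a form))"
        by (simp add: zs_def mult.assoc)
      have S: "set (x # v) - {x} = set v" using Cons.prems by auto
      have "?c ys (set (x # v)) = (- 1) ^ ?k * (shuffle_sign {x} (set v) * ?c zs (set v))"
        unfolding move minus_one_power_form form_coeff_scalar_times
        using gen_mult_coeff[of "set (x # v)" x "prod_list (map form_gen zs) :: 'a form"]
        unfolding S by simp
      also have "?c zs (set v) = det (match_mat zs v) * ?c v (set v)"
        using Cons.IH[of zs] Cons.prems zs by simp
      finally show ?thesis
        unfolding det
        using gen_mult_coeff[of "set (x # v)" x "prod_list (map form_gen v) :: 'a form"]
        unfolding S by (simp add: mult_ac)
    qed
  qed
qed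

definition da_prod :: "(nat \<times> nat) list \<Rightarrow> 'a::comm_ring_1 form" where
  "da_prod xs = prod_list (map (\<lambda>(i, j). da i j) xs)"

text \<open>
  The same differential is \<open>da i j\<close> and \<open>da j i\<close>. Reversing the pairs at the positions in \<open>F\<close> runs through
  all the ordered versions of a monomial.
\<close>

definition flip_at :: "nat set \<Rightarrow> (nat \<times> nat) list \<Rightarrow> (nat \<times> nat) list" where
  "flip_at F v = map (\<lambda>l. if l \<in> F then prod.swap (v ! l) else v ! l) [0..<length v]"

lemma length_flip_at [simp]: "length (flip_at F v) = length v"
  by (simp add: flip_at_def)

lemma nth_flip_at [simp]:
  "l < length v \<Longrightarrow> flip_at F v ! l = (if l \<in> F then prod.swap (v ! l) else v ! l)"
  by (simp add: flip_at_def)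

definition off_positions :: "(nat \<times> nat) list \<Rightarrow> nat set" where
  "off_positions v = {l. l < length v \<and> fst (v ! l) \<noteq> snd (v ! l)}"

lemma finite_off_positions [simp]: "finite (off_positions v)"
  by (simp add: off_positions_def)

text \<open>
  An off-diagonal generator is met by a pair in either order, so a column of the matching determinant
  at an off-diagonal position is the sum of two columns. Multilinearity gives one summand for each
  set of reversed positions.
\<close>

lemma da_prod_coeff:
  assumes v: "distinct v" "\<forall>x\<in>set v. fst x \<le> snd x" and len: "length xs = length v"
  shows "form_coeff (da_prod xs) (set v) =
    (\<Sum>F\<in>Pow (off_positions v). det (match_mat xs (flip_at F v))) *
      form_coeff (da_prod v :: 'a::comm_ring_1 form) (set v)"
proof -
  define s where "s = (\<lambda>(i :: nat, j). (min i j, max i j))"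
  have gens: "da_prod ys = (prod_list (map form_gen (map s ys)) :: 'a form)" for ys
    by (simp add: da_prod_def da_def s_def case_prod_unfold comp_def)
  have sv: "map s v = v"
    using v(2) by (intro map_idI) (auto simp: s_def)
  let ?N = "length v" and ?O = "off_positions v"
  have O: "?O \<subseteq> {0..<?N}" by (auto simp: off_positions_def)
  define hit where "hit x y = (if x = y then 1 else 0 :: 'a)" for x y :: "nat \<times> nat"
  have entry: "(if s x = v ! l then 1 else 0) =
      (if l \<in> ?O then hit x (prod.swap (v ! l)) + hit x (v ! l) else hit x (v ! l))"
    if l: "l < ?N" for x l
  proof -
    have "fst (v ! l) \<le> snd (v ! l)" using v(2) l by simp
    then show ?thesis
      using l by (cases x; cases "v ! l") (auto simp: s_def hit_def off_positions_def min_def max_def)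
  qed
  have "det (match_mat (map s xs) v :: 'a mat) =
      (\<Sum>p | p permutes {0..<?N}. signof p * (\<Prod>j<?N. if s (xs ! p j) = v ! j then 1 else 0))"
    using len by (subst det_col[OF match_mat_carrier])
      (auto simp: match_mat_def permutes_lt intro!: sum.cong prod.cong)
  also have "\<dots> = (\<Sum>p | p permutes {0..<?N}. \<Sum>F\<in>Pow ?O.
      signof p * (\<Prod>j<?N. hit (xs ! p j) (flip_at F v ! j)))"
  proof (intro sum.cong refl)
    fix p assume "p \<in> {p. p permutes {0..<?N}}"
    let ?x = "\<lambda>j. xs ! p j"
    have "(\<Prod>j<?N. if s (?x j) = v ! j then 1 else 0 :: 'a) =
        (\<Prod>j\<in>?O. hit (?x j) (prod.swap (v ! j)) + hit (?x j) (v ! j)) *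
        (\<Prod>j\<in>{0..<?N} - ?O. hit (?x j) (v ! j))"
    proof -
      have "(\<Prod>j\<in>?O. if s (?x j) = v ! j then 1 else 0 :: 'a) =
          (\<Prod>j\<in>?O. hit (?x j) (prod.swap (v ! j)) + hit (?x j) (v ! j))"
        using O by (intro prod.cong refl) (subst entry, auto)
      moreover have "(\<Prod>j\<in>{0..<?N} - ?O. if s (?x j) = v ! j then 1 else 0 :: 'a) =
          (\<Prod>j\<in>{0..<?N} - ?O. hit (?x j) (v ! j))"
        by (intro prod.cong refl) (subst entry, auto)
      ultimately show ?thesis
        unfolding lessThan_atLeast0 using O
          by (subst prod.subset_diff[of ?O]) (auto simp: mult.commute)
    qed
    also have "\<dots> = (\<Sum>F\<in>Pow ?O. (\<Prod>j\<in>F. hit (?x j) (prod.swap (v ! j))) *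
        (\<Prod>j\<in>?O - F. hit (?x j) (v ! j)) * (\<Prod>j\<in>{0..<?N} - ?O. hit (?x j) (v ! j)))"
      by (simp add: prod_add sum_distrib_right)
    also have "\<dots> = (\<Sum>F\<in>Pow ?O. \<Prod>j<?N. hit (?x j) (flip_at F v ! j))"
    proof (intro sum.cong refl)
      fix F assume F: "F \<in> Pow ?O"
      have split: "(\<Prod>j<?N. g j) = (\<Prod>j\<in>F. g j) * (\<Prod>j\<in>?O - F. g j) * (\<Prod>j\<in>{0..<?N} - ?O. g j)"
        for g :: "nat \<Rightarrow> 'a"
        unfolding lessThan_atLeast0
        using O F prod.subset_diff[of ?O "{0..<?N}" g] prod.subset_diff[of F ?O g]
        by (simp add: mult_ac)
      show "(\<Prod>j\<in>F. hit (?x j) (prod.swap (v ! j))) *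
        (\<Prod>j\<in>?O - F. hit (?x j) (v ! j)) * (\<Prod>j\<in>{0..<?N} - ?O. hit (?x j) (v ! j)) =
        (\<Prod>j<?N. hit (?x j) (flip_at F v ! j))"
        unfolding split using F O
        by (intro arg_cong2[where f = "(*)"] prod.cong refl) (auto simp: subset_iff)
    qed
    finally show "signof p * (\<Prod>j<?N. if s (?x j) = v ! j then 1 else 0 :: 'a) =
        (\<Sum>F\<in>Pow ?O. signof p * (\<Prod>j<?N. hit (?x j) (flip_at F v ! j)))"
      by (simp add: sum_distrib_left)
  qed
  also have "\<dots> = (\<Sum>F\<in>Pow ?O. det (match_mat xs (flip_at F v)))"
    using det_col[OF match_mat_carrier, of xs "flip_at _ v", where ?'a = 'a]
    by (subst sum.swap) (auto simp: match_mat_def hit_def permutes_lt intro!: sum.cong prod.cong)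
  finally show ?thesis
    using gen_prod_coeff[OF v(1), of "map s xs", where ?'a = 'a] len by (simp add: gens sv)
qed

text \<open>
  The factor \<open>x\<^sub>i\<close> passes \<open>y\<^sub>0, \<dots>, y\<^bsub>i-1\<^esub>\<close>, altogether \<open>m (m - 1) / 2\<close> transpositions of odd forms.
\<close>

lemma prod_list_pairs_reorder:
  fixes x y :: "nat \<Rightarrow> 'a::comm_ring_1 form"
  assumes "\<And>i. i < m \<Longrightarrow> homogeneous UNIV 1 (x i)" "\<And>i. i < m \<Longrightarrow> homogeneous UNIV 1 (y i)"
  shows "prod_list (map (\<lambda>i. x i * y i) [0..<m]) =
    (- 1) ^ (m choose 2) * (prod_list (map x [0..<m]) * prod_list (map y [0..<m]))"
  using assms
proof (induction m)
  case (Suc m)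
  let ?x = "prod_list (map x [0..<m])" and ?y = "prod_list (map y [0..<m])"
  have "homogeneous UNIV (length [0..<m]) ?y"
    using Suc.prems by (intro homogeneous_prod_list) auto
  then have c: "?y * x m = (- 1) ^ m * (x m * ?y)"
    using graded_commute[of UNIV m ?y UNIV 1 "x m"] Suc.prems by simp
  have "prod_list (map (\<lambda>i. x i * y i) [0..<Suc m]) =
      (- 1) ^ (m choose 2) * (?x * (?y * x m) * y m)"
    using Suc by (simp add: mult.assoc)
  also have "\<dots> = (- 1) ^ (m choose 2) * ((- 1) ^ m * (?x * x m * (?y * y m)))"
    unfolding c by (cases "even m") (simp_all add: mult.assoc)
  also have "\<dots> = (- 1) ^ (Suc m choose 2) * (?x * x m * (?y * y m))"
    by (simp add: numeral_2_eq_2 add.commute[of m] power_add mult.assoc)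
  finally show ?case by simp
qed (simp add: binomial_eq_0)

section \<open>Expansion of the adjugate\<close>

abbreviation rows_to :: "nat \<Rightarrow> (nat \<Rightarrow> nat) set" where
  "rows_to m \<equiv> PiE {0..<m} (\<lambda>_. {..<Suc m})"

text \<open>
  A product of differentials that occurs in \<open>da j k\<close> times the \<open>(k, j)\<close> entry of the adjugate: the special
  factor, then a left factor for each row other than \<open>j\<close>, then a right factor for each column other
  than \<open>k\<close>. The free indices \<open>f i\<close> and \<open>g i\<close> are those of the entry of \<open>B\<close> between the two.
\<close>

definition slots :: "nat \<Rightarrow> nat \<Rightarrow> nat \<Rightarrow> (nat \<Rightarrow> nat) \<Rightarrow> (nat \<Rightarrow> nat) \<Rightarrow> (nat \<Rightarrow> nat) \<Rightarrow> (nat \<times> nat) list" where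
  "slots m j k f g \<sigma> = (j, k) # map (\<lambda>i. (insert_index j i, f i)) [0..<m] @
     map (\<lambda>i. (g i, insert_index k (\<sigma> i))) [0..<m]"

definition slot_cell :: "nat \<Rightarrow> 'a::comm_ring_1 mat \<Rightarrow> nat \<Rightarrow> nat \<Rightarrow> (nat \<times> nat) list \<Rightarrow> 'a" where
  "slot_cell m B j k w =
     (\<Sum>\<sigma> | \<sigma> permutes {0..<m}. signof \<sigma> * (\<Sum>f\<in>rows_to m. \<Sum>g\<in>rows_to m.
        (\<Prod>i = 0..<m. B $$ (f i, g i)) * det (match_mat (slots m j k f g \<sigma>) w)))"

definition slot_sum :: "nat \<Rightarrow> 'a::comm_ring_1 mat \<Rightarrow> (nat \<times> nat) list \<Rightarrow> 'a" where
  "slot_sum m B w = (\<Sum>k<Suc m. \<Sum>j<Suc m. (- 1) ^ (j + k) * slot_cell m B j k w)"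

lemma length_slots [simp]: "length (slots m j k f g \<sigma>) = 2 * m + 1"
  by (simp add: slots_def)

lemma da_prod_slots:
  "prod_list (map (\<lambda>i. da (insert_index j i) (f i) * da (g i) (insert_index k (\<sigma> i))) [0..<m]) * da j k =
    scalar_form ((- 1) ^ (m choose 2)) * (da_prod (slots m j k f g \<sigma>) :: 'a::comm_ring_1 form)"
proof -
  let ?x = "\<lambda>i. da (insert_index j i) (f i) :: 'a form"
  let ?y = "\<lambda>i. da (g i) (insert_index k (\<sigma> i)) :: 'a form"
  have h: "homogeneous UNIV 1 (da a b :: 'a form)" for a b
    unfolding da_def by (rule homogeneous_gen) simp
  let ?X = "prod_list (map ?x [0..<m])" and ?Y = "prod_list (map ?y [0..<m])"
  have "homogeneous UNIV (length [0..<m]) ?X" "homogeneous UNIV (length [0..<m]) ?Y"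
    by (intro homogeneous_prod_list h)+
  from homogeneous_mult[OF this] have "homogeneous UNIV (2 * m) (?X * ?Y)" by (simp add: mult_2)
  from graded_commute[OF this h] have "?X * ?Y * da j k = da j k * (?X * ?Y)" by simp
  moreover have "prod_list (map (\<lambda>i. ?x i * ?y i) [0..<m]) = (- 1) ^ (m choose 2) * (?X * ?Y)"
    by (rule prod_list_pairs_reorder[OF h h])
  moreover have "da j k * (?X * ?Y) = da_prod (slots m j k f g \<sigma>)"
    by (simp add: da_prod_def slots_def comp_def)
  ultimately show ?thesis by (simp add: minus_one_power_form mult.assoc)
qed

lemma adj_quad_mat_entry:
  fixes B :: "'a::comm_ring_1 mat"
  assumes "j < Suc m" "k < Suc m"
  shows "form_of_even (adj_mat (quad_mat (Suc m) B) $$ (k, j)) * da j k =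
    (\<Sum>\<sigma> | \<sigma> permutes {0..<m}. \<Sum>f\<in>rows_to m. \<Sum>g\<in>rows_to m.
      scalar_form ((- 1) ^ (j + k) * signof \<sigma> * (\<Prod>i = 0..<m. B $$ (f i, g i)) * (- 1) ^ (m choose 2)) *
      da_prod (slots m j k f g \<sigma>))"
proof -
  let ?C = "quad_mat (Suc m) B"
  let ?c = "\<lambda>\<sigma> i p q. even_scalar (B $$ (p, q)) * da_pair (insert_index j i) p q (insert_index k (\<sigma> i))"
  have C: "?C \<in> carrier_mat (Suc m) (Suc m)" by (simp add: quad_mat_def)
  have del: "mat_delete ?C j k \<in> carrier_mat m m"
    using mat_delete_carrier[OF C] by simp
  have ins: "insert_index a i < Suc m" if "i < m" for a i
    using that by (auto simp: insert_index_def)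
  have prod: "(\<Prod>i = 0..<m. mat_delete ?C j k $$ (i, \<sigma> i)) =
      (\<Sum>f\<in>rows_to m. \<Sum>g\<in>rows_to m. even_scalar (\<Prod>i = 0..<m. B $$ (f i, g i)) *
        (\<Prod>i = 0..<m. da_pair (insert_index j i) (f i) (g i) (insert_index k (\<sigma> i))))"
    if \<sigma>: "\<sigma> permutes {0..<m}" for \<sigma>
  proof -
    have "(\<Prod>i = 0..<m. mat_delete ?C j k $$ (i, \<sigma> i)) =
        (\<Prod>i = 0..<m. \<Sum>p<Suc m. \<Sum>q<Suc m. ?c \<sigma> i p q)"
    proof (intro prod.cong refl)
      fix i assume i: "i \<in> {0..<m}"
      then have "mat_delete ?C j k $$ (i, \<sigma> i) = ?C $$ (insert_index j i, insert_index k (\<sigma> i))"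
        using assms permutes_lt[OF \<sigma>, of i] by (intro mat_delete_index[OF C, symmetric]) auto
      then show "mat_delete ?C j k $$ (i, \<sigma> i) = (\<Sum>p<Suc m. \<Sum>q<Suc m. ?c \<sigma> i p q)"
        using i ins permutes_lt[OF \<sigma>, of i] by (simp add: quad_mat_def del: sum.lessThan_Suc)
    qed
    also have "\<dots> = (\<Sum>f\<in>rows_to m. \<Sum>g\<in>rows_to m. \<Prod>i = 0..<m. ?c \<sigma> i (f i) (g i))"
      by (simp add: prod_sum_PiE del: sum.lessThan_Suc)
    finally show ?thesis by (simp add: prod.distrib even_scalar.hom_prod)
  qed
  have "adj_mat ?C $$ (k, j) = (- 1) ^ (j + k) * det (mat_delete ?C j k)"
    using assms C by (simp add: adj_mat_def cofactor_def)
  also have "\<dots> = (\<Sum>\<sigma> | \<sigma> permutes {0..<m}. \<Sum>f\<in>rows_to m. \<Sum>g\<in>rows_to m.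
      even_scalar ((- 1) ^ (j + k) * signof \<sigma> * (\<Prod>i = 0..<m. B $$ (f i, g i))) *
        (\<Prod>i = 0..<m. da_pair (insert_index j i) (f i) (g i) (insert_index k (\<sigma> i))))"
    unfolding det_def'[OF del] sum_distrib_left
    by (intro sum.cong refl)
      (simp add: prod sum_distrib_left even_scalar.hom_mult even_scalar.hom_power
        even_scalar.hom_uminus mult.assoc)
  finally have "form_of_even (adj_mat ?C $$ (k, j)) * da j k =
      (\<Sum>\<sigma> | \<sigma> permutes {0..<m}. \<Sum>f\<in>rows_to m. \<Sum>g\<in>rows_to m.
      scalar_form ((- 1) ^ (j + k) * signof \<sigma> * (\<Prod>i = 0..<m. B $$ (f i, g i))) *
        (prod_list (map (\<lambda>i. da (insert_index j i) (f i) * da (g i) (insert_index k (\<sigma> i))) [0..<m]) * da j k))"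
    by (simp add: form_of_even_sum times_eform.rep_eq even_scalar.rep_eq form_of_even_prod
        da_pair.rep_eq sum_distrib_right mult.assoc del: of_int_power)
  then show ?thesis
    unfolding da_prod_slots by (simp add: scalar_form_mult mult.assoc)
qed

text \<open>
  The cofactors are expanded by the Leibniz formula and each entry of \<open>dA B dA\<close> by its definition. The
  sign \<open>(- 1) ^ (m choose 2)\<close> separates the left factors from the right factors.
\<close>

lemma adj_trace_coeff:
  fixes B :: "'a::comm_ring_1 mat"
  assumes v: "distinct v" "\<forall>x\<in>set v. fst x \<le> snd x" and len: "length v = 2 * m + 1"
  shows "form_coeff (\<Sum>k<Suc m. \<Sum>j<Suc m.
      form_of_even (adj_mat (quad_mat (Suc m) B) $$ (k, j)) * da j k) (set v) =
    (- 1) ^ (m choose 2) * (\<Sum>F\<in>Pow (off_positions v). slot_sum m B (flip_at F v)) *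
      form_coeff (da_prod v) (set v)"
proof -
  let ?c = "form_coeff (da_prod v) (set v) :: 'a"
  let ?w = "\<lambda>j k \<sigma> f g. (- 1) ^ (j + k) * (signof \<sigma> * (\<Prod>i = 0..<m. B $$ (f i, g i)))"
  have "form_coeff (form_of_even (adj_mat (quad_mat (Suc m) B) $$ (k, j)) * da j k) (set v) =
      (- 1) ^ (m choose 2) * ?c * (\<Sum>F\<in>Pow (off_positions v). (- 1) ^ (j + k) *
        slot_cell m B j k (flip_at F v))"
    if "k < Suc m" "j < Suc m" for j k
  proof -
    have "form_coeff (form_of_even (adj_mat (quad_mat (Suc m) B) $$ (k, j)) * da j k) (set v) =
      (\<Sum>\<sigma> | \<sigma> permutes {0..<m}. \<Sum>f\<in>rows_to m. \<Sum>g\<in>rows_to m. \<Sum>F\<in>Pow (off_positions v).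
        (- 1) ^ (m choose 2) * ?c * (?w j k \<sigma> f g * det (match_mat (slots m j k f g \<sigma>) (flip_at F v))))"
      unfolding adj_quad_mat_entry[OF that(2,1)] form_coeff_sum form_coeff_scalar_times
    proof (intro sum.cong refl)
      fix \<sigma> f g
      have "length (slots m j k f g \<sigma>) = length v" by (simp add: len)
      note eq = da_prod_coeff[OF v(1) v(2) this, where ?'a = 'a]
      show "(- 1) ^ (j + k) * signof \<sigma> * (\<Prod>i = 0..<m. B $$ (f i, g i)) * (- 1) ^ (m choose 2) *
          form_coeff (da_prod (slots m j k f g \<sigma>)) (set v) =
        (\<Sum>F\<in>Pow (off_positions v). (- 1) ^ (m choose 2) * ?c *
          (?w j k \<sigma> f g * det (match_mat (slots m j k f g \<sigma>) (flip_at F v))))"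
        unfolding eq sum_distrib_left sum_distrib_right
        by (intro sum.cong refl) (simp only: mult_ac)
    qed
    also have "\<dots> = (\<Sum>F\<in>Pow (off_positions v). \<Sum>\<sigma> | \<sigma> permutes {0..<m}. \<Sum>f\<in>rows_to m. \<Sum>g\<in>rows_to m.
        (- 1) ^ (m choose 2) * ?c * (?w j k \<sigma> f g * det (match_mat (slots m j k f g \<sigma>) (flip_at F v))))"
      by (simp only: sum.swap[of _ _ "Pow (off_positions v)"])
    finally show ?thesis
      by (simp add: slot_cell_def sum_distrib_left mult.assoc)
  qed
  then have "form_coeff (\<Sum>k<Suc m. \<Sum>j<Suc m.
      form_of_even (adj_mat (quad_mat (Suc m) B) $$ (k, j)) * da j k) (set v) =
    (\<Sum>k<Suc m. \<Sum>j<Suc m. \<Sum>F\<in>Pow (off_positions v). (- 1) ^ (m choose 2) * ?c * ((- 1) ^ (j + k) *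
        slot_cell m B j k (flip_at F v)))"
    by (simp add: form_coeff_sum sum_distrib_left del: sum.lessThan_Suc)
  also have "\<dots> = (\<Sum>F\<in>Pow (off_positions v). \<Sum>k<Suc m. \<Sum>j<Suc m. (- 1) ^ (m choose 2) * ?c * ((- 1) ^ (j + k) *
        slot_cell m B j k (flip_at F v)))"
    by (simp only: sum.swap[of _ _ "Pow (off_positions v)"])
  also have "\<dots> = (- 1) ^ (m choose 2) * ?c * (\<Sum>F\<in>Pow (off_positions v). slot_sum m B (flip_at F v))"
    by (simp only: slot_sum_def sum_distrib_left)
  finally show ?thesis by (simp add: mult_ac)
qed

section \<open>Permanents and incidence determinants\<close>

definition permanent :: "'e set \<Rightarrow> ('e \<Rightarrow> 'e \<Rightarrow> 'r::comm_ring_1) \<Rightarrow> 'r" where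
  "permanent E M = (\<Sum>\<pi> | \<pi> permutes E. \<Prod>e\<in>E. M e (\<pi> e))"

lemma permanent_permute_rows:
  assumes \<rho>: "\<rho> permutes E" and fin: "finite E"
  shows "permanent E (\<lambda>e. M (\<rho> e)) = permanent E M"
proof -
  have "permanent E M = (\<Sum>\<pi> | \<pi> permutes E. \<Prod>e\<in>E. M (\<rho> e) (\<pi> (\<rho> e)))"
    unfolding permanent_def
    by (intro sum.cong refl prod.permute[OF \<rho>, unfolded comp_def])
  also have "\<dots> = permanent E (\<lambda>e. M (\<rho> e))"
    unfolding permanent_def
    by (subst sum_permutations_compose_right[OF \<rho>, of "\<lambda>\<pi>. \<Prod>e\<in>E. M (\<rho> e) (\<pi> e)"]) simp
  finally show ?thesis ..
qed

lemma permanent_permute_cols: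
  assumes \<rho>: "\<rho> permutes E"
  shows "permanent E (\<lambda>e f. M e (\<rho> f)) = permanent E M"
  unfolding permanent_def
  by (subst (2) setum_permutations_compose_left[OF \<rho>]) simp

text \<open>
  Permanents are invariant under independent permutations of rows and columns. It is this invariance
  that lets the entries of \<open>B\<close> be pulled out of the sum over all placements.
\<close>

lemma permanent_mset_cong:
  fixes m :: nat
  assumes "mset ts = mset ts'" "mset ss = mset ss'" "length ts = m" "length ss = m"
  shows "permanent {0..<m} (\<lambda>i j. b (ts ! i) (ss ! j)) = permanent {0..<m} (\<lambda>i j. b (ts' ! i) (ss' ! j))"
proof -
  have len: "length ts' = m" "length ss' = m" using assms mset_eq_length by metis+
  obtain p where p: "p permutes {0..<m}" "permute_list p ts' = ts"
    using mset_eq_permutation[OF assms(1)] len by (metis lessThan_atLeast0)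
  obtain q where q: "q permutes {0..<m}" "permute_list q ss' = ss"
    using mset_eq_permutation[OF assms(2)] len by (metis lessThan_atLeast0)
  have tp: "ts ! i = ts' ! p i" and sq: "ss ! i = ss' ! q i" if "i < m" for i
    using p q that len permute_list_nth[of p ts' i] permute_list_nth[of q ss' i]
    by (auto simp: lessThan_atLeast0)
  have "permanent {0..<m} (\<lambda>i j. b (ts ! i) (ss ! j)) =
      permanent {0..<m} (\<lambda>i j. b (ts' ! p i) (ss' ! q j))"
    unfolding permanent_def by (intro sum.cong prod.cong refl) (auto simp: tp sq permutes_lt)
  also have "\<dots> = permanent {0..<m} (\<lambda>i j. b (ts' ! p i) (ss' ! j))"
    using permanent_permute_cols[OF q(1), of "\<lambda>i j. b (ts' ! p i) (ss' ! j)"] by simp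
  also have "\<dots> = permanent {0..<m} (\<lambda>i j. b (ts' ! i) (ss' ! j))"
    using permanent_permute_rows[OF p(1), of "\<lambda>i j. b (ts' ! i) (ss' ! j)"] by simp
  finally show ?thesis .
qed

definition incidence_minor :: "nat \<Rightarrow> (nat \<times> nat) list \<Rightarrow> nat \<Rightarrow> int mat" where
  "incidence_minor n w k =
    mat (length w) (2 * n - 1) (\<lambda>(r, c). incidence_mat n w $$ (r, insert_index k c))"

lemma pick_skip: "pick (- {k}) c = insert_index k c"
proof -
  have "{a \<in> - {k}. a < insert_index k c} = (if c < k then {..<c} else {..<Suc c} - {k})"
    by (auto simp: insert_index_def)
  then have "card {a \<in> - {k}. a < insert_index k c} = c" by (simp add: card_Diff_subset)
  moreover have "insert_index k c \<in> - {k}" by (auto simp: insert_index_def)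
  ultimately show ?thesis using pick_card_in_set by metis
qed

lemma submatrix_incidence:
  assumes "k < 2 * n"
  shows "submatrix (incidence_mat n w) UNIV (- {k}) = incidence_minor n w k"
proof -
  have "{j. j < 2 * n \<and> j \<in> - {k}} = {..<2 * n} - {k}" by auto
  then have "card {j. j < 2 * n \<and> j \<in> - {k}} = 2 * n - 1" using assms by simp
  then show ?thesis
    by (simp add: submatrix_def incidence_minor_def incidence_mat_def pick_UNIV pick_skip)
qed

text \<open>
  Complete \<open>M\<close> by a first row which is the difference of two unit vectors. All rows sum to zero, so the
  square matrix is singular, and its expansion along the first row compares the two minors.
\<close>

lemma det_delete_column_alternates:
  fixes M :: "int mat"
  assumes M: "M \<in> carrier_mat N (Suc N)" and zero: "\<And>r. r < N \<Longrightarrow> (\<Sum>c<Suc N. M $$ (r, c)) = 0"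
    and k: "k < Suc N" and k': "k' < Suc N"
  shows "(- 1) ^ k * det (mat N N (\<lambda>(r, c). M $$ (r, insert_index k c))) =
    (- 1) ^ k' * det (mat N N (\<lambda>(r, c). M $$ (r, insert_index k' c)))"
proof -
  let ?d = "\<lambda>k. det (mat N N (\<lambda>(r, c). M $$ (r, insert_index k c)))"
  \<comment> \<open>The difference of two unit vectors, placed above \<open>M\<close>.\<close>
  define e where "e c = (if c = k then 1 else 0) - (if c = k' then 1 else (0 :: int))" for c
  define Q where "Q = mat (Suc N) (Suc N) (\<lambda>(r, c). if r = 0 then e c else M $$ (r - 1, c))"
  have Q: "Q \<in> carrier_mat (Suc N) (Suc N)" by (simp add: Q_def)
  have "Q *\<^sub>v vec (Suc N) (\<lambda>_. 1) = 0\<^sub>v (Suc N)"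
  proof (rule eq_vecI)
    fix r assume "r < dim_vec (0\<^sub>v (Suc N) :: int vec)"
    then have r: "r < Suc N" by simp
    have "(Q *\<^sub>v vec (Suc N) (\<lambda>_. 1)) $ r = (\<Sum>c<Suc N. Q $$ (r, c))"
      using r Q by (simp add: scalar_prod_def lessThan_atLeast0 del: sum.lessThan_Suc sum.op_ivl_Suc)
    also have "\<dots> = 0"
    proof (cases r)
      case 0
      have "(\<Sum>c<Suc N. Q $$ (r, c)) = (\<Sum>c<Suc N. e c)"
        by (intro sum.cong refl) (simp add: Q_def 0)
      also have "\<dots> = 0"
        unfolding e_def sum_subtractf using k k' by (simp add: sum.delta del: sum.lessThan_Suc)
      finally show ?thesis .
    next
      case (Suc r')
      have "(\<Sum>c<Suc N. Q $$ (r, c)) = (\<Sum>c<Suc N. M $$ (r', c))"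
        using r by (intro sum.cong refl) (simp add: Q_def Suc)
      then show ?thesis using zero[of r'] r Suc by simp
    qed
    finally show "(Q *\<^sub>v vec (Suc N) (\<lambda>_. 1)) $ r = 0\<^sub>v (Suc N) $ r" using r by simp
  qed (use Q in simp)
  moreover have "vec (Suc N) (\<lambda>_. 1 :: int) \<noteq> 0\<^sub>v (Suc N)"
    by (auto simp: vec_eq_iff)
  ultimately have det0: "det Q = 0"
    using det_0_iff_vec_prod_zero[OF Q] by (metis vec_carrier)
  have expand: "det Q = (\<Sum>c<Suc N. e c * ((- 1) ^ c * ?d c))"
  proof (subst laplace_expansion_row[OF Q, of 0], simp, intro sum.cong refl)
    fix c assume c: "c \<in> {..<Suc N}"
    have "mat_delete Q 0 c = mat N N (\<lambda>(r, c'). M $$ (r, insert_index c c'))"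
      using c by (intro eq_matI) (auto simp: mat_delete_def Q_def insert_index_def)
    then show "Q $$ (0, c) * cofactor Q 0 c = e c * ((- 1) ^ c * ?d c)"
      using c by (simp add: cofactor_def Q_def)
  qed
  have pick: "(\<Sum>c<Suc N. e c * g c) = g k - g k'" for g
    using k k' unfolding e_def left_diff_distrib sum_subtractf
    by (simp add: if_distrib[of "\<lambda>x. x * _"] sum.delta' cong: if_cong del: sum.lessThan_Suc)
  show ?thesis
    using expand unfolding det0 pick[of "\<lambda>c. (- 1) ^ c * ?d c"] by simp
qed

lemma incidence_minor_alternates:
  assumes len: "length w = 2 * n - 1" and n: "n \<ge> 1" and k: "k < 2 * n" "k' < 2 * n"
    and w: "\<forall>x\<in>set w. fst x < n \<and> snd x < n"
  shows "(- 1) ^ k * det (incidence_minor n w k) = (- 1) ^ k' * det (incidence_minor n w k')"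
  unfolding incidence_minor_def len
proof (rule det_delete_column_alternates)
  have N: "Suc (2 * n - 1) = 2 * n" using n by simp
  show "incidence_mat n w \<in> carrier_mat (2 * n - 1) (Suc (2 * n - 1))"
    unfolding N by (simp add: incidence_mat_def len)
  show "k < Suc (2 * n - 1)" "k' < Suc (2 * n - 1)" using k by simp_all
  fix r assume r: "r < 2 * n - 1"
  have b: "fst (w ! r) < n" "snd (w ! r) < n" using w r len by auto
  have "(\<Sum>c<2 * n. incidence_mat n w $$ (r, c)) =
      (\<Sum>c<2 * n. (if c = n + snd (w ! r) then 1 else 0) - (if c = fst (w ! r) then 1 else 0))"
    using r len b by (intro sum.cong refl) (auto simp: incidence_mat_def)
  also have "\<dots> = 0" using b unfolding sum_subtractf by simp
  finally show "(\<Sum>c<Suc (2 * n - 1). incidence_mat n w $$ (r, c)) = 0" unfolding N .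
qed

lemma det_scale_rows:
  assumes A: "A \<in> carrier_mat n n"
  shows "det (mat n n (\<lambda>(r, c). d r * A $$ (r, c))) = (\<Prod>r = 0..<n. d r) * det A"
  unfolding det_def'[OF A] det_def'[OF mat_carrier] sum_distrib_left
  by (intro sum.cong refl) (auto simp: permutes_lt prod.distrib mult_ac)

lemma prod_blocks:
  "(\<Prod>s = 0..<Suc (m + m'). F s) = F 0 * ((\<Prod>i = 0..<m. F (Suc i)) * (\<Prod>i = 0..<m'. F (Suc (m + i))))"
proof -
  have "(\<Prod>s = 0..<Suc (m + m'). F s) = F 0 * (\<Prod>i = 0..<m + m'. F (Suc i))"
    unfolding prod.atLeast0_lessThan_Suc_shift by (simp add: comp_def)
  also have "(\<Prod>i = 0..<m + m'. F (Suc i)) = (\<Prod>i = 0..<m. F (Suc i)) * (\<Prod>i = m..<m + m'. F (Suc i))"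
    by (rule prod.atLeastLessThan_concat[symmetric]) auto
  also have "(\<Prod>i = m..<m + m'. F (Suc i)) = (\<Prod>i = 0..<m'. F (Suc (m + i)))"
    using prod.shift_bounds_nat_ivl[of "\<lambda>i. F (Suc i)" 0 m m'] by (simp add: add.commute)
  finally show ?thesis .
qed

text \<open>
  The sum of the matching determinants of all \<open>slots\<close> with given \<open>j\<close> and \<open>k\<close>: after the free index has
  been summed over, a left factor only has to have the right row and a right factor the right
  column.
\<close>

definition slot_mat :: "nat \<Rightarrow> (nat \<times> nat) list \<Rightarrow> nat \<Rightarrow> nat \<Rightarrow> 'r::comm_ring_1 mat" where
  "slot_mat m w j k = mat (2 * m + 1) (2 * m + 1) (\<lambda>(r, c).
     of_bool (if r = 0 then w ! c = (j, k)
      else if r \<le> m then fst (w ! c) = insert_index j (r - 1)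
      else snd (w ! c) = insert_index k (r - 1 - m)))"

lemma slot_mat_hom: "of_int (det (slot_mat m w j k :: int mat)) = (det (slot_mat m w j k) :: 'r::comm_ring_1)"
proof -
  have "map_mat of_int (slot_mat m w j k) = (slot_mat m w j k :: 'r mat)"
    by (intro eq_matI) (auto simp: slot_mat_def of_bool_def)
  then show ?thesis by (metis of_int_hom.hom_det)
qed

text \<open>
  In each term of the Leibniz formula the free indices occur in separate factors, so the sum over
  \<open>f\<close> and \<open>g\<close> is a product of sums over single indices.
\<close>

lemma sum_det_match_slots:
  assumes len: "length w = 2 * m + 1" and w: "\<forall>x\<in>set w. fst x < Suc m \<and> snd x < Suc m"
  shows "(\<Sum>f\<in>rows_to m. \<Sum>g\<in>rows_to m. det (match_mat (slots m j k f g id) w)) =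
    (det (slot_mat m w j k) :: 'r::comm_ring_1)"
proof -
  define h where "h x y = (if x = y then 1 else 0 :: 'r)" for x y :: "nat \<times> nat"
  let ?P = "{\<tau>. \<tau> permutes {0..<2 * m + 1}}"
  have N: "2 * m + 1 = Suc (m + m)" by simp
  have S: "slot_mat m w j k \<in> carrier_mat (2 * m + 1) (2 * m + 1)" by (simp add: slot_mat_def)
  have match: "match_mat (slots m j k f g id) w \<in> carrier_mat (2 * m + 1) (2 * m + 1)" for f g
    by (simp add: match_mat_def len)
  have "det (match_mat (slots m j k f g id) w) =
      (\<Sum>\<tau>\<in>?P. signof \<tau> * (h (j, k) (w ! \<tau> 0) *
        ((\<Prod>i = 0..<m. h (insert_index j i, f i) (w ! \<tau> (Suc i))) *
         (\<Prod>i = 0..<m. h (g i, insert_index k i) (w ! \<tau> (Suc (m + i)))))))" for f g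
    unfolding det_def'[OF match]
  proof (intro sum.cong refl)
    fix \<tau> assume "\<tau> \<in> ?P"
    then have lt: "\<tau> s < 2 * m + 1" if "s < 2 * m + 1" for s using permutes_lt that by simp
    have "(\<Prod>s = 0..<2 * m + 1. match_mat (slots m j k f g id) w $$ (s, \<tau> s)) =
        (\<Prod>s = 0..<Suc (m + m). h (slots m j k f g id ! s) (w ! \<tau> s))"
      unfolding N[symmetric] using lt len by (intro prod.cong refl) (simp add: match_mat_def h_def)
    also have "\<dots> = h (j, k) (w ! \<tau> 0) *
        ((\<Prod>i = 0..<m. h (insert_index j i, f i) (w ! \<tau> (Suc i))) *
         (\<Prod>i = 0..<m. h (g i, insert_index k i) (w ! \<tau> (Suc (m + i)))))"
      unfolding prod_blocks
      by (intro arg_cong2[where f = "(*)"] prod.cong refl) (auto simp: slots_def nth_append)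
    finally show "signof \<tau> * (\<Prod>s = 0..<2 * m + 1. match_mat (slots m j k f g id) w $$ (s, \<tau> s)) =
        signof \<tau> * (h (j, k) (w ! \<tau> 0) *
        ((\<Prod>i = 0..<m. h (insert_index j i, f i) (w ! \<tau> (Suc i))) *
         (\<Prod>i = 0..<m. h (g i, insert_index k i) (w ! \<tau> (Suc (m + i))))))" by simp
  qed
  then have "(\<Sum>f\<in>rows_to m. \<Sum>g\<in>rows_to m. det (match_mat (slots m j k f g id) w)) =
      (\<Sum>f\<in>rows_to m. \<Sum>g\<in>rows_to m. \<Sum>\<tau>\<in>?P. signof \<tau> * (h (j, k) (w ! \<tau> 0) *
        ((\<Prod>i = 0..<m. h (insert_index j i, f i) (w ! \<tau> (Suc i))) *
         (\<Prod>i = 0..<m. h (g i, insert_index k i) (w ! \<tau> (Suc (m + i)))))))"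
    by simp
  also have "\<dots> = (\<Sum>\<tau>\<in>?P. \<Sum>f\<in>rows_to m. \<Sum>g\<in>rows_to m. signof \<tau> * (h (j, k) (w ! \<tau> 0) *
        ((\<Prod>i = 0..<m. h (insert_index j i, f i) (w ! \<tau> (Suc i))) *
         (\<Prod>i = 0..<m. h (g i, insert_index k i) (w ! \<tau> (Suc (m + i)))))))"
    by (simp only: sum.swap[of _ ?P])
  also have "\<dots> = (\<Sum>\<tau>\<in>?P. signof \<tau> * (h (j, k) (w ! \<tau> 0) *
        ((\<Prod>i = 0..<m. \<Sum>p<Suc m. h (insert_index j i, p) (w ! \<tau> (Suc i))) *
         (\<Prod>i = 0..<m. \<Sum>q<Suc m. h (q, insert_index k i) (w ! \<tau> (Suc (m + i)))))))"
    unfolding prod_sum_PiE[OF finite_atLeastLessThan finite_lessThan]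
    unfolding sum_product unfolding sum_distrib_left ..
  also have "\<dots> = (\<Sum>\<tau>\<in>?P. signof \<tau> * (\<Prod>s = 0..<2 * m + 1. slot_mat m w j k $$ (s, \<tau> s)))"
  proof (intro sum.cong refl)
    fix \<tau> assume "\<tau> \<in> ?P"
    then have lt: "\<tau> s < 2 * m + 1" if "s < 2 * m + 1" for s using permutes_lt that by simp
    then have b: "fst (w ! \<tau> s) < Suc m" "snd (w ! \<tau> s) < Suc m" if "s < 2 * m + 1" for s
      using that len w by (auto simp: less_Suc_eq)
    have "(\<Sum>p<Suc m. h (insert_index j i, p) (w ! \<tau> (Suc i))) = slot_mat m w j k $$ (Suc i, \<tau> (Suc i))"
      if i: "i < m" for i
    proof -
      have "(\<Sum>p<Suc m. h (insert_index j i, p) (w ! \<tau> (Suc i))) =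
          (\<Sum>p\<in>{snd (w ! \<tau> (Suc i))}. of_bool (insert_index j i = fst (w ! \<tau> (Suc i))))"
        using b[of "Suc i"] i by (intro sum.mono_neutral_cong_right) (auto simp: h_def prod_eq_iff)
      then show ?thesis using lt[of "Suc i"] i by (auto simp: slot_mat_def)
    qed
    moreover have "(\<Sum>q<Suc m. h (q, insert_index k i) (w ! \<tau> (Suc (m + i)))) =
        slot_mat m w j k $$ (Suc (m + i), \<tau> (Suc (m + i)))" if i: "i < m" for i
    proof -
      have "(\<Sum>q<Suc m. h (q, insert_index k i) (w ! \<tau> (Suc (m + i)))) =
          (\<Sum>q\<in>{fst (w ! \<tau> (Suc (m + i)))}. of_bool (insert_index k i = snd (w ! \<tau> (Suc (m + i)))))"
        using b[of "Suc (m + i)"] i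
          by (intro sum.mono_neutral_cong_right) (auto simp: h_def prod_eq_iff)
      then show ?thesis using lt[of "Suc (m + i)"] i by (auto simp: slot_mat_def)
    qed
    moreover have "h (j, k) (w ! \<tau> 0) = slot_mat m w j k $$ (0, \<tau> 0)"
      using lt[of 0] by (auto simp: slot_mat_def h_def)
    ultimately show "signof \<tau> * (h (j, k) (w ! \<tau> 0) *
        ((\<Prod>i = 0..<m. \<Sum>p<Suc m. h (insert_index j i, p) (w ! \<tau> (Suc i))) *
         (\<Prod>i = 0..<m. \<Sum>q<Suc m. h (q, insert_index k i) (w ! \<tau> (Suc (m + i)))))) =
        signof \<tau> * (\<Prod>s = 0..<2 * m + 1. slot_mat m w j k $$ (s, \<tau> s))"
      unfolding N prod_blocks by simp
  qed
  also have "\<dots> = det (slot_mat m w j k)" by (rule det_def'[OF S, symmetric])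
  finally show ?thesis .
qed

text \<open>
  After the column of the vertex \<open>j\<close> has been deleted, row \<open>l\<close> of the incidence matrix, which belongs to
  the pair \<open>(j, k)\<close>, has a single entry. Expanding along it leaves the rows and columns of the
  matrix on the left, transposed and with \<open>m\<close> negated columns.
\<close>

lemma slot_minor_eq_incidence_minor:
  assumes len: "length w = 2 * m + 1" and w: "\<forall>x\<in>set w. fst x < Suc m \<and> snd x < Suc m"
    and m: "even m" and l: "l < 2 * m + 1" and jk: "w ! l = (j, k)"
  shows "(- 1) ^ (j + k) * ((- 1) ^ l * det (mat_delete (slot_mat m w j k :: int mat) 0 l)) =
    (- 1) ^ j * det (incidence_minor (Suc m) w j)"
proof -
  let ?N = "2 * m + 1"
  let ?I = "incidence_minor (Suc m) w j" and ?S = "mat_delete (slot_mat m w j k :: int mat) 0 l"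
  have "w ! l \<in> set w" using l len by simp
  then have lt: "j < Suc m" "k < Suc m" using w jk by auto
  have I: "?I \<in> carrier_mat ?N ?N" by (simp add: incidence_minor_def len)
  have S: "?S \<in> carrier_mat (2 * m) (2 * m)" by (rule carrier_matI) (simp_all add: slot_mat_def)
  have entry: "?I $$ (r, c) =
      (if c < m then - of_bool (fst (w ! r) = insert_index j c) else of_bool (snd (w ! r) = c - m))"
    if r: "r < ?N" and c: "c < ?N" for r c
  proof -
    have x: "fst (w ! r) < Suc m" using w r len by auto
    have I_rc: "?I $$ (r, c) = (if insert_index j c = fst (w ! r) then - 1
        else if insert_index j c = Suc m + snd (w ! r) then 1 else 0)"
      using r c lt len by (simp add: incidence_minor_def incidence_mat_def insert_index_def)
    show ?thesis
    proof (cases "c < m")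
      case True
      then have "insert_index j c < Suc m" by (simp add: insert_index_def)
      then show ?thesis using True unfolding I_rc by auto
    next
      case False
      then have "insert_index j c = Suc c" using lt by (simp add: insert_index_def)
      then show ?thesis using False x unfolding I_rc by auto
    qed
  qed
  have "det ?I = (\<Sum>c<?N. ?I $$ (l, c) * cofactor ?I l c)"
    using laplace_expansion_row[OF I l] .
  also have "\<dots> = (\<Sum>c\<in>{m + k}. cofactor ?I l c)"
  proof (rule sum.mono_neutral_cong_right)
    show "\<forall>c\<in>{..<?N} - {m + k}. ?I $$ (l, c) * cofactor ?I l c = 0"
    proof
      fix c assume c: "c \<in> {..<?N} - {m + k}"
      then have "?I $$ (l, c) = 0"
        using entry[OF l, of c] jk by (auto simp: insert_index_def)
      then show "?I $$ (l, c) * cofactor ?I l c = 0" by simp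
    qed
    show "?I $$ (l, c) * cofactor ?I l c = cofactor ?I l c" if "c \<in> {m + k}" for c
      using entry[OF l, of c] jk lt that by simp
  qed (use lt in auto)
  also have "\<dots> = (- 1) ^ (l + (m + k)) * det (mat_delete ?I l (m + k))"
    by (simp add: cofactor_def)
  also have "(- 1) ^ (l + (m + k)) = ((- 1) ^ (l + k) :: int)"
    using m by (auto simp: power_add elim!: evenE)
  also have "det (mat_delete ?I l (m + k)) = det ?S"
  proof -
    define d where "d r = (if r < m then - 1 else 1 :: int)" for r
    have "mat_delete ?I l (m + k) = (mat (2 * m) (2 * m) (\<lambda>(r, c). d r * ?S $$ (r, c)))\<^sup>T"
    proof (rule eq_matI)
      fix r c assume "r < dim_row ((mat (2 * m) (2 * m) (\<lambda>(r, c). d r * ?S $$ (r, c)))\<^sup>T)"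
        "c < dim_col ((mat (2 * m) (2 * m) (\<lambda>(r, c). d r * ?S $$ (r, c)))\<^sup>T)"
      then have rc: "r < 2 * m" "c < 2 * m" by auto
      have "mat_delete ?I l (m + k) $$ (r, c) = ?I $$ (insert_index l r, insert_index (m + k) c)"
        using rc l lt by (intro mat_delete_index[symmetric, of _ "2 * m"]) (use I in auto)
      also have "\<dots> = d c * ?S $$ (c, r)"
        using rc l lt by (subst entry) (auto simp: insert_index_def mat_delete_def slot_mat_def d_def)
      finally show "mat_delete ?I l (m + k) $$ (r, c) =
          (mat (2 * m) (2 * m) (\<lambda>(r, c). d r * ?S $$ (r, c)))\<^sup>T $$ (r, c)"
        using rc by simp
    qed (use I in \<open>auto simp: mat_delete_def\<close>)
    then have "det (mat_delete ?I l (m + k)) = (\<Prod>r = 0..<2 * m. d r) * det ?S"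
      by (simp add: det_transpose[of _ "2 * m"] det_scale_rows[OF S])
    also have "(\<Prod>r = 0..<2 * m. d r) = (\<Prod>r = 0..<m. d r) * (\<Prod>r = m..<2 * m. d r)"
      by (rule prod.atLeastLessThan_concat[symmetric]) auto
    also have "\<dots> = (- 1) ^ m" by (simp add: d_def)
    finally show ?thesis using m by simp
  qed
  finally show ?thesis by (simp add: power_add mult_ac)
qed

text \<open>
  Expanding along the special slot, each of the \<open>2 m + 1\<close> pairs in \<open>w\<close> may take it, and each choice
  contributes the same incidence determinant. This is the origin of the factor \<open>2 n - 1\<close>.
\<close>

lemma sum_slot_mat:
  assumes len: "length w = 2 * m + 1" and w: "\<forall>x\<in>set w. fst x < Suc m \<and> snd x < Suc m"
    and m: "even m" and c: "c < 2 * Suc m"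
  shows "(\<Sum>k<Suc m. \<Sum>j<Suc m. (- 1) ^ (j + k) * det (slot_mat m w j k :: int mat)) =
    int (2 * m + 1) * ((- 1) ^ c * det (incidence_minor (Suc m) w c))"
proof -
  let ?N = "2 * m + 1"
  let ?D = "\<lambda>l j k. (- 1) ^ (j + k) * ((- 1) ^ l * det (mat_delete (slot_mat m w j k :: int mat) 0 l))"
  have S: "slot_mat m w j k \<in> carrier_mat ?N ?N" for j k by (simp add: slot_mat_def)
  have zero_less_N: "0 < ?N" by simp
  have "(\<Sum>k<Suc m. \<Sum>j<Suc m. (- 1) ^ (j + k) * det (slot_mat m w j k :: int mat)) =
      (\<Sum>k<Suc m. \<Sum>j<Suc m. \<Sum>l<?N. if w ! l = (j, k) then ?D l j k else 0)"
  proof (intro sum.cong refl)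
    fix j k
    show "(- 1) ^ (j + k) * det (slot_mat m w j k :: int mat) =
        (\<Sum>l<?N. if w ! l = (j, k) then ?D l j k else 0)"
      unfolding laplace_expansion_row[OF S zero_less_N] sum_distrib_left
      by (intro sum.cong refl) (auto simp: cofactor_def slot_mat_def)
  qed
  also have "\<dots> = (\<Sum>l<?N. \<Sum>k<Suc m. \<Sum>j<Suc m. if w ! l = (j, k) then ?D l j k else 0)"
    by (simp only: sum.swap[of _ "{..<?N}"])
  also have "\<dots> = (\<Sum>l<?N. (- 1) ^ c * det (incidence_minor (Suc m) w c))"
  proof (intro sum.cong refl)
    fix l assume "l \<in> {..<?N}"
    then have l: "l < ?N" by simp
    obtain j k where jk: "w ! l = (j, k)" by (cases "w ! l")
    have "w ! l \<in> set w" using l len by simp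
  then have lt: "j < Suc m" "k < Suc m" using w jk by auto
    have "(\<Sum>k'<Suc m. \<Sum>j'<Suc m. if w ! l = (j', k') then ?D l j' k' else 0) =
        (\<Sum>k'<Suc m. if k' = k then \<Sum>j'<Suc m. if j' = j then ?D l j' k' else 0 else 0)"
      by (intro sum.cong refl) (auto simp: jk intro!: sum.cong)
    also have "\<dots> = ?D l j k"
      using lt by (simp add: sum.delta del: sum.lessThan_Suc)
    also have "\<dots> = (- 1) ^ j * det (incidence_minor (Suc m) w j)"
      by (rule slot_minor_eq_incidence_minor[OF len w m l jk])
    also have "\<dots> = (- 1) ^ c * det (incidence_minor (Suc m) w c)"
      using lt c len w by (intro incidence_minor_alternates) auto
    finally show "(\<Sum>k'<Suc m. \<Sum>j'<Suc m. if w ! l = (j', k') then ?D l j' k' else 0) =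
        (- 1) ^ c * det (incidence_minor (Suc m) w c)" .
  qed
  finally show ?thesis by simp
qed

text \<open>
  Permuting the right factors permutes rows of the matching matrix; the sign cancels that of the
  Leibniz formula for the cofactor and leaves a permanent.
\<close>

lemma det_match_slots_permute:
  assumes len: "length w = 2 * m + 1" and \<sigma>: "\<sigma> permutes {0..<m}"
  shows "det (match_mat (slots m j k f (\<lambda>i. g (\<sigma> i)) \<sigma>) w) =
    (signof \<sigma> * det (match_mat (slots m j k f g id) w) :: 'r::comm_ring_1)"
proof -
  let ?N = "2 * m + 1" and ?e = "\<lambda>i. Suc (m + i)"
  \<comment> \<open>The permutation of the right factors, acting on the positions \<open>m + 1, \<dots>, 2 m\<close> of all slots.\<close>
  define \<rho> where "\<rho> = map_permutation {0..<m} ?e \<sigma>"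
  have inj: "inj_on ?e {0..<m}" by (simp add: inj_on_def)
  have \<rho>': "\<rho> permutes ?e ` {0..<m}"
    unfolding \<rho>_def by (rule map_permutation_permutes[OF inj_on_imp_bij_betw[OF inj] \<sigma>])
  have \<rho>: "\<rho> permutes {0..<?N}" by (rule permutes_subset[OF \<rho>']) auto
  have sgn: "sign \<rho> = sign \<sigma>" unfolding \<rho>_def by (rule sign_map_permutation[OF inj \<sigma>]) simp
  have app: "\<rho> (?e i) = ?e (\<sigma> i)" if "i < m" for i
    unfolding \<rho>_def using that by (subst map_permutation_apply[OF inj]) auto
  have low: "\<rho> s = s" if "s \<le> m" for s
  proof -
    have "s \<notin> ?e ` {0..<m}" using that by auto
    then show ?thesis by (rule permutes_not_in[OF \<rho>'])
  qed
  have slot: "slots m j k f (\<lambda>i. g (\<sigma> i)) \<sigma> ! s = slots m j k f g id ! \<rho> s" if s: "s < ?N" for s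
  proof (cases "s \<le> m")
    case True
    then show ?thesis unfolding low[OF True] by (cases s) (auto simp: slots_def nth_append)
  next
    case False
    then obtain i where i: "s = ?e i" "i < m" using s
      by (metis Suc_leI add_Suc_right add_less_cancel_left
        less_iff_Suc_add mult_2 not_le_imp_less Suc_eq_plus1 Suc_less_eq)
    then show ?thesis
      using permutes_lt[OF \<sigma> i(2)] by (simp add: app) (simp add: slots_def nth_append)
  qed
  let ?M = "match_mat (slots m j k f g id) w :: 'r mat"
  have M: "?M \<in> carrier_mat ?N ?N" by (simp add: match_mat_def len)
  have "match_mat (slots m j k f (\<lambda>i. g (\<sigma> i)) \<sigma>) w = mat ?N ?N (\<lambda>(r, c). ?M $$ (\<rho> r, c))"
    using permutes_lt[OF \<rho>] by (intro eq_matI) (auto simp: match_mat_def len slot)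
  then show ?thesis using det_permute_rows[OF M \<rho>] by (simp add: sgn)
qed

text \<open>
  Some term of the Leibniz formula must survive, and it is a rearrangement of \<open>w\<close> to \<open>xs\<close>.
\<close>

lemma det_match_nonzero_imp_mset:
  assumes "length xs = length w" "det (match_mat xs w :: 'r::comm_ring_1 mat) \<noteq> 0"
  shows "mset xs = mset w"
proof -
  have "(\<Sum>p | p permutes {0..<length w}. signof p *
      (\<Prod>i = 0..<length w. match_mat xs w $$ (i, p i))) \<noteq> (0 :: 'r)"
    using assms(2) by (simp add: det_def'[OF match_mat_carrier])
  then obtain p where p: "p permutes {0..<length w}"
      "(\<Prod>i = 0..<length w. match_mat xs w $$ (i, p i)) \<noteq> (0 :: 'r)"
    by (metis (mono_tags, lifting) mem_Collect_eq mult_zero_right sum.not_neutral_contains_not_neutral)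
  have "xs ! i = w ! p i" if "i < length w" for i
  proof (rule ccontr)
    assume "xs ! i \<noteq> w ! p i"
    then have "match_mat xs w $$ (i, p i) = (0 :: 'r)"
      using that permutes_lt[OF p(1) that] by (simp add: match_mat_def)
    then have "(\<Prod>i = 0..<length w. match_mat xs w $$ (i, p i)) = (0 :: 'r)"
      using that by (intro prod_zero) auto
    with p(2) show False by simp
  qed
  then have "xs = permute_list p w"
    using assms(1) by (intro nth_equalityI) (auto simp: permute_list_def)
  then show ?thesis using p(1) by (simp add: lessThan_atLeast0)
qed

lemma mset_map_insert_index:
  "k < Suc m \<Longrightarrow> add_mset k (mset (map (insert_index k) [0..<m])) = mset [0..<Suc m]"
proof -
  assume k: "k < Suc m"
  have "mset (map (insert_index k) [0..<m]) = image_mset (insert_index k) (mset_set {0..<m})"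
    by (simp only: mset_map mset_upt)
  also have "\<dots> = mset_set ({0..<Suc m} - {k})"
    by (simp only: image_mset_mset_set[OF insert_index_inj_on] insert_index_image[OF k])
  finally have "add_mset k (mset (map (insert_index k) [0..<m])) = mset_set {0..<Suc m}"
    using k by (simp add: mset_set.remove[of _ k])
  then show ?thesis by (simp only: mset_upt)
qed

text \<open>
  If a placement contributes, then its pairs are those of \<open>w\<close> in some order. Comparing second
  components, and removing the column labels that occur among the right factors and the special
  factor, determines the multiset of the free indices \<open>f\<close>; similarly for \<open>g\<close>. So all contributing
  placements carry the same permanent.
\<close>

lemma slot_sum_eq:
  fixes B :: "'a::comm_ring_1 mat"
  assumes len: "length w = 2 * m + 1" and w: "\<forall>x\<in>set w. fst x < Suc m \<and> snd x < Suc m"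
    and m: "even m" and c: "c < 2 * Suc m"
    and ts: "mset (map snd w) = mset [0..<Suc m] + mset ts"
    and ss: "mset (map fst w) = mset [0..<Suc m] + mset ss"
  shows "slot_sum m B w = permanent {0..<m} (\<lambda>i j. B $$ (ts ! i, ss ! j)) *
    of_int (int (2 * m + 1) * ((- 1) ^ c * det (incidence_minor (Suc m) w c)))"
proof -
  let ?P = "permanent {0..<m} (\<lambda>i j. B $$ (ts ! i, ss ! j))"
  have perm_eq: "permanent {0..<m} (\<lambda>i i'. B $$ (f i, g i')) * det (match_mat (slots m j k f g id) w) =
      ?P * det (match_mat (slots m j k f g id) w)"
    if jk: "j < Suc m" "k < Suc m" for f g j k
  proof (cases "det (match_mat (slots m j k f g id) w) = (0 :: 'a)")
    case False
    then have eq: "mset (slots m j k f g id) = mset w"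
      using det_match_nonzero_imp_mset[of "slots m j k f g id" w, where ?'r = 'a] len by simp
    have "mset (map snd (slots m j k f g id)) = mset (map snd w)" using eq by (metis mset_map)
    then have "mset [0..<Suc m] + mset (map f [0..<m]) = mset [0..<Suc m] + mset ts"
      unfolding ts mset_map_insert_index[OF jk(2), symmetric]
      by (simp add: slots_def comp_def add.commute)
    then have 1: "mset (map f [0..<m]) = mset ts" by (rule add_left_imp_eq)
    have "mset (map fst (slots m j k f g id)) = mset (map fst w)" using eq by (metis mset_map)
    then have "mset [0..<Suc m] + mset (map g [0..<m]) = mset [0..<Suc m] + mset ss"
      unfolding ss mset_map_insert_index[OF jk(1), symmetric]
      by (simp add: slots_def comp_def add.commute)
    then have 2: "mset (map g [0..<m]) = mset ss" by (rule add_left_imp_eq)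
    have "permanent {0..<m} (\<lambda>i i'. B $$ (f i, g i')) =
        permanent {0..<m} (\<lambda>i i'. B $$ (map f [0..<m] ! i, map g [0..<m] ! i'))"
      unfolding permanent_def by (intro sum.cong prod.cong refl) (auto simp: permutes_lt)
    also have "\<dots> = ?P"
      by (rule permanent_mset_cong[OF 1 2, of m "\<lambda>i j. B $$ (i, j)"]) auto
    finally show ?thesis by simp
  qed simp
  have inner: "slot_cell m B j k w =
      ?P * det (slot_mat m w j k)" if jk: "j < Suc m" "k < Suc m" for j k
  proof -
    let ?d = "\<lambda>f g. det (match_mat (slots m j k f g id) w) :: 'a"
    have "slot_cell m B j k w =
        (\<Sum>\<sigma> | \<sigma> permutes {0..<m}. \<Sum>f\<in>rows_to m. \<Sum>g\<in>rows_to m.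
        (\<Prod>i = 0..<m. B $$ (f i, g (\<sigma> i))) * ?d f g)"
      unfolding slot_cell_def
    proof (intro sum.cong refl)
      fix \<sigma> assume "\<sigma> \<in> {\<sigma>. \<sigma> permutes {0..<m}}"
      then have \<sigma>: "\<sigma> permutes {0..<m}" by simp
      have sq: "signof \<sigma> * (y * (signof \<sigma> * x)) = y * x" for x y :: 'a
        by (cases \<sigma> rule: sign_cases) auto
      have "(\<Sum>g\<in>rows_to m. (\<Prod>i = 0..<m. B $$ (f i, g i)) * det (match_mat (slots m j k f g \<sigma>) w)) =
          (\<Sum>g\<in>rows_to m. (\<Prod>i = 0..<m. B $$ (f i, g (\<sigma> i))) * (signof \<sigma> * ?d f g))" for f
      proof (rule sum.reindex_bij_witness[of _ "\<lambda>g i. g (\<sigma> i)" "\<lambda>g i. g (Hilbert_Choice.inv \<sigma> i)"])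
        fix g assume g: "g \<in> rows_to m"
        show "(\<lambda>i. g (Hilbert_Choice.inv \<sigma> (\<sigma> i))) = g" "(\<lambda>i. g (\<sigma> (Hilbert_Choice.inv \<sigma> i))) = g"
          using permutes_inverses[OF \<sigma>] by simp_all
        show "(\<lambda>i. g (Hilbert_Choice.inv \<sigma> i)) \<in> rows_to m" "(\<lambda>i. g (\<sigma> i)) \<in> rows_to m"
          using g permutes_in_image[OF \<sigma>] permutes_in_image[OF permutes_inv[OF \<sigma>]]
          by (auto simp: PiE_iff extensional_def)
        show "(\<Prod>i = 0..<m. B $$ (f i, g (Hilbert_Choice.inv \<sigma> (\<sigma> i)))) * (signof \<sigma> * ?d f (\<lambda>i. g (Hilbert_Choice.inv \<sigma> i))) =
            (\<Prod>i = 0..<m. B $$ (f i, g i)) * det (match_mat (slots m j k f g \<sigma>) w)"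
          using det_match_slots_permute[OF len \<sigma>, of j k f "\<lambda>i. g (Hilbert_Choice.inv \<sigma> i)", where ?'r = 'a]
          by (simp add: permutes_inverses[OF \<sigma>])
      qed
      then show "signof \<sigma> * (\<Sum>f\<in>rows_to m. \<Sum>g\<in>rows_to m.
        (\<Prod>i = 0..<m. B $$ (f i, g i)) * det (match_mat (slots m j k f g \<sigma>) w)) =
        (\<Sum>f\<in>rows_to m. \<Sum>g\<in>rows_to m. (\<Prod>i = 0..<m. B $$ (f i, g (\<sigma> i))) * ?d f g)"
        by (simp only: sum_distrib_left sq)
    qed
    also have "\<dots> = (\<Sum>f\<in>rows_to m. \<Sum>g\<in>rows_to m. \<Sum>\<sigma> | \<sigma> permutes {0..<m}.
        (\<Prod>i = 0..<m. B $$ (f i, g (\<sigma> i))) * ?d f g)"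
      by (simp only: sum.swap[of _ _ "{\<sigma>. \<sigma> permutes {0..<m}}"])
    also have "\<dots> = (\<Sum>f\<in>rows_to m. \<Sum>g\<in>rows_to m. permanent {0..<m} (\<lambda>i i'. B $$ (f i, g i')) * ?d f g)"
      by (simp only: permanent_def sum_distrib_right)
    also have "\<dots> = ?P * (\<Sum>f\<in>rows_to m. \<Sum>g\<in>rows_to m. ?d f g)"
      by (simp only: perm_eq[OF jk] sum_distrib_left)
    finally show ?thesis unfolding sum_det_match_slots[OF len w] .
  qed
  have "slot_sum m B w = (\<Sum>k<Suc m. \<Sum>j<Suc m. (- 1) ^ (j + k) * (?P * det (slot_mat m w j k)))"
    unfolding slot_sum_def by (intro sum.cong refl) (simp add: inner)
  also have "\<dots> = ?P * of_int (\<Sum>k<Suc m. \<Sum>j<Suc m. (- 1) ^ (j + k) * det (slot_mat m w j k :: int mat))"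
    by (simp add: sum_distrib_left mult_ac slot_mat_hom del: sum.lessThan_Suc)
  finally show ?thesis unfolding sum_slot_mat[OF len w m c] .
qed

lemma permanent_reindex:
  assumes h: "bij_betw h E E'" and fin: "finite E"
  shows "permanent E (\<lambda>e f. M (h e) (h f)) = permanent E' M"
proof -
  have inj: "inj_on h E" and img: "h ` E = E'" using h by (auto simp: bij_betw_def)
  have "permanent E (\<lambda>e f. M (h e) (h f)) = (\<Sum>\<pi> | \<pi> permutes E. \<Prod>e\<in>E'. M e (map_permutation E h \<pi> e))"
    unfolding permanent_def
  proof (intro sum.cong refl)
    fix \<pi> assume "\<pi> \<in> {\<pi>. \<pi> permutes E}"
    have "(\<Prod>e\<in>E'. M e (map_permutation E h \<pi> e)) = (\<Prod>e\<in>E. M (h e) (map_permutation E h \<pi> (h e)))"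
      unfolding img[symmetric] using inj by (simp add: prod.reindex)
    then show "(\<Prod>e\<in>E. M (h e) (h (\<pi> e))) = (\<Prod>e\<in>E'. M e (map_permutation E h \<pi> e))"
      by (simp add: map_permutation_apply[OF inj])
  qed
  also have "\<dots> = permanent E' M"
    unfolding permanent_def
  proof (rule sum.reindex_bij_witness[of _ "map_permutation E' (inv_into E h)" "map_permutation E h"])
    have inv: "bij_betw (inv_into E h) E' E" using h by (rule bij_betw_inv_into)
    fix \<pi> assume "\<pi> \<in> {\<pi>. \<pi> permutes E}"
    then have \<pi>: "\<pi> permutes E" by simp
    show "map_permutation E h \<pi> \<in> {\<pi>. \<pi> permutes E'}"
      using map_permutation_permutes[OF h \<pi>] by simp
    show "map_permutation E' (inv_into E h) (map_permutation E h \<pi>) = \<pi>"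
      by (rule map_permutation_compose_inv[OF h \<pi>]) (simp add: inj)
  next
    have inv: "bij_betw (inv_into E h) E' E" using h by (rule bij_betw_inv_into)
    fix \<pi> assume "\<pi> \<in> {\<pi>. \<pi> permutes E'}"
    then have \<pi>: "\<pi> permutes E'" by simp
    show "map_permutation E' (inv_into E h) \<pi> \<in> {\<pi>. \<pi> permutes E}"
      using map_permutation_permutes[OF inv \<pi>] by simp
    show "map_permutation E h (map_permutation E' (inv_into E h) \<pi>) = \<pi>"
      by (rule map_permutation_compose_inv[OF inv \<pi>]) (simp add: img f_inv_into_f)
  qed simp
  finally show ?thesis .
qed

section \<open>Reversal of edges\<close>

text \<open>
  The set \<open>F\<close> consists of the edges that are traversed backwards. With \<open>S\<close> the antisymmetric matrix that
  has the variable \<open>\<theta>\<^sub>e\<close> at \<open>(s e, t e)\<close> and \<open>- \<theta>\<^sub>e\<close> at \<open>(t e, s e)\<close>, this is the coefficient of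
  \<open>\<Prod>e\<in>E. \<theta>\<^sub>e\<close> in \<open>1 / det (1 + S b)\<close> if \<open>b\<close> is symmetric and all \<open>\<theta>\<^sub>e\<close> have square zero.
\<close>

definition oriented_permanent ::
    "(nat \<Rightarrow> nat \<Rightarrow> 'r::comm_ring_1) \<Rightarrow> ('e \<Rightarrow> nat) \<Rightarrow> ('e \<Rightarrow> nat) \<Rightarrow> 'e set \<Rightarrow> 'r" where
  "oriented_permanent b s t E = (\<Sum>F\<in>Pow E. (- 1) ^ card F *
     permanent E (\<lambda>e f. b (if e \<in> F then s e else t e) (if f \<in> F then t f else s f)))"

lemma oriented_permanent_reindex:
  assumes h: "bij_betw h E E'" and fin: "finite E"
  shows "oriented_permanent b (\<lambda>e. s (h e)) (\<lambda>e. t (h e)) E = oriented_permanent b s t E'"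
  unfolding oriented_permanent_def
proof -
  have "(\<Sum>F\<in>Pow E. (- 1) ^ card F * permanent E
       (\<lambda>e f. b (if e \<in> F then s (h e) else t (h e)) (if f \<in> F then t (h f) else s (h f)))) =
    (\<Sum>F\<in>Pow E. (- 1) ^ card (h ` F) * permanent E'
       (\<lambda>e f. b (if e \<in> h ` F then s e else t e) (if f \<in> h ` F then t f else s f)))"
  proof (intro sum.cong refl)
    fix F assume F: "F \<in> Pow E"
    have inj: "inj_on h E" using h by (simp add: bij_betw_def)
    then have "card (h ` F) = card F" using F by (meson PowD card_image inj_on_subset)
    moreover have mem: "h e \<in> h ` F \<longleftrightarrow> e \<in> F" if "e \<in> E" for e
      using F inj that by (auto simp: inj_on_def)
    have "permanent E (\<lambda>e f. b (if e \<in> F then s (h e) else t (h e)) (if f \<in> F then t (h f) else s (h f))) =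
        permanent E (\<lambda>e f. b (if h e \<in> h ` F then s (h e) else t (h e)) (if h f \<in> h ` F then t (h f) else s (h f)))"
      unfolding permanent_def
      by (intro sum.cong prod.cong refl) (auto simp: mem permutes_in_image)
    ultimately show "(- 1) ^ card F * permanent E
       (\<lambda>e f. b (if e \<in> F then s (h e) else t (h e)) (if f \<in> F then t (h f) else s (h f))) =
      (- 1) ^ card (h ` F) * permanent E'
       (\<lambda>e f. b (if e \<in> h ` F then s e else t e) (if f \<in> h ` F then t f else s f))"
      using permanent_reindex[OF h fin, of "\<lambda>e f. b (if e \<in> h ` F then s e else t e) (if f \<in> h ` F then t f else s f)"]
      by simp
  qed
  also have "\<dots> = (\<Sum>F\<in>Pow E'. (- 1) ^ card F * permanent E'
       (\<lambda>e f. b (if e \<in> F then s e else t e) (if f \<in> F then t f else s f)))"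
    by (rule sum.reindex_bij_betw[OF bij_betw_Pow[OF h]])
  finally show "(\<Sum>F\<in>Pow E. (- 1) ^ card F * permanent E
       (\<lambda>e f. b (if e \<in> F then s (h e) else t (h e)) (if f \<in> F then t (h f) else s (h f)))) = \<dots>" .
qed

text \<open>
  Adding the two determinants adds the two rows at \<open>l\<close>, and the sum of these rows is a sum of other rows
  of the same matrix.
\<close>

lemma det_row_sum_of_others:
  assumes A: "A \<in> carrier_mat N N" and A': "A' \<in> carrier_mat N N"
    and l: "l < N" and pq: "p < N" "q < N" "p \<noteq> l" "q \<noteq> l"
    and other: "\<And>r c. r < N \<Longrightarrow> c < N \<Longrightarrow> r \<noteq> l \<Longrightarrow> A' $$ (r, c) = A $$ (r, c)"
    and row: "\<And>c. c < N \<Longrightarrow> A $$ (l, c) + A' $$ (l, c) = A $$ (p, c) + A $$ (q, c)"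
  shows "det A' = - det (A :: 'r::comm_ring_1 mat)"
proof -
  have cof: "cofactor A' l c = cofactor A l c" if "c < N" for c
  proof -
    have "mat_delete A' l c = mat_delete A l c"
      using A A' that l by (intro eq_matI) (auto simp: mat_delete_def intro!: other)
    then show ?thesis by (simp add: cofactor_def)
  qed
  \<comment> \<open>An expansion with alien cofactors is the determinant of a matrix with two equal rows.\<close>
  have alien: "(\<Sum>c<N. A $$ (p, c) * cofactor A l c) = 0" if p: "p < N" "p \<noteq> l" for p
  proof -
    define R where "R = mat N N (\<lambda>(r, c). if r = l then A $$ (p, c) else A $$ (r, c))"
    have R: "R \<in> carrier_mat N N" by (simp add: R_def)
    have "cofactor R l c = cofactor A l c" if "c < N" for c
    proof -
      have "mat_delete R l c = mat_delete A l c"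
        using A that l by (intro eq_matI) (auto simp: mat_delete_def R_def)
      then show ?thesis by (simp add: cofactor_def)
    qed
    then have "det R = (\<Sum>c<N. A $$ (p, c) * cofactor A l c)"
      using l by (subst laplace_expansion_row[OF R l]) (auto simp: R_def)
    moreover have "det R = 0"
      by (rule det_identical_rows[OF R p(2) p(1) l])
        (use p l A in \<open>auto simp: R_def intro!: eq_vecI\<close>)
    ultimately show ?thesis by simp
  qed
  have "det A + det A' = (\<Sum>c<N. (A $$ (l, c) + A' $$ (l, c)) * cofactor A l c)"
    by (simp add: laplace_expansion_row[OF A l] laplace_expansion_row[OF A' l] cof
        sum.distrib algebra_simps)
  also have "\<dots> = (\<Sum>c<N. A $$ (p, c) * cofactor A l c) + (\<Sum>c<N. A $$ (q, c) * cofactor A l c)"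
    by (simp add: row sum.distrib algebra_simps)
  also have "\<dots> = 0" using alien pq by simp
  finally show ?thesis by (simp add: add_eq_0_iff)
qed

text \<open>
  The incidence rows of \<open>(s, t)\<close> and \<open>(t, s)\<close> add up to those of the loops \<open>(s, s)\<close> and \<open>(t, t)\<close>, which
  are present. So each reversal changes the sign.
\<close>

lemma det_incidence_minor_flip:
  assumes len: "length v = 2 * n - 1" and v: "\<forall>x\<in>set v. fst x < n \<and> snd x < n"
    and diag: "diag_pairs n \<subseteq> set v" and k: "k < 2 * n" and F: "F \<subseteq> off_positions v"
  shows "det (incidence_minor n (flip_at F v) k) = (- 1) ^ card F * det (incidence_minor n v k)"
proof -
  let ?N = "2 * n - 1"
  have ins: "insert_index k c < 2 * n" if "c < ?N" for c
    using that k by (auto simp: insert_index_def)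
  have "finite F" using F by (rule finite_subset) simp
  then show ?thesis using F
  proof (induction F)
    case empty
    have "flip_at {} v = v" by (simp add: flip_at_def map_nth)
    then show ?case by simp
  next
    case (insert l F)
    define w w' where "w = flip_at F v" and "w' = flip_at (insert l F) v"
    have l: "l < ?N" "fst (v ! l) \<noteq> snd (v ! l)" using insert.prems
      by (auto simp: off_positions_def len)
    have F: "r < ?N" "fst (v ! r) \<noteq> snd (v ! r)" if "r \<in> F" for r
      using insert.prems that by (auto simp: off_positions_def len)
    obtain s t where st: "w ! l = (s, t)" by (cases "w ! l")
    then have st': "w' ! l = (t, s)" using l insert.hyps by (simp add: w_def w'_def len)
    have "v ! l \<in> set v" using l len by simp
    from bspec[OF v this] have lt: "s < n" "t < n" using st l insert.hyps by (auto simp: w_def len)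
    have loop: "\<exists>p<?N. p \<noteq> l \<and> w ! p = (x, x)" if "x < n" for x
    proof -
      have "(x, x) \<in> set v" using diag that by (auto simp: diag_pairs_def)
      then obtain p where p: "p < ?N" "v ! p = (x, x)" by (auto simp: in_set_conv_nth len)
      then have "p \<notin> F" "p \<noteq> l" using F l by fastforce+
      then show ?thesis using p by (auto simp: w_def len)
    qed
    \<comment> \<open>The loops at both ends of the reversed edge; loops are never reversed.\<close>
    obtain p q where p: "p < ?N" "p \<noteq> l" "w ! p = (s, s)" and q: "q < ?N" "q \<noteq> l" "w ! q = (t, t)"
      using loop lt by metis
    have M: "incidence_minor n u k \<in> carrier_mat ?N ?N" if "length u = ?N" for u
      using that by (simp add: incidence_minor_def)
    have "det (incidence_minor n w' k) = - det (incidence_minor n w k)"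
    proof (rule det_row_sum_of_others[where l = l and p = p and q = q])
      show "incidence_minor n w k \<in> carrier_mat ?N ?N" "incidence_minor n w' k \<in> carrier_mat ?N ?N"
        by (rule M; simp add: w_def w'_def len)+
      show "incidence_minor n w' k $$ (r, c) = incidence_minor n w k $$ (r, c)"
        if "r < ?N" "c < ?N" "r \<noteq> l" for r c
        using that ins[of c] len by (simp add: incidence_minor_def incidence_mat_def w_def w'_def)
      show "incidence_minor n w k $$ (l, c) + incidence_minor n w' k $$ (l, c) =
          incidence_minor n w k $$ (p, c) + incidence_minor n w k $$ (q, c)" if "c < ?N" for c
        using that ins[of c] l p q st st' lt len
        by (simp add: incidence_minor_def incidence_mat_def) (auto simp: w_def w'_def)
    qed (use l p q in auto)
    then show ?case
      using insert by (simp add: w_def w'_def)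
  qed
qed

section \<open>The coefficients of highest diagonal degree\<close>

lemma card_diag_pairs [simp]: "card (diag_pairs n) = n" and finite_diag_pairs [simp]: "finite (diag_pairs n)"
proof -
  have "diag_pairs n = (\<lambda>i. (i, i)) ` {..<n}" by (auto simp: diag_pairs_def)
  then show "card (diag_pairs n) = n" "finite (diag_pairs n)"
    by (simp_all add: card_image inj_on_def)
qed

lemma finite_upper_pairs [simp]: "finite (upper_pairs n)"
  by (rule finite_subset[of _ "{..<n} \<times> {..<n}"]) (auto simp: upper_pairs_def)

lemma diag_upper_disjoint: "E \<subseteq> upper_pairs n \<Longrightarrow> diag_pairs n \<inter> E = {}"
  by (auto simp: diag_pairs_def upper_pairs_def)

text \<open>
  The diagonal positions of \<open>v\<close> contribute each vertex once.
\<close>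

lemma mset_split_positions:
  assumes v: "distinct v" "set v = diag_pairs n \<union> E" "E \<subseteq> upper_pairs n"
    and p: "\<And>l. l < length v \<Longrightarrow> l \<notin> off_positions v \<Longrightarrow> g l = fst (v ! l)"
  shows "mset (map g [0..<length v]) =
    mset [0..<n] + mset (map g (sorted_list_of_set (off_positions v)))"
proof -
  let ?O = "off_positions v" and ?D = "{0..<length v} - off_positions v"
  have O: "?O \<subseteq> {0..<length v}" by (auto simp: off_positions_def)
  have D: "v ! l = (fst (v ! l), fst (v ! l))" "fst (v ! l) < n" if "l \<in> ?D" for l
  proof -
    have "v ! l \<in> set v" using that by simp
    then show "v ! l = (fst (v ! l), fst (v ! l))" "fst (v ! l) < n"
      using that v(2,3) by (auto simp: off_positions_def diag_pairs_def upper_pairs_def prod_eq_iff)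
  qed
  have inj: "inj_on (\<lambda>l. fst (v ! l)) ?D"
  proof (rule inj_onI)
    fix k l assume "k \<in> ?D" "l \<in> ?D" "fst (v ! k) = fst (v ! l)"
    then have "v ! k = v ! l" using D by metis
    then show "k = l" using \<open>k \<in> ?D\<close> \<open>l \<in> ?D\<close> v(1) by (simp add: nth_eq_iff_index_eq)
  qed
  have img: "(\<lambda>l. fst (v ! l)) ` ?D = {0..<n}"
  proof
    show "(\<lambda>l. fst (v ! l)) ` ?D \<subseteq> {0..<n}" using D(2) by auto
    show "{0..<n} \<subseteq> (\<lambda>l. fst (v ! l)) ` ?D"
    proof
      fix i assume "i \<in> {0..<n}"
      then have "(i, i) \<in> set v" using v(2) by (auto simp: diag_pairs_def)
      then obtain l where "l < length v" "v ! l = (i, i)" by (auto simp: in_set_conv_nth)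
      then show "i \<in> (\<lambda>l. fst (v ! l)) ` ?D"
        by (intro image_eqI[of _ _ l]) (auto simp: off_positions_def)
    qed
  qed
  have "mset (map g [0..<length v]) = image_mset g (mset_set (?D \<union> ?O))"
    using O by (simp add: Un_absorb2)
  also have "mset_set (?D \<union> ?O) = mset_set ?D + mset_set ?O"
    by (rule mset_set_Union) auto
  also have "image_mset g (mset_set ?D + mset_set ?O) =
      image_mset (\<lambda>l. fst (v ! l)) (mset_set ?D) + image_mset g (mset_set ?O)"
    using p by (auto intro!: arg_cong2[where f = "(+)"] image_mset_cong)
  also have "image_mset (\<lambda>l. fst (v ! l)) (mset_set ?D) = mset_set {0..<n}"
    by (simp only: image_mset_mset_set[OF inj] img)
  also have "image_mset g (mset_set ?O) = mset (map g (sorted_list_of_set ?O))"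
    by (metis finite_off_positions mset_map mset_sorted_list_of_multiset sorted_list_of_mset_set)
  finally show ?thesis by simp
qed

lemma form_coeff_omega_seq:
  assumes "k < 2 * n"
  shows "form_coeff (omega_seq n v k) S =
    of_int ((- 1) ^ ((n choose 2) + k) * det (incidence_minor n v k)) * form_coeff (da_prod v) S"
  unfolding omega_seq_def submatrix_incidence[OF assms] of_int_form[where ?'a = 'a] form_coeff_scalar_times
  by (simp add: da_prod_def)

text \<open>
  The permanent and the incidence determinant from \<open>slot_sum_eq\<close> are summed over all orientations of the
  edges. The determinant changes by \<open>(- 1) ^ card F\<close> and therefore leaves the signed sum of
  permanents \<open>oriented_permanent\<close>.
\<close>

lemma adj_trace_top_coeff:
  fixes B :: "'a::comm_ring_1 mat"
  assumes v: "distinct v" "set v = diag_pairs (Suc m) \<union> E" "E \<subseteq> upper_pairs (Suc m)"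
    and E: "card E = m" and m: "even m" and k: "k < 2 * Suc m"
    and L: "distinct L" "set L = E"
  shows "form_coeff (\<Sum>k<Suc m. \<Sum>j<Suc m.
      form_of_even (adj_mat (quad_mat (Suc m) B) $$ (k, j)) * da j k) (set v) =
    of_nat (2 * m + 1) *
      oriented_permanent (\<lambda>i j. B $$ (i, j)) (\<lambda>i. fst (L ! i)) (\<lambda>i. snd (L ! i)) {..<m} *
      form_coeff (omega_seq (Suc m) v k) (set v)"
proof -
  let ?n = "Suc m" and ?O = "off_positions v" and ?b = "\<lambda>i j. B $$ (i, j)"
  have "card (set v) = ?n + m"
    unfolding v(2) using diag_upper_disjoint[OF v(3)] E v(3)
    by (subst card_Un_disjoint) (auto intro: finite_subset)
  then have len: "length v = 2 * m + 1" using distinct_card[OF v(1)] by simp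
  have le: "\<forall>x\<in>set v. fst x \<le> snd x"
    unfolding v(2) using v(3) by (auto simp: diag_pairs_def upper_pairs_def)
  have bound: "\<forall>x\<in>set v. fst x < ?n \<and> snd x < ?n"
    unfolding v(2) using v(3) by (auto simp: diag_pairs_def upper_pairs_def)
  have Ov: "(!) v ` ?O = E"
  proof
    show "(!) v ` ?O \<subseteq> E"
    proof
      fix x assume "x \<in> (!) v ` ?O"
      then have "x \<in> set v" "fst x \<noteq> snd x" by (auto simp: off_positions_def)
      then show "x \<in> E" using v(2) by (auto simp: diag_pairs_def)
    qed
    show "E \<subseteq> (!) v ` ?O"
    proof
      fix x assume x: "x \<in> E"
      then have "x \<in> set v" using v(2) by simp
      then obtain l where l: "l < length v" "v ! l = x" by (auto simp: in_set_conv_nth)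
      have "fst x \<noteq> snd x" using x v(3) by (auto simp: upper_pairs_def)
      then show "x \<in> (!) v ` ?O" using l
        by (intro image_eqI[of _ _ l]) (auto simp: off_positions_def)
    qed
  qed
  have injv: "inj_on ((!) v) ?O"
    using v(1) by (auto simp: inj_on_def off_positions_def nth_eq_iff_index_eq)
  have cardO: "card ?O = m" using card_image[OF injv] Ov E by simp
  let ?o = "sorted_list_of_set ?O"
  have ol: "length ?o = m" "set ?o = ?O" "distinct ?o" using cardO by auto
  have bij: "bij_betw ((!) ?o) {0..<m} ?O"
    using bij_betw_nth[OF ol(3), of "{0..<m}" ?O] ol by (simp add: lessThan_atLeast0)
  define s t where "s l = fst (v ! l)" and "t l = snd (v ! l)" for l
  define \<mu> where "\<mu> = (- 1) ^ k * det (incidence_minor ?n v k)"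
  have slot: "slot_sum m B (flip_at F v) = (- 1) ^ card F *
      permanent ?O (\<lambda>e f. ?b (if e \<in> F then s e else t e) (if f \<in> F then t f else s f)) *
      of_int (int (2 * m + 1) * \<mu>)" if F: "F \<in> Pow ?O" for F
  proof -
    let ?w = "flip_at F v"
    let ?t = "\<lambda>e. if e \<in> F then s e else t e" and ?s = "\<lambda>e. if e \<in> F then t e else s e"
    let ?ts = "map ?t ?o" and ?ss = "map ?s ?o"
    have same: "s l = t l" "l \<notin> F" if "l < length v" "l \<notin> ?O" for l
      using that F by (auto simp: off_positions_def s_def t_def)
    have snd: "map snd ?w = map ?t [0..<length v]" and fst: "map fst ?w = map ?s [0..<length v]"
      by (auto simp: flip_at_def s_def t_def)
    have w: "\<forall>x\<in>set ?w. fst x < ?n \<and> snd x < ?n"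
      using bound by (auto simp: flip_at_def)
    have "slot_sum m B ?w = permanent {0..<m} (\<lambda>i j. ?b (?ts ! i) (?ss ! j)) *
        of_int (int (2 * m + 1) * ((- 1) ^ k * det (incidence_minor ?n ?w k)))"
    proof (rule slot_sum_eq[OF _ w m k])
      show "length ?w = 2 * m + 1" by (simp add: len)
      show "mset (map snd ?w) = mset [0..<?n] + mset ?ts"
        unfolding snd by (rule mset_split_positions[OF v]) (use same in \<open>auto simp: s_def\<close>)
      show "mset (map fst ?w) = mset [0..<?n] + mset ?ss"
        unfolding fst by (rule mset_split_positions[OF v]) (use same in \<open>auto simp: s_def\<close>)
    qed
    also have "permanent {0..<m} (\<lambda>i j. ?b (?ts ! i) (?ss ! j)) =
        permanent {0..<m} (\<lambda>i j. ?b (?t (?o ! i)) (?s (?o ! j)))"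
      unfolding permanent_def using ol(1)
        by (intro sum.cong prod.cong refl) (auto simp: permutes_lt)
    also have "\<dots> = permanent ?O (\<lambda>e f. ?b (?t e) (?s f))"
      using permanent_reindex[OF bij, of "\<lambda>e f. ?b (?t e) (?s f)"] by simp
    also have "det (incidence_minor ?n ?w k) = (- 1) ^ card F * det (incidence_minor ?n v k)"
      using F k len bound v(2) by (intro det_incidence_minor_flip) auto
    finally show ?thesis by (simp add: \<mu>_def mult_ac)
  qed
  have "(\<Sum>F\<in>Pow ?O. slot_sum m B (flip_at F v)) =
      oriented_permanent ?b s t ?O * of_int (int (2 * m + 1) * \<mu>)"
    unfolding oriented_permanent_def sum_distrib_right by (intro sum.cong refl) (rule slot)
  also have "oriented_permanent ?b s t ?O =
      oriented_permanent ?b (\<lambda>i. fst (L ! i)) (\<lambda>i. snd (L ! i)) {..<m}"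
  proof -
    let ?h = "\<lambda>i. inv_into ?O ((!) v) (L ! i)"
    have lenL: "length L = m" using distinct_card[OF L(1)] L(2) E by simp
    have "bij_betw ((!) L) {..<m} E" using bij_betw_nth[OF L(1)] L(2) lenL by simp
    moreover have "bij_betw (inv_into ?O ((!) v)) E ?O"
      using injv Ov by (intro bij_betw_inv_into) (simp add: bij_betw_def)
    ultimately have h: "bij_betw ?h {..<m} ?O"
      using bij_betw_trans[of "(!) L" "{..<m}" E "inv_into ?O ((!) v)" ?O] by (simp add: comp_def)
    have vh: "v ! ?h i = L ! i" if "i < m" for i
    proof -
      have "L ! i \<in> (!) v ` ?O" using that L lenL Ov by auto
      then show ?thesis by (rule f_inv_into_f)
    qed
    have "oriented_permanent ?b s t ?O = oriented_permanent ?b (\<lambda>i. s (?h i)) (\<lambda>i. t (?h i)) {..<m}"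
      by (rule oriented_permanent_reindex[OF h, symmetric]) simp
    also have "\<dots> = oriented_permanent ?b (\<lambda>i. fst (L ! i)) (\<lambda>i. snd (L ! i)) {..<m}"
    proof -
      have "s (?h i) = fst (L ! i)" "t (?h i) = snd (L ! i)" if "i < m" for i
        using vh[OF that] by (simp_all add: s_def t_def)
      then show ?thesis
        unfolding oriented_permanent_def permanent_def
        by (intro sum.cong prod.cong arg_cong2[where f = "(*)"] refl)
          (auto simp: permutes_lt[unfolded lessThan_atLeast0[symmetric]])
    qed
    finally show ?thesis .
  qed
  finally have sum: "(\<Sum>F\<in>Pow ?O. slot_sum m B (flip_at F v)) =
      oriented_permanent ?b (\<lambda>i. fst (L ! i)) (\<lambda>i. snd (L ! i)) {..<m} * of_int (int (2 * m + 1) * \<mu>)" .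
  have sgn: "(- 1) ^ (m choose 2) = ((- 1) ^ (?n choose 2) :: 'a)"
    using m by (simp add: numeral_2_eq_2 power_add)
  have om: "form_coeff (omega_seq ?n v k) (set v) =
      (- 1) ^ (?n choose 2) * of_int \<mu> * form_coeff (da_prod v) (set v)"
    unfolding form_coeff_omega_seq[OF k] \<mu>_def by (simp add: power_add)
  show ?thesis
    unfolding adj_trace_coeff[OF v(1) le len] sum sgn om by (simp add: mult_ac)
qed

section \<open>The convolution identity\<close>

text \<open>
  Expansion along the row \<open>e0\<close>. If \<open>e0\<close> is sent to \<open>f\<close>, removing \<open>e0\<close> from its cycle leaves a permutation
  of \<open>E\<close> in which the column \<open>e0\<close> takes the place of the column \<open>f\<close>.
\<close>

lemma permanent_insert:
  assumes fin: "finite E" and e0: "e0 \<notin> E"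
  shows "permanent (insert e0 E) M = M e0 e0 * permanent E M +
    (\<Sum>f\<in>E. M e0 f * permanent E (\<lambda>e x. M e (if x = f then e0 else x)))"
proof -
  have "permanent (insert e0 E) M = (\<Sum>f\<in>insert e0 E. M e0 f *
      (\<Sum>q | q permutes E. \<Prod>e\<in>E. M e (transpose e0 f (q e))))"
    unfolding permanent_def sum_over_permutations_insert[OF fin e0] sum_distrib_left
  proof (intro sum.cong refl)
    fix f q assume "q \<in> {q. q permutes E}"
    then have "q e0 = e0" using e0 permutes_not_in by fastforce
    then show "(\<Prod>e\<in>insert e0 E. M e ((transpose e0 f \<circ> q) e)) =
        M e0 f * (\<Prod>e\<in>E. M e (transpose e0 f (q e)))"
      using fin e0 by simp
  qed
  also have "\<dots> = M e0 e0 * permanent E M +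
      (\<Sum>f\<in>E. M e0 f * (\<Sum>q | q permutes E. \<Prod>e\<in>E. M e (transpose e0 f (q e))))"
    using fin e0 by (simp add: permanent_def)
  also have "(\<Sum>f\<in>E. M e0 f * (\<Sum>q | q permutes E. \<Prod>e\<in>E. M e (transpose e0 f (q e)))) =
      (\<Sum>f\<in>E. M e0 f * permanent E (\<lambda>e x. M e (if x = f then e0 else x)))"
    unfolding permanent_def
  proof (intro sum.cong arg_cong2[where f = "(*)"] prod.cong refl)
    fix f q e assume "f \<in> E" "q \<in> {q. q permutes E}" "e \<in> E"
    then have "q e \<in> E" by (simp add: permutes_in_image)
    then show "M e (transpose e0 f (q e)) = M e (if q e = f then e0 else q e)"
      using e0 by (auto simp: transpose_def)
  qed
  finally show ?thesis .
qed

text \<open>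
  An edge \<open>e0\<close> with prescribed row label \<open>x\<close> and column label \<open>y\<close>. The labels are free so that the row
  expansion stays within this family.
\<close>

definition rooted_permanent ::
    "(nat \<Rightarrow> nat \<Rightarrow> 'r::comm_ring_1) \<Rightarrow> ('e \<Rightarrow> nat) \<Rightarrow> ('e \<Rightarrow> nat) \<Rightarrow> 'e \<Rightarrow> 'e set \<Rightarrow> nat \<Rightarrow> nat \<Rightarrow> 'r" where
  "rooted_permanent b s t e0 E x y = (\<Sum>F\<in>Pow E. (- 1) ^ card F *
     permanent (insert e0 E) (\<lambda>e f. b (if e = e0 then x else if e \<in> F then s e else t e)
       (if f = e0 then y else if f \<in> F then t f else s f)))"

lemma permanent_cong:
  assumes "\<And>e f. e \<in> E \<Longrightarrow> f \<in> E \<Longrightarrow> M e f = M' e f"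
  shows "permanent E M = permanent E M'"
  unfolding permanent_def using assms
    by (intro sum.cong prod.cong refl) (auto simp: permutes_in_image)

lemma sum_Pow_insert:
  assumes "finite E" "e0 \<notin> E"
  shows "(\<Sum>F\<in>Pow (insert e0 E). g F) = (\<Sum>F\<in>Pow E. g F) + (\<Sum>F\<in>Pow E. g (insert e0 F))"
proof -
  have "Pow E \<inter> insert e0 ` Pow E = {}" using assms by auto
  moreover have "inj_on (insert e0) (Pow E)" using assms by (auto simp: inj_on_def)
  ultimately show ?thesis
    unfolding Pow_insert using assms by (simp add: sum.union_disjoint sum.reindex)
qed

lemma card_insert_subset:
  assumes "finite E" "e0 \<notin> E" "F \<in> Pow E"
  shows "card (insert e0 F) = Suc (card F)"
  using assms by (metis PowD card_insert_disjoint finite_subset subsetD)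

lemma oriented_permanent_insert:
  assumes fin: "finite E" and e0: "e0 \<notin> E"
  shows "oriented_permanent b s t (insert e0 E) =
    rooted_permanent b s t e0 E (t e0) (s e0) - rooted_permanent b s t e0 E (s e0) (t e0)"
proof -
  have 1: "permanent (insert e0 E) (\<lambda>e f. b (if e \<in> F then s e else t e) (if f \<in> F then t f else s f)) =
      permanent (insert e0 E) (\<lambda>e f. b (if e = e0 then t e0 else if e \<in> F then s e else t e)
        (if f = e0 then s e0 else if f \<in> F then t f else s f))" if "F \<in> Pow E" for F
    by (rule permanent_cong) (use that e0 in auto)
  have 2: "permanent (insert e0 E) (\<lambda>e f. b (if e \<in> insert e0 F then s e else t e)
        (if f \<in> insert e0 F then t f else s f)) =
      permanent (insert e0 E) (\<lambda>e f. b (if e = e0 then s e0 else if e \<in> F then s e else t e)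
        (if f = e0 then t e0 else if f \<in> F then t f else s f))" for F
    by (rule permanent_cong) auto
  show ?thesis
    unfolding oriented_permanent_def rooted_permanent_def sum_Pow_insert[OF fin e0] 2
    using 1 by (simp add: card_insert_subset[OF fin e0] sum_negf)
qed

text \<open>
  If \<open>e0\<close> is followed by the edge \<open>f\<close>, the two edges merge to one with the row label of \<open>f\<close> and the
  column label of \<open>e0\<close>. The two orientations of \<open>f\<close> give the two terms.
\<close>

lemma rooted_permanent_expand:
  assumes fin: "finite E" and e0: "e0 \<notin> E"
  shows "rooted_permanent b s t e0 E x y = b x y * oriented_permanent b s t E +
    (\<Sum>f\<in>E. b x (s f) * rooted_permanent b s t e0 (E - {f}) (t f) y -
      b x (t f) * rooted_permanent b s t e0 (E - {f}) (s f) y)"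
proof -
  let ?t = "\<lambda>F e. if e \<in> F then s e else t e" and ?s = "\<lambda>F e. if e \<in> F then t e else s e"
  let ?M = "\<lambda>F e f. b (if e = e0 then x else ?t F e) (if f = e0 then y else ?s F f)"
  let ?p = "\<lambda>F f. permanent E (\<lambda>e z. b (?t F e) (if z = f then y else ?s F z))"
  have root: "permanent (insert e0 E) (?M F) =
      b x y * permanent E (\<lambda>e f. b (?t F e) (?s F f)) + (\<Sum>f\<in>E. b x (?s F f) * ?p F f)" for F
  proof -
    have "permanent E (?M F) = permanent E (\<lambda>e f. b (?t F e) (?s F f))"
      by (rule permanent_cong) (use e0 in auto)
    moreover have "(\<Sum>f\<in>E. ?M F e0 f * permanent E (\<lambda>e z. ?M F e (if z = f then e0 else z))) =
        (\<Sum>f\<in>E. b x (?s F f) * ?p F f)"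
    proof (intro sum.cong arg_cong2[where f = "(*)"] refl)
      show "?M F e0 f = b x (?s F f)" if "f \<in> E" for f using that e0 by auto
      show "permanent E (\<lambda>e z. ?M F e (if z = f then e0 else z)) = ?p F f" for f
        by (rule permanent_cong) (use e0 in auto)
    qed
    ultimately show ?thesis unfolding permanent_insert[OF fin e0, of "?M F"] by simp
  qed
  have merge: "(\<Sum>F\<in>Pow E. (- 1) ^ card F * (b x (?s F f) * ?p F f)) =
      b x (s f) * rooted_permanent b s t e0 (E - {f}) (t f) y -
      b x (t f) * rooted_permanent b s t e0 (E - {f}) (s f) y" if f: "f \<in> E" for f
  proof -
    let ?E = "E - {f}"
    \<comment> \<open>Renaming \<open>f\<close> to \<open>e0\<close> turns the merged edge into the new distinguished edge.\<close>
    let ?h = "\<lambda>e. if e = f then e0 else e"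
    have E: "insert f ?E = E" and fin': "finite ?E" and fE: "f \<notin> ?E" using f fin by auto
    have bij: "bij_betw ?h E (insert e0 ?E)"
      unfolding bij_betw_def using f e0 by (auto simp: inj_on_def)
    have p: "?p F f = permanent (insert e0 ?E)
        (\<lambda>e g. b (if e = e0 then r else ?t G e) (if g = e0 then y else ?s G g))"
      if "r = ?t F f" "G \<in> Pow ?E" "F = G \<or> F = insert f G" for F G r
    proof -
      have "permanent E (\<lambda>e z. b (if ?h e = e0 then r else ?t G (?h e)) (if ?h z = e0 then y else ?s G (?h z))) = ?p F f"
        by (rule permanent_cong) (use that e0 in auto)
      then show ?thesis
        using permanent_reindex[OF bij fin, of "\<lambda>e g. b (if e = e0 then r else ?t G e) (if g = e0 then y else ?s G g)"]
        by simp
    qed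
    have "(\<Sum>F\<in>Pow E. (- 1) ^ card F * (b x (?s F f) * ?p F f)) =
        (\<Sum>F\<in>Pow ?E. (- 1) ^ card F * (b x (?s F f) * ?p F f)) +
        (\<Sum>F\<in>Pow ?E. (- 1) ^ card (insert f F) * (b x (?s (insert f F) f) * ?p (insert f F) f))"
      using sum_Pow_insert[OF fin' fE, of "\<lambda>F. (- 1) ^ card F * (b x (?s F f) * ?p F f)"]
        unfolding E .
    also have "(\<Sum>F\<in>Pow ?E. (- 1) ^ card F * (b x (?s F f) * ?p F f)) =
        b x (s f) * rooted_permanent b s t e0 ?E (t f) y"
      unfolding rooted_permanent_def sum_distrib_left
    proof (intro sum.cong refl)
      fix F assume F: "F \<in> Pow ?E"
      then have "f \<notin> F" by auto
      then show "(- 1) ^ card F * (b x (?s F f) * ?p F f) = b x (s f) * ((- 1) ^ card F *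
          permanent (insert e0 ?E) (\<lambda>e g. b (if e = e0 then t f else ?t F e) (if g = e0 then y else ?s F g)))"
        using p[of "t f" F F] F by (simp add: mult_ac)
    qed
    also have "(\<Sum>F\<in>Pow ?E. (- 1) ^ card (insert f F) * (b x (?s (insert f F) f) * ?p (insert f F) f)) =
        - (b x (t f) * rooted_permanent b s t e0 ?E (s f) y)"
      unfolding rooted_permanent_def sum_distrib_left sum_negf[symmetric]
    proof (intro sum.cong refl)
      fix F assume F: "F \<in> Pow ?E"
      show "(- 1) ^ card (insert f F) * (b x (?s (insert f F) f) * ?p (insert f F) f) =
          - (b x (t f) * ((- 1) ^ card F *
          permanent (insert e0 ?E) (\<lambda>e g. b (if e = e0 then s f else ?t F e) (if g = e0 then y else ?s F g))))"
        unfolding card_insert_subset[OF fin' fE F]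
        using p[of "s f" "insert f F" F] F by (simp add: mult_ac)
    qed
    finally show ?thesis by simp
  qed
  have "rooted_permanent b s t e0 E x y =
      (\<Sum>F\<in>Pow E. (- 1) ^ card F * (b x y * permanent E (\<lambda>e f. b (?t F e) (?s F f)))) +
      (\<Sum>F\<in>Pow E. \<Sum>f\<in>E. (- 1) ^ card F * (b x (?s F f) * ?p F f))"
    unfolding rooted_permanent_def root by (simp add: distrib_left sum.distrib sum_distrib_left)
  also have "(\<Sum>F\<in>Pow E. (- 1) ^ card F * (b x y * permanent E (\<lambda>e f. b (?t F e) (?s F f)))) =
      b x y * oriented_permanent b s t E"
    unfolding oriented_permanent_def sum_distrib_left by (intro sum.cong refl) (simp add: mult_ac)
  also have "(\<Sum>F\<in>Pow E. \<Sum>f\<in>E. (- 1) ^ card F * (b x (?s F f) * ?p F f)) =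
      (\<Sum>f\<in>E. b x (s f) * rooted_permanent b s t e0 (E - {f}) (t f) y -
      b x (t f) * rooted_permanent b s t e0 (E - {f}) (s f) y)"
    by (subst sum.swap) (intro sum.cong refl merge)
  finally show ?thesis .
qed

lemma sum_Pow_member:
  assumes "finite E"
  shows "(\<Sum>I\<in>Pow E. \<Sum>f\<in>I. g I f) = (\<Sum>f\<in>E. \<Sum>J\<in>Pow (E - {f}). g (insert f J) f)"
proof -
  have fin: "finite I" if "I \<in> Pow E" for I using that assms finite_subset by auto
  have "(\<Sum>I\<in>Pow E. \<Sum>f\<in>I. g I f) = (\<Sum>(I, f)\<in>(SIGMA I:Pow E. I). g I f)"
    using assms fin by (intro sum.Sigma) auto
  also have "\<dots> = (\<Sum>(f, J)\<in>(SIGMA f:E. Pow (E - {f})). g (insert f J) f)"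
    by (rule sum.reindex_bij_witness[of _ "\<lambda>(f, J). (insert f J, f)" "\<lambda>(I, f). (f, I - {f})"])
      (auto simp: insert_absorb)
  also have "\<dots> = (\<Sum>f\<in>E. \<Sum>J\<in>Pow (E - {f}). g (insert f J) f)"
    using assms by (intro sum.Sigma[symmetric]) auto
  finally show ?thesis .
qed

lemma sum_Pow_nonmember:
  assumes "finite E"
  shows "(\<Sum>I\<in>Pow E. \<Sum>f\<in>E - I. g I f) = (\<Sum>f\<in>E. \<Sum>J\<in>Pow (E - {f}). g J f)"
proof -
  have "(\<Sum>I\<in>Pow E. \<Sum>f\<in>E - I. g I f) = (\<Sum>(I, f)\<in>(SIGMA I:Pow E. E - I). g I f)"
    using assms by (intro sum.Sigma) auto
  also have "\<dots> = (\<Sum>(f, J)\<in>(SIGMA f:E. Pow (E - {f})). g J f)"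
    by (rule sum.reindex_bij_witness[of _ "\<lambda>(f, J). (J, f)" "\<lambda>(I, f). (f, I)"]) auto
  also have "\<dots> = (\<Sum>f\<in>E. \<Sum>J\<in>Pow (E - {f}). g J f)"
    using assms by (intro sum.Sigma[symmetric]) auto
  finally show ?thesis .
qed

text \<open>
  The recursion that sums of minors share with \<open>rooted_permanent\<close>. The sign in \<open>Q_insert\<close> is opposite to
  that in \<open>oriented_permanent_insert\<close>, which makes the two families inverse to each other.
\<close>

locale minor_recursion =
  fixes b :: "nat \<Rightarrow> nat \<Rightarrow> 'r::comm_ring_1" and s t :: "'e \<Rightarrow> nat"
    and Q :: "'e set \<Rightarrow> 'r" and R :: "'e set \<Rightarrow> nat \<Rightarrow> nat \<Rightarrow> 'r"
  assumes Q_insert: "\<And>E e. finite E \<Longrightarrow> e \<notin> E \<Longrightarrow> Q (insert e E) = R E (s e) (t e) - R E (t e) (s e)"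
    and R_expand: "\<And>E x y. finite E \<Longrightarrow> R E x y = b x y * Q E +
      (\<Sum>f\<in>E. b x (s f) * R (E - {f}) (t f) y - b x (t f) * R (E - {f}) (s f) y)"
begin

abbreviation "P \<equiv> oriented_permanent b s t"

text \<open>
  Expanding both sides by one row, the terms without a further edge agree, and the terms for a fixed
  edge \<open>f\<close> are instances of the claim for \<open>E - {f}\<close>.
\<close>

lemma rooted_convolution:
  assumes "finite E" "e0 \<notin> E"
  shows "(\<Sum>I\<in>Pow E. R I x y * P (E - I)) = (\<Sum>I\<in>Pow E. Q I * rooted_permanent b s t e0 (E - I) x y)"
  using assms
proof (induction "card E" arbitrary: E x rule: less_induct)
  case less
  let ?T = "rooted_permanent b s t e0"
  have IH: "(\<Sum>I\<in>Pow (E - {f}). R I x' y * P (E - {f} - I)) =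
      (\<Sum>I\<in>Pow (E - {f}). Q I * ?T (E - {f} - I) x' y)" if "f \<in> E" for f x'
    by (rule less.hyps[OF card_Diff1_less[OF less.prems(1) that]]) (use less.prems in auto)
  have fin: "finite I" if "I \<in> Pow E" for I using that less.prems finite_subset by auto
  have diff_swap: "E - {f} - J = E - J - {f}" for f J by blast
  have "(\<Sum>I\<in>Pow E. R I x y * P (E - I)) = (\<Sum>I\<in>Pow E. b x y * (Q I * P (E - I))) +
      (\<Sum>I\<in>Pow E. \<Sum>f\<in>I. (b x (s f) * R (I - {f}) (t f) y - b x (t f) * R (I - {f}) (s f) y) * P (E - I))"
    unfolding sum.distrib[symmetric]
  proof (intro sum.cong refl)
    fix I assume I: "I \<in> Pow E"
    show "R I x y * P (E - I) = b x y * (Q I * P (E - I)) +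
        (\<Sum>f\<in>I. (b x (s f) * R (I - {f}) (t f) y - b x (t f) * R (I - {f}) (s f) y) * P (E - I))"
      unfolding sum_distrib_right[symmetric]
      by (subst R_expand[OF fin[OF I]]) (simp add: distrib_right mult.assoc)
  qed
  also have "(\<Sum>I\<in>Pow E. \<Sum>f\<in>I. (b x (s f) * R (I - {f}) (t f) y - b x (t f) * R (I - {f}) (s f) y) * P (E - I)) =
      (\<Sum>f\<in>E. \<Sum>J\<in>Pow (E - {f}). (b x (s f) * R J (t f) y - b x (t f) * R J (s f) y) * P (E - {f} - J))"
    unfolding sum_Pow_member[OF less.prems(1)]
  proof (intro sum.cong refl)
    fix f J assume "f \<in> E" "J \<in> Pow (E - {f})"
    then have "insert f J - {f} = J" "E - insert f J = E - {f} - J" by auto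
    then show "(b x (s f) * R (insert f J - {f}) (t f) y - b x (t f) * R (insert f J - {f}) (s f) y) * P (E - insert f J) =
      (b x (s f) * R J (t f) y - b x (t f) * R J (s f) y) * P (E - {f} - J)" by simp
  qed
  also have "\<dots> = (\<Sum>f\<in>E. b x (s f) * (\<Sum>J\<in>Pow (E - {f}). R J (t f) y * P (E - {f} - J)) -
      b x (t f) * (\<Sum>J\<in>Pow (E - {f}). R J (s f) y * P (E - {f} - J)))"
    by (simp add: left_diff_distrib sum_subtractf sum_distrib_left mult.assoc)
  also have "\<dots> = (\<Sum>f\<in>E. b x (s f) * (\<Sum>J\<in>Pow (E - {f}). Q J * ?T (E - {f} - J) (t f) y) -
      b x (t f) * (\<Sum>J\<in>Pow (E - {f}). Q J * ?T (E - {f} - J) (s f) y))"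
    by (intro sum.cong refl) (simp only: IH)
  also have "\<dots> = (\<Sum>f\<in>E. \<Sum>J\<in>Pow (E - {f}). Q J *
      (b x (s f) * ?T (E - {f} - J) (t f) y - b x (t f) * ?T (E - {f} - J) (s f) y))"
    by (simp add: right_diff_distrib sum_subtractf sum_distrib_left mult.left_commute)
  also have "\<dots> = (\<Sum>I\<in>Pow E. \<Sum>f\<in>E - I. Q I *
      (b x (s f) * ?T (E - I - {f}) (t f) y - b x (t f) * ?T (E - I - {f}) (s f) y))"
    unfolding sum_Pow_nonmember[OF less.prems(1)]
    by (intro sum.cong refl) (simp only: diff_swap)
  also have "(\<Sum>I\<in>Pow E. b x y * (Q I * P (E - I))) + \<dots> = (\<Sum>I\<in>Pow E. Q I * ?T (E - I) x y)"
    unfolding sum.distrib[symmetric]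
  proof (intro sum.cong refl)
    fix I assume "I \<in> Pow E"
    have "?T (E - I) x y = b x y * P (E - I) + (\<Sum>f\<in>E - I. b x (s f) * ?T (E - I - {f}) (t f) y -
        b x (t f) * ?T (E - I - {f}) (s f) y)"
      by (rule rooted_permanent_expand) (use less.prems in auto)
    then show "b x y * (Q I * P (E - I)) + (\<Sum>f\<in>E - I. Q I *
      (b x (s f) * ?T (E - I - {f}) (t f) y - b x (t f) * ?T (E - I - {f}) (s f) y)) = Q I * ?T (E - I) x y"
      by (simp add: distrib_left sum_distrib_left mult.left_commute)
  qed
  finally show ?case .
qed

text \<open>
  An edge \<open>e\<close> of \<open>E\<close> belongs to the first or to the second factor; by \<open>rooted_convolution\<close> the two cases
  cancel.
\<close>

lemma convolution_zero:
  assumes fin: "finite E" and ne: "E \<noteq> {}"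
  shows "(\<Sum>I\<in>Pow E. Q I * P (E - I)) = 0"
proof -
  obtain e where e: "e \<in> E" using ne by blast
  define E' where "E' = E - {e}"
  have E: "E = insert e E'" and E': "finite E'" "e \<notin> E'" using e fin by (auto simp: E'_def)
  have fin': "finite I" "e \<notin> I" if "I \<in> Pow E'" for I using that E' finite_subset by auto
  let ?T = "rooted_permanent b s t e"
  have "(\<Sum>I\<in>Pow E. Q I * P (E - I)) =
      (\<Sum>I\<in>Pow E'. Q I * P (insert e (E' - I))) + (\<Sum>I\<in>Pow E'. Q (insert e I) * P (E' - I))"
    unfolding E sum_Pow_insert[OF E']
    by (intro arg_cong2[where f = "(+)"] sum.cong refl) (use E' in \<open>auto intro!: arg_cong2[where f = "(*)"] arg_cong[where f = P]\<close>)
  also have "(\<Sum>I\<in>Pow E'. Q I * P (insert e (E' - I))) =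
      (\<Sum>I\<in>Pow E'. Q I * ?T (E' - I) (t e) (s e)) - (\<Sum>I\<in>Pow E'. Q I * ?T (E' - I) (s e) (t e))"
    using E' by (simp add: oriented_permanent_insert right_diff_distrib sum_subtractf)
  also have "(\<Sum>I\<in>Pow E'. Q (insert e I) * P (E' - I)) =
      (\<Sum>I\<in>Pow E'. R I (s e) (t e) * P (E' - I)) - (\<Sum>I\<in>Pow E'. R I (t e) (s e) * P (E' - I))"
    using fin' by (simp add: Q_insert left_diff_distrib sum_subtractf)
  finally show ?thesis unfolding rooted_convolution[OF E'] by simp
qed

end

lemma oriented_permanent_empty [simp]: "oriented_permanent b s t {} = 1"
  by (simp add: oriented_permanent_def permanent_def)

section \<open>Minors indexed by sets of edges\<close>

definition minor :: "(nat \<Rightarrow> nat \<Rightarrow> 'r::comm_ring_1) \<Rightarrow> nat list \<Rightarrow> nat list \<Rightarrow> 'r" where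
  "minor b K L = (if length K = length L
     then det (mat (length K) (length K) (\<lambda>(i, j). b (K ! i) (L ! j))) else 0)"

lemma minor_Nil [simp]: "minor b [] [] = 1"
  by (simp add: minor_def)

lemma minor_transpose:
  assumes "\<And>i j. b i j = b j i"
  shows "minor b K L = minor b L K"
proof (cases "length K = length L")
  case True
  let ?n = "length L"
  have "(mat ?n ?n (\<lambda>(i, j). b (K ! i) (L ! j)))\<^sup>T = mat ?n ?n (\<lambda>(i, j). b (L ! i) (K ! j))"
    using assms by (intro eq_matI) auto
  then show ?thesis
    using True det_transpose[of "mat ?n ?n (\<lambda>(i, j). b (K ! i) (L ! j))" ?n]
      by (simp add: minor_def)
qed (simp add: minor_def)

lemma minor_swap:
  "minor b K (pre @ x # y # post) = - minor b K (pre @ y # x # post)"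
proof (cases "length K = length pre + length post + 2")
  case True
  let ?n = "length K" and ?k = "length pre"
  let ?A = "mat ?n ?n (\<lambda>(i, j). b (K ! i) ((pre @ x # y # post) ! j))"
  have "mat ?n ?n (\<lambda>(i, j). b (K ! i) ((pre @ y # x # post) ! j)) = swapcols ?k (Suc ?k) ?A"
    using True by (intro eq_matI) (auto simp: nth_append nth_Cons' mat_swapcols_def)
  then show ?thesis
    using True det_swapcols[of ?k ?n "Suc ?k" ?A] by (simp add: minor_def)
qed (simp add: minor_def)

lemma minor_move:
  "minor b K (pre @ us @ x # post) = (- 1) ^ length us * minor b K (pre @ x # us @ post)"
proof (induction us arbitrary: post rule: rev_induct)
  case (snoc u us)
  have "minor b K (pre @ (us @ [u]) @ x # post) = - minor b K (pre @ us @ x # u # post)"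
    using minor_swap[of b K "pre @ us" u x post] by simp
  also have "\<dots> = - ((- 1) ^ length us * minor b K (pre @ x # us @ u # post))"
    using snoc[of "u # post"] by simp
  finally show ?case by simp
qed simp

text \<open>
  Laplace expansion along the row \<open>a\<close> over a suffix of the columns; the columns \<open>pre\<close> are already passed.
  This form allows induction on the list of columns.
\<close>

fun row_expansion :: "(nat \<Rightarrow> nat \<Rightarrow> 'r::comm_ring_1) \<Rightarrow> nat \<Rightarrow> nat list \<Rightarrow> nat list \<Rightarrow> nat list \<Rightarrow> 'r" where
  "row_expansion b a K pre [] = 0"
| "row_expansion b a K pre (x # L) =
    (- 1) ^ length pre * (b a x * minor b K (pre @ L)) + row_expansion b a K (pre @ [x]) L"

lemma row_expansion_sum:
  "row_expansion b a K pre L = (\<Sum>j<length L. (- 1) ^ (length pre + j) *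
     (b a (L ! j) * minor b K (pre @ take j L @ drop (Suc j) L)))"
proof (induction L arbitrary: pre)
  case (Cons x L)
  show ?case by (simp add: Cons.IH sum.lessThan_Suc_shift del: sum.lessThan_Suc)
qed simp

lemma minor_row_expansion: "minor b (a # K) L = row_expansion b a K [] L"
proof (cases "length L = Suc (length K)")
  case True
  let ?n = "length L"
  let ?A = "mat ?n ?n (\<lambda>(i, j). b ((a # K) ! i) (L ! j))"
  have A: "?A \<in> carrier_mat ?n ?n" by simp
  have "minor b (a # K) L = (\<Sum>j<?n. ?A $$ (0, j) * cofactor ?A 0 j)"
    using True laplace_expansion_row[OF A, of 0] by (simp add: minor_def)
  also have "\<dots> = row_expansion b a K [] L"
    unfolding row_expansion_sum
  proof (intro sum.cong refl)
    fix j assume j: "j \<in> {..<?n}"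
    let ?L = "take j L @ drop (Suc j) L"
    have len: "length ?L = length K" using j True by auto
    have "mat_delete ?A 0 j = mat (length K) (length K) (\<lambda>(i, j). b (K ! i) (?L ! j))"
      using True j by (intro eq_matI) (auto simp: mat_delete_def nth_append)
    then show "?A $$ (0, j) * cofactor ?A 0 j =
        (- 1) ^ (length [] + j) * (b a (L ! j) * minor b K ([] @ take j L @ drop (Suc j) L))"
      using j len True by (simp add: cofactor_def minor_def mult_ac)
  qed
  finally show ?thesis .
next
  case False
  then have "minor b K (take j L @ drop (Suc j) L) = 0" if "j < length L" for j
    using that by (auto simp: minor_def)
  then show ?thesis using False by (simp add: row_expansion_sum) (simp add: minor_def)
qed

context
  fixes b :: "nat \<Rightarrow> nat \<Rightarrow> 'r::comm_ring_1" and s t :: "nat \<Rightarrow> nat"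
begin

definition ends :: "nat list \<Rightarrow> nat list" where
  "ends xs = concat (map (\<lambda>e. [s e, t e]) xs)"

lemma ends_simps [simp]:
  "ends [] = []" "ends (e # xs) = s e # t e # ends xs" "ends (xs @ ys) = ends xs @ ends ys"
  by (simp_all add: ends_def)

lemma length_ends [simp]: "length (ends xs) = 2 * length xs"
  by (induction xs) auto

text \<open>
  The two ends of an edge form a block of even length, so moving blocks past each other costs no sign.
\<close>

lemma minor_ends_cong:
  "mset xs = mset ys \<Longrightarrow> minor b K (pre @ ends xs) = minor b K (pre @ ends ys)"
proof (induction xs arbitrary: pre ys)
  case (Cons e xs)
  then have "e \<in> set ys" by (metis list.set_intros(1) mset_eq_setD)
  then obtain us vs where ys: "ys = us @ e # vs" by (meson split_list)
  then have "mset xs = mset (us @ vs)" using Cons.prems by simp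
  from Cons.IH[OF this, of "pre @ [s e, t e]"]
  have "minor b K (pre @ ends (e # xs)) = minor b K (pre @ s e # t e # ends us @ ends vs)" by simp
  also have "\<dots> = minor b K ((pre @ [s e]) @ ends us @ t e # ends vs)"
    using minor_move[of b K "pre @ [s e]" "ends us" "t e" "ends vs"] by simp
  also have "\<dots> = minor b K (pre @ ends us @ s e # t e # ends vs)"
    using minor_move[of b K pre "ends us" "s e" "t e # ends vs"] by simp
  finally show ?case by (simp add: ys)
qed simp

text \<open>
  Removing one end of the edge \<open>f\<close> leaves the other end as a free column. Moved to the front it passes
  \<open>pre\<close> and whole blocks only, so the sign is the same for all edges.
\<close>

lemma row_expansion_ends:
  assumes "distinct (zs @ ys)"
  shows "row_expansion b a K (pre @ ends zs) (ends ys) =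
    (\<Sum>f\<in>set ys. b a (s f) * minor b K (t f # pre @ ends (remove1 f (zs @ ys))) -
      b a (t f) * minor b K (s f # pre @ ends (remove1 f (zs @ ys))))"
  using assms
proof (induction ys arbitrary: zs)
  case (Cons f ys)
  let ?p = "length pre"
  have sgn: "(- 1) ^ ?p * ((- 1) ^ ?p * y) = y" for y :: 'r
    by (cases "even ?p") simp_all
  have move: "minor b K (pre @ ends zs @ x # ends ys) = (- 1) ^ ?p * minor b K (x # pre @ ends zs @ ends ys)" for x
    using minor_move[of b K "[]" "pre @ ends zs" x "ends ys"] by (simp add: power_add)
  have "row_expansion b a K (pre @ ends zs) (ends (f # ys)) =
      (b a (s f) * minor b K (t f # pre @ ends zs @ ends ys) -
       b a (t f) * minor b K (s f # pre @ ends zs @ ends ys)) +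
      row_expansion b a K (pre @ ends (zs @ [f])) (ends ys)"
    using minor_move[of b K "[]" "pre @ ends zs @ [s f]" "x" "ends ys" for x]
    by (simp add: move sgn power_add mult.left_commute[of "b a _"])
  also have "row_expansion b a K (pre @ ends (zs @ [f])) (ends ys) =
      (\<Sum>g\<in>set ys. b a (s g) * minor b K (t g # pre @ ends (remove1 g ((zs @ [f]) @ ys))) -
      b a (t g) * minor b K (s g # pre @ ends (remove1 g ((zs @ [f]) @ ys))))"
    using Cons.prems by (intro Cons.IH) auto
  finally show ?case using Cons.prems by (simp add: remove1_append)
qed simp

lemma minor_expand_ends:
  assumes "distinct ys"
  shows "minor b (a # K) (ends ys) =
    (\<Sum>f\<in>set ys. b a (s f) * minor b K (t f # ends (remove1 f ys)) -
      b a (t f) * minor b K (s f # ends (remove1 f ys)))"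
    "minor b (a # K) (y # ends ys) = b a y * minor b K (ends ys) +
    (\<Sum>f\<in>set ys. b a (s f) * minor b K (t f # y # ends (remove1 f ys)) -
      b a (t f) * minor b K (s f # y # ends (remove1 f ys)))"
  using row_expansion_ends[of "[]" ys a K "[]"] row_expansion_ends[of "[]" ys a K "[y]"] assms
  by (simp_all add: minor_row_expansion)

abbreviation ends_of :: "nat set \<Rightarrow> nat list" where
  "ends_of I \<equiv> ends (sorted_list_of_set I)"

lemma minor_expand_ends_of:
  assumes "finite J"
  shows "minor b (a # K) (ends_of J) =
    (\<Sum>f\<in>J. b a (s f) * minor b K (t f # ends_of (J - {f})) - b a (t f) * minor b K (s f # ends_of (J - {f})))"
    "minor b (a # K) (y # ends_of J) = b a y * minor b K (ends_of J) +
    (\<Sum>f\<in>J. b a (s f) * minor b K (t f # y # ends_of (J - {f})) -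
      b a (t f) * minor b K (s f # y # ends_of (J - {f})))"
  using minor_expand_ends[of "sorted_list_of_set J"] assms
  by (simp_all add: sorted_list_of_set_remove)

lemma minor_ends_insert:
  assumes "finite I" "e \<notin> I"
  shows "minor b K (ends_of (insert e I)) = minor b K (s e # t e # ends_of I)"
proof -
  have "mset (sorted_list_of_set (insert e I)) = mset (e # sorted_list_of_set I)"
    using assms by simp
  from minor_ends_cong[OF this, of K "[]"] show ?thesis by simp
qed

text \<open>
  In the notation of \<open>oriented_permanent\<close> and for symmetric \<open>b\<close>, this is the coefficient of
  \<open>\<Prod>e\<in>E. \<theta>\<^sub>e\<close> in \<open>det (1 + S b)\<close>.
\<close>

definition split_minors :: "nat set \<Rightarrow> 'r" where
  "split_minors E = (\<Sum>I\<in>Pow E. minor b (ends_of I) (ends_of (E - I)))"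

text \<open>
  Row expansion of the first kind of minors produces the second kind and conversely. The lengths of the
  lists show that the first kind contributes for \<open>card E\<close> even and the second for \<open>card E\<close> odd only.
\<close>

definition rooted_minors :: "nat set \<Rightarrow> nat \<Rightarrow> nat \<Rightarrow> 'r" where
  "rooted_minors E x y = (\<Sum>I\<in>Pow E. minor b (x # ends_of I) (y # ends_of (E - I)) +
     minor b (x # y # ends_of I) (ends_of (E - I)))"

lemma sum_Pow_complement: "(\<Sum>I\<in>Pow E. g I (E - I)) = (\<Sum>I\<in>Pow E. g (E - I) I)"
  by (rule sum.reindex_bij_witness[of _ "\<lambda>I. E - I" "\<lambda>I. E - I"]) (auto simp: double_diff)

context
  assumes sym: "\<And>i j. b i j = b j i"
begin

lemma minor_commute: "minor b K L = minor b L K"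
  by (rule minor_transpose[OF sym])

text \<open>
  The new edge lies on the row side or, equivalently by symmetry, on the column side. The minors with
  \<open>x\<close> and \<open>y\<close> on different sides are symmetric in \<open>x\<close> and \<open>y\<close> and drop out of the difference; those with
  \<open>x\<close> and \<open>y\<close> on the same side are antisymmetric and are doubled.
\<close>

lemma split_minors_insert:
  assumes fin: "finite E" and e: "e \<notin> E"
  shows "split_minors (insert e E) = rooted_minors E (s e) (t e) - rooted_minors E (t e) (s e)"
proof -
  have fin': "finite I" "e \<notin> I" if "I \<in> Pow E" for I using that e fin finite_subset by auto
  let ?D = "\<Sum>I\<in>Pow E. minor b (s e # t e # ends_of I) (ends_of (E - I))"
  have "split_minors (insert e E) = (\<Sum>I\<in>Pow E. minor b (ends_of I) (ends_of (insert e (E - I)))) +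
      (\<Sum>I\<in>Pow E. minor b (ends_of (insert e I)) (ends_of (E - I)))"
    unfolding split_minors_def sum_Pow_insert[OF fin e]
  proof (intro arg_cong2[where f = "(+)"] sum.cong refl)
    fix I assume I: "I \<in> Pow E"
    then show "minor b (ends_of I) (ends_of (insert e E - I)) = minor b (ends_of I) (ends_of (insert e (E - I)))"
      using e by (simp add: insert_Diff_if fin')
    have "insert e E - insert e I = E - I" using e I by auto
    then show "minor b (ends_of (insert e I)) (ends_of (insert e E - insert e I)) =
      minor b (ends_of (insert e I)) (ends_of (E - I))" by simp
  qed
  also have "(\<Sum>I\<in>Pow E. minor b (ends_of I) (ends_of (insert e (E - I)))) =
      (\<Sum>I\<in>Pow E. minor b (ends_of (E - I)) (ends_of (insert e I)))"
    by (subst sum_Pow_complement) (intro sum.cong refl, auto simp: double_diff)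
  also have "\<dots> = ?D"
  proof (intro sum.cong refl)
    fix I assume I: "I \<in> Pow E"
    show "minor b (ends_of (E - I)) (ends_of (insert e I)) = minor b (s e # t e # ends_of I) (ends_of (E - I))"
      unfolding minor_ends_insert[OF fin'[OF I]] by (rule minor_commute)
  qed
  also have "(\<Sum>I\<in>Pow E. minor b (ends_of (insert e I)) (ends_of (E - I))) = ?D"
  proof (intro sum.cong refl)
    fix I assume I: "I \<in> Pow E"
    show "minor b (ends_of (insert e I)) (ends_of (E - I)) = minor b (s e # t e # ends_of I) (ends_of (E - I))"
      unfolding minor_commute[of "ends_of (insert e I)"] minor_ends_insert[OF fin'[OF I]]
        by (rule minor_commute)
  qed
  finally have Q: "split_minors (insert e E) = ?D + ?D" .
  have swap: "minor b (y # x # K) L = - minor b (x # y # K) L" for x y K L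
    using minor_swap[of b L "[]" y x K] by (simp add: minor_commute[of _ L])
  have symm: "(\<Sum>I\<in>Pow E. minor b (x # ends_of I) (y # ends_of (E - I))) =
      (\<Sum>I\<in>Pow E. minor b (y # ends_of I) (x # ends_of (E - I)))" for x y
    by (subst sum_Pow_complement) (intro sum.cong refl minor_commute)
  show ?thesis
    unfolding Q rooted_minors_def sum.distrib symm[of "t e" "s e"] swap[of "t e" "s e"]
    by (simp add: sum_negf)
qed

lemma rooted_minors_expand:
  assumes fin: "finite E"
  shows "rooted_minors E x y = b x y * split_minors E +
    (\<Sum>f\<in>E. b x (s f) * rooted_minors (E - {f}) (t f) y - b x (t f) * rooted_minors (E - {f}) (s f) y)"
proof -
  let ?g = "\<lambda>z I J. minor b (z # ends_of J) (y # ends_of I) + minor b (z # y # ends_of J) (ends_of I)"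
  have "rooted_minors E x y = (\<Sum>I\<in>Pow E. b x y * minor b (ends_of I) (ends_of (E - I)) +
      (\<Sum>f\<in>E - I. b x (s f) * ?g (t f) I (E - I - {f}) - b x (t f) * ?g (s f) I (E - I - {f})))"
    unfolding rooted_minors_def
  proof (intro sum.cong refl)
    fix I assume "I \<in> Pow E"
    have fin': "finite (E - I)" using fin by simp
    show "minor b (x # ends_of I) (y # ends_of (E - I)) + minor b (x # y # ends_of I) (ends_of (E - I)) =
      b x y * minor b (ends_of I) (ends_of (E - I)) +
      (\<Sum>f\<in>E - I. b x (s f) * ?g (t f) I (E - I - {f}) - b x (t f) * ?g (s f) I (E - I - {f}))"
      unfolding minor_expand_ends_of(1)[OF fin', of x "y # ends_of I"] minor_expand_ends_of(2)[OF fin']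
      unfolding minor_commute[of "ends_of I" "_ # _"] minor_commute[of "y # ends_of I"]
      by (simp add: algebra_simps sum.distrib sum_subtractf)
  qed
  also have "\<dots> = b x y * split_minors E + (\<Sum>f\<in>E. \<Sum>I\<in>Pow (E - {f}).
      b x (s f) * ?g (t f) I (E - I - {f}) - b x (t f) * ?g (s f) I (E - I - {f}))"
    unfolding sum.distrib sum_Pow_nonmember[OF fin] split_minors_def sum_distrib_left ..
  also have "(\<Sum>f\<in>E. \<Sum>I\<in>Pow (E - {f}).
      b x (s f) * ?g (t f) I (E - I - {f}) - b x (t f) * ?g (s f) I (E - I - {f})) =
    (\<Sum>f\<in>E. b x (s f) * rooted_minors (E - {f}) (t f) y - b x (t f) * rooted_minors (E - {f}) (s f) y)"
  proof (intro sum.cong refl)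
    fix f assume "f \<in> E"
    have swap: "E - I - {f} = E - {f} - I" for I by blast
    have "rooted_minors (E - {f}) z y = (\<Sum>I\<in>Pow (E - {f}). ?g z I (E - {f} - I))" for z
      unfolding rooted_minors_def
      by (rule sum_Pow_complement[of "\<lambda>I J. minor b (z # ends_of I) (y # ends_of J) +
        minor b (z # y # ends_of I) (ends_of J)"])
    then show "(\<Sum>I\<in>Pow (E - {f}). b x (s f) * ?g (t f) I (E - I - {f}) - b x (t f) * ?g (s f) I (E - I - {f})) =
      b x (s f) * rooted_minors (E - {f}) (t f) y - b x (t f) * rooted_minors (E - {f}) (s f) y"
      unfolding swap by (simp add: sum_subtractf sum_distrib_left)
  qed
  finally show ?thesis .
qed

lemma split_minors_convolution:
  assumes "finite E" "E \<noteq> {}"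
  shows "(\<Sum>I\<in>Pow E. split_minors I * oriented_permanent b s t (E - I)) = 0"
proof -
  interpret minor_recursion b s t split_minors rooted_minors
    by unfold_locales (fact split_minors_insert, fact rooted_minors_expand)
  show ?thesis by (rule convolution_zero[OF assms])
qed

end

end

section \<open>Inversion of the convolution\<close>

text \<open>
  Removing a pair from a pairing leaves a pairing of the complement, which is no initial segment any
  more; hence the arbitrary ground set in place of \<open>{..<m}\<close>.
\<close>

definition pairings_of :: "nat set \<Rightarrow> nat \<Rightarrow> nat set set set set" where
  "pairings_of E k = {P. card P = k \<and> disjoint P \<and>
     (\<forall>p\<in>P. \<exists>I J. p = {I, J} \<and> I \<noteq> J \<and> card I = card J) \<and> partition_on E (\<Union>P)}"

lemma pairings_eq: "pairings m k = pairings_of {..<m} k"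
  by (simp add: pairings_def pairings_of_def)

lemma finite_member_pairings_of:
  assumes "finite E" "P \<in> pairings_of E k"
  shows "finite P" "P \<subseteq> Pow (Pow E)"
proof -
  have "\<Union>P \<subseteq> Pow E" using assms(2) by (auto simp: pairings_of_def partition_on_def)
  then show "P \<subseteq> Pow (Pow E)" by auto
  then show "finite P" using assms(1) by (meson finite_Pow_iff finite_subset)
qed

lemma finite_pairings_of:
  assumes "finite E"
  shows "finite (pairings_of E k)"
proof (rule finite_subset)
  show "pairings_of E k \<subseteq> Pow (Pow (Pow E))"
    by (rule subsetI, rule PowI, rule finite_member_pairings_of(2)[OF assms])
qed (simp add: assms)

lemma pairings_of_0:
  assumes "finite E"
  shows "pairings_of E 0 = (if E = {} then {{}} else {})"
proof -
  have "P = {}" if "P \<in> pairings_of E 0" for P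
    using finite_member_pairings_of(1)[OF assms that] that by (simp add: pairings_of_def)
  moreover have "{} \<in> pairings_of E 0 \<longleftrightarrow> E = {}"
    by (auto simp: pairings_of_def partition_on_def disjoint_def)
  ultimately show ?thesis by auto
qed

lemma pairings_of_member:
  assumes fin: "finite E" and P: "P \<in> pairings_of E (Suc k)" and p: "{I, J} \<in> P"
  shows "I \<noteq> J" "I \<inter> J = {}" "I \<noteq> {}" "I \<subseteq> E" "J \<subseteq> E" "card I = card J"
    "P - {{I, J}} \<in> pairings_of (E - (I \<union> J)) k"
proof -
  have "\<forall>p\<in>P. \<exists>I J. p = {I, J} \<and> I \<noteq> J \<and> card I = card J" using P by (simp add: pairings_of_def)
  from bspec[OF this p] obtain I' J' where IJ: "{I, J} = {I', J'}" "I' \<noteq> J'" "card I' = card J'"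
    by (elim exE conjE)
  then have "I = I' \<and> J = J' \<or> I = J' \<and> J = I'" by (simp add: doubleton_eq_iff)
  then show ne: "I \<noteq> J" and "card I = card J" using IJ(2,3) by (elim disjE conjE; simp)+
  have part: "\<Union>(\<Union>P) = E" "disjoint (\<Union>P)" "{} \<notin> \<Union>P" and dP: "disjoint P"
    using P by (auto simp: pairings_of_def partition_on_def)
  have mem: "I \<in> \<Union>P" "J \<in> \<Union>P" using p by auto
  show IJd: "I \<inter> J = {}" using part(2) mem ne by (auto dest: disjointD)
  show "I \<noteq> {}" using part(3) mem by auto
  show "I \<subseteq> E" "J \<subseteq> E" using part(1) mem by auto
  have U: "\<Union>(P - {{I, J}}) = \<Union>P - {I, J}"
  proof
    show "\<Union>(P - {{I, J}}) \<subseteq> \<Union>P - {I, J}"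
    proof
      fix L assume "L \<in> \<Union>(P - {{I, J}})"
      then obtain X where X: "X \<in> P" "X \<noteq> {I, J}" "L \<in> X" by blast
      then have "X \<inter> {I, J} = {}" using dP p by (intro disjointD)
      then show "L \<in> \<Union>P - {I, J}" using X by blast
    qed
  qed auto
  have "\<Union>(\<Union>P - {I, J}) = E - (I \<union> J)"
  proof
    show "\<Union>(\<Union>P - {I, J}) \<subseteq> E - (I \<union> J)"
    proof
      fix x assume "x \<in> \<Union>(\<Union>P - {I, J})"
      then obtain L where L: "L \<in> \<Union>P" "L \<noteq> I" "L \<noteq> J" "x \<in> L" by auto
      then have "L \<inter> I = {}" "L \<inter> J = {}" using part(2) mem by (metis disjointD)+
      then show "x \<in> E - (I \<union> J)" using L part(1) by blast
    qed
    show "E - (I \<union> J) \<subseteq> \<Union>(\<Union>P - {I, J})" unfolding part(1)[symmetric] by blast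
  qed
  moreover have "disjoint (\<Union>P - {I, J})" by (rule pairwise_subset[OF part(2)]) blast
  ultimately have "partition_on (E - (I \<union> J)) (\<Union>(P - {{I, J}}))"
    unfolding U partition_on_def using part(3) by auto
  moreover have "card (P - {{I, J}}) = k"
    using P p finite_member_pairings_of(1)[OF fin P] by (simp add: pairings_of_def)
  moreover have "disjoint (P - {{I, J}})" by (rule pairwise_subset[OF dP]) blast
  ultimately show "P - {{I, J}} \<in> pairings_of (E - (I \<union> J)) k"
    using P by (auto simp: pairings_of_def)
qed

lemma pairings_of_insert:
  assumes fin: "finite E" and IJ: "I \<inter> J = {}" "I \<noteq> {}" "I \<subseteq> E" "J \<subseteq> E" "card I = card J"
    and P: "P \<in> pairings_of (E - (I \<union> J)) k"
  shows "insert {I, J} P \<in> pairings_of E (Suc k)" "{I, J} \<notin> P"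
proof -
  have J: "J \<noteq> {}" using IJ fin by (metis card_eq_0_iff finite_subset)
  then have ne: "I \<noteq> J" using IJ by auto
  have part: "\<Union>(\<Union>P) = E - (I \<union> J)" "disjoint (\<Union>P)" "{} \<notin> \<Union>P" and dP: "disjoint P"
    using P by (auto simp: pairings_of_def partition_on_def)
  have sep: "L \<inter> I = {}" "L \<inter> J = {}" if "L \<in> \<Union>P" for L using part(1) that by blast+
  then have nI: "I \<notin> \<Union>P" and nJ: "J \<notin> \<Union>P" using IJ(2) J by auto
  then show new: "{I, J} \<notin> P" by auto
  have "\<Union>(\<Union>(insert {I, J} P)) = E"
  proof -
    have "\<Union>(\<Union>(insert {I, J} P)) = (I \<union> J) \<union> \<Union>(\<Union>P)" by auto
    then show ?thesis unfolding part(1) using IJ by auto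
  qed
  moreover have "disjoint (\<Union>(insert {I, J} P))"
  proof -
    have "\<Union>(insert {I, J} P) = insert I (insert J (\<Union>P))" by auto
    moreover have "disjoint (insert I (insert J (\<Union>P)))"
    proof (rule disjointI)
      fix A B assume "A \<in> insert I (insert J (\<Union>P))" "B \<in> insert I (insert J (\<Union>P))" "A \<noteq> B"
      then show "A \<inter> B = {}"
        using disjointD[OF part(2), of A B] sep[of A] sep[of B] IJ(1) by (metis Int_commute insertE)
    qed
    ultimately show ?thesis by simp
  qed
  moreover have "{} \<notin> \<Union>(insert {I, J} P)" using part(3) IJ(2) J by auto
  ultimately have "partition_on E (\<Union>(insert {I, J} P))" by (simp add: partition_on_def)
  moreover have "disjoint (insert {I, J} P)"
    using dP nI nJ by (auto simp: disjoint_def)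
  moreover have "card (insert {I, J} P) = Suc k"
    using finite_member_pairings_of(1)[OF _ P] fin new P by (simp add: pairings_of_def)
  ultimately show "insert {I, J} P \<in> pairings_of E (Suc k)"
    using P ne IJ(5) by (auto simp: pairings_of_def)
qed

locale symmetric_weight =
  fixes d :: "nat set \<Rightarrow> nat set \<Rightarrow> 'r::field_char_0" and w :: "nat set set \<Rightarrow> 'r"
  assumes weight: "\<And>I J. w {I, J} = d I J"
    and unequal: "\<And>I J. card I \<noteq> card J \<Longrightarrow> d I J = 0"
begin

definition pairing_sum :: "nat \<Rightarrow> nat set \<Rightarrow> 'r" where
  "pairing_sum k E = (\<Sum>P\<in>pairings_of E k. \<Prod>p\<in>P. w p)"

definition split_sum :: "nat set \<Rightarrow> 'r" where
  "split_sum E = (\<Sum>I\<in>Pow E. d I (E - I))"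

text \<open>
  Double counting: choose a pairing with \<open>k + 1\<close> pairs and one of its pairs with an order \<open>(I, J)\<close>, or
  choose the union \<open>K\<close> of \<open>I\<close> and \<open>J\<close>, the part \<open>I\<close> and a pairing of the rest.
\<close>

lemma pairing_sum_Suc:
  assumes fin: "finite E"
  shows "of_nat (2 * Suc k) * pairing_sum (Suc k) E =
    (\<Sum>K\<in>Pow E - {{}}. split_sum K * pairing_sum k (E - K))"
proof -
  let ?pairs = "\<lambda>P. {(I, J). {I, J} \<in> P}"
  let ?g = "\<lambda>P I J. d I J * (\<Prod>p\<in>P - {{I, J}}. w p)"
  have each: "(\<Sum>(I, J)\<in>?pairs P. ?g P I J) = of_nat (2 * Suc k) * (\<Prod>p\<in>P. w p)"
    and fin_pairs: "finite (?pairs P)" if P: "P \<in> pairings_of E (Suc k)" for P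
  proof -
    note finP = finite_member_pairings_of[OF fin P]
    have "?pairs P \<subseteq> Pow E \<times> Pow E" using finP(2) by blast
    then show fin_pairs: "finite (?pairs P)" using fin
      by (meson finite_Pow_iff finite_SigmaI finite_subset)
    have prod: "?g P I J = (\<Prod>p\<in>P. w p)" if "{I, J} \<in> P" for I J
      using prod.remove[OF finP(1) that, of w] by (simp add: weight)
    have "?pairs P = (\<Union>p\<in>P. {(I, J). {I, J} = p})" by auto
    moreover have "card (\<Union>p\<in>P. {(I, J). {I, J} = p}) = (\<Sum>p\<in>P. card {(I, J). {I, J} = p})"
    proof (rule card_UN_disjoint)
      show "\<forall>p\<in>P. finite {(I, J). {I, J} = p}"
        using fin_pairs by (auto intro: finite_subset[of _ "?pairs P"])
    qed (use finP in auto)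
    moreover have "card {(I, J). {I, J} = p} = 2" if p: "p \<in> P" for p
    proof -
      have "\<forall>p\<in>P. \<exists>I J. p = {I, J} \<and> I \<noteq> J \<and> card I = card J" using P by (simp add: pairings_of_def)
      from bspec[OF this p] obtain I J where IJ: "p = {I, J}" "I \<noteq> J" by (elim exE conjE)
      then have "{(I, J). {I, J} = p} = {(I, J), (J, I)}" by (auto simp: doubleton_eq_iff)
      then show ?thesis using IJ by simp
    qed
    ultimately have "card (?pairs P) = 2 * Suc k" using P by (simp add: pairings_of_def)
    moreover have "(\<Sum>(I, J)\<in>?pairs P. ?g P I J) = (\<Sum>x\<in>?pairs P. \<Prod>p\<in>P. w p)"
      by (intro sum.cong refl) (use prod in auto)
    ultimately show "(\<Sum>(I, J)\<in>?pairs P. ?g P I J) = of_nat (2 * Suc k) * (\<Prod>p\<in>P. w p)" by simp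
  qed
  have "of_nat (2 * Suc k) * pairing_sum (Suc k) E = (\<Sum>P\<in>pairings_of E (Suc k). \<Sum>(I, J)\<in>?pairs P. ?g P I J)"
    unfolding pairing_sum_def sum_distrib_left by (intro sum.cong refl) (simp only: each)
  also have "\<dots> = (\<Sum>(P, I, J)\<in>(SIGMA P:pairings_of E (Suc k). ?pairs P). ?g P I J)"
    using fin_pairs finite_pairings_of[OF fin] by (subst sum.Sigma) (auto simp: case_prod_unfold)
  also have "\<dots> = (\<Sum>(K, I, P)\<in>{(K, I, P). K \<in> Pow E - {{}} \<and> I \<in> Pow K \<and> card I = card (K - I) \<and>
      P \<in> pairings_of (E - K) k}. d I (K - I) * (\<Prod>p\<in>P. w p))"
  proof (rule sum.reindex_bij_witness[of _ "\<lambda>(K, I, P). (insert {I, K - I} P, I, K - I)"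
        "\<lambda>(P, I, J). (I \<union> J, I, P - {{I, J}})"])
    fix x assume "x \<in> (SIGMA P:pairings_of E (Suc k). ?pairs P)"
    then obtain P I J where x: "x = (P, I, J)" and P: "P \<in> pairings_of E (Suc k)" and IJ: "{I, J} \<in> P"
      by auto
    note m = pairings_of_member[OF fin P IJ]
    have J: "I \<union> J - I = J" using m(2) by auto
    show "(\<lambda>(K, I, P). (insert {I, K - I} P, I, K - I)) ((\<lambda>(P, I, J). (I \<union> J, I, P - {{I, J}})) x) = x"
      using IJ by (auto simp: x J)
    show "(\<lambda>(P, I, J). (I \<union> J, I, P - {{I, J}})) x \<in> {(K, I, P). K \<in> Pow E - {{}} \<and> I \<in> Pow K \<and>
        card I = card (K - I) \<and> P \<in> pairings_of (E - K) k}"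
      using m by (auto simp: x J)
    show "(case (\<lambda>(P, I, J). (I \<union> J, I, P - {{I, J}})) x of (K, I, P) \<Rightarrow> d I (K - I) * (\<Prod>p\<in>P. w p)) =
        (case x of (P, I, J) \<Rightarrow> ?g P I J)" by (simp add: x J)
  next
    fix y assume "y \<in> {(K, I, P). K \<in> Pow E - {{}} \<and> I \<in> Pow K \<and> card I = card (K - I) \<and>
      P \<in> pairings_of (E - K) k}"
    then obtain K I P where y: "y = (K, I, P)" and K: "K \<subseteq> E" "K \<noteq> {}" "I \<subseteq> K" "card I = card (K - I)"
      and P: "P \<in> pairings_of (E - K) k" by auto
    have un: "I \<union> (K - I) = K" using K by auto
    have "finite K" using K fin finite_subset by auto
    then have "I \<noteq> {}" using K by (metis Diff_empty card_0_eq card.empty)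
    note ins = pairings_of_insert[OF fin _ this _ _ K(4), of P k]
    have new: "insert {I, K - I} P \<in> pairings_of E (Suc k)" "{I, K - I} \<notin> P"
      using ins P K unfolding un by auto
    show "(\<lambda>(P, I, J). (I \<union> J, I, P - {{I, J}})) ((\<lambda>(K, I, P). (insert {I, K - I} P, I, K - I)) y) = y"
      using new K(3) by (simp add: y Un_absorb1)
    show "(\<lambda>(K, I, P). (insert {I, K - I} P, I, K - I)) y \<in> (SIGMA P:pairings_of E (Suc k). ?pairs P)"
      using new by (simp add: y)
  qed
  also have "\<dots> = (\<Sum>(K, I, P)\<in>(SIGMA K:Pow E - {{}}. SIGMA I:{I\<in>Pow K. card I = card (K - I)}.
      pairings_of (E - K) k). d I (K - I) * (\<Prod>p\<in>P. w p))"
    by (rule sum.cong) auto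
  also have "\<dots> = (\<Sum>K\<in>Pow E - {{}}. \<Sum>I\<in>{I\<in>Pow K. card I = card (K - I)}.
      \<Sum>P\<in>pairings_of (E - K) k. d I (K - I) * (\<Prod>p\<in>P. w p))"
  proof -
    have fK: "finite {I \<in> Pow K. card I = card (K - I)}" if "K \<in> Pow E - {{}}" for K
    proof (rule finite_subset[of _ "Pow K"])
      show "finite (Pow K)" using that fin finite_subset by auto
    qed blast
    have fP: "finite (pairings_of (E - K) k)" for K using finite_pairings_of fin by blast
    show ?thesis
      using fin fK fP by (simp add: sum.Sigma)
  qed
  also have "\<dots> = (\<Sum>K\<in>Pow E - {{}}. split_sum K * pairing_sum k (E - K))"
  proof (intro sum.cong refl)
    fix K assume "K \<in> Pow E - {{}}"
    then have "finite K" using fin finite_subset by auto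
    then have "split_sum K = (\<Sum>I\<in>{I\<in>Pow K. card I = card (K - I)}. d I (K - I))"
      unfolding split_sum_def by (intro sum.mono_neutral_right) (auto simp: unequal)
    then show "(\<Sum>I\<in>{I\<in>Pow K. card I = card (K - I)}. \<Sum>P\<in>pairings_of (E - K) k. d I (K - I) * (\<Prod>p\<in>P. w p)) =
        split_sum K * pairing_sum k (E - K)"
      by (simp add: pairing_sum_def sum_product)
  qed
  finally show ?thesis .
qed

lemma pairing_sum_0: "finite E \<Longrightarrow> pairing_sum 0 E = (if E = {} then 1 else 0)"
  by (simp add: pairing_sum_def pairings_of_0)

lemma split_sum_singleton_zero:
  assumes "card K = 1"
  shows "split_sum K = 0"
proof -
  obtain x where "K = {x}" using assms by (auto simp: card_1_singleton_iff)
  then show ?thesis by (simp add: split_sum_def Pow_insert unequal)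
qed

text \<open>
  By \<open>pairing_sum_Suc\<close> and induction: a split of \<open>K\<close> contributes only if \<open>K\<close> has at least two elements.
\<close>

lemma pairing_sum_large:
  assumes "finite E" "card E < 2 * k"
  shows "pairing_sum k E = 0"
  using assms
proof (induction k arbitrary: E)
  case (Suc k)
  have "of_nat (2 * Suc k) * pairing_sum (Suc k) E = 0"
    unfolding pairing_sum_Suc[OF Suc.prems(1)]
  proof (intro sum.neutral ballI)
    fix K assume K: "K \<in> Pow E - {{}}"
    then have fK: "finite K" "K \<subseteq> E" using Suc.prems(1) finite_subset by auto
    show "split_sum K * pairing_sum k (E - K) = 0"
    proof (cases "card K = 1")
      case False
      have "card K \<noteq> 0" using K fK by auto
      then have "2 \<le> card K" using False by linarith
      moreover have "card (E - K) = card E - card K" by (rule card_Diff_subset[OF fK])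
      moreover have "card K \<le> card E" using fK Suc.prems(1) by (simp add: card_mono)
      ultimately have "card (E - K) < 2 * k" using Suc.prems(2) by simp
      then show ?thesis using Suc.IH[of "E - K"] Suc.prems(1) by auto
    qed (simp add: split_sum_singleton_zero)
  qed
  then show ?case by (simp del: of_nat_Suc of_nat_mult)
qed simp

text \<open>
  The series \<open>1 / (1 + 2 F) = \<Sum> (- 2)\<^sup>k F\<^sup>k\<close> in the ring of set functions. By \<open>pairing_sum_Suc\<close> the sum on
  the right satisfies the recursion that the vanishing convolution gives for \<open>f\<close>.
\<close>

lemma convolution_inverse:
  assumes one: "f {} = 1"
    and conv: "\<And>E. finite E \<Longrightarrow> E \<noteq> {} \<Longrightarrow> (\<Sum>K\<in>Pow E. split_sum K * f (E - K)) = 0"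
    and empty: "d {} {} = 1"
    and fin: "finite E" "card E \<le> M"
  shows "f E = (\<Sum>k\<le>M. (- 2) ^ k * fact k * pairing_sum k E)"
  using fin
proof (induction M arbitrary: E)
  case 0
  then show ?case by (simp add: pairing_sum_0 one)
next
  case (Suc M)
  show ?case
  proof (cases "E = {}")
    case True
    have "(\<Sum>k\<le>Suc M. (- 2) ^ k * fact k * pairing_sum k E) = (\<Sum>k\<in>{0}. (- 2) ^ k * fact k * pairing_sum k E)"
      by (rule sum.mono_neutral_right) (auto simp: True pairing_sum_large)
    then show ?thesis by (simp add: True pairing_sum_0 one)
  next
    case False
    have IH: "f (E - K) = (\<Sum>k\<le>M. (- 2) ^ k * fact k * pairing_sum k (E - K))" if "K \<in> Pow E - {{}}" for K
    proof (rule Suc.IH)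
      show "finite (E - K)" using Suc.prems by simp
      have "card (E - K) < card E" using that Suc.prems by (intro psubset_card_mono) auto
      then show "card (E - K) \<le> M" using Suc.prems by linarith
    qed
    have "(\<Sum>K\<in>Pow E. split_sum K * f (E - K)) =
        split_sum {} * f (E - {}) + (\<Sum>K\<in>Pow E - {{}}. split_sum K * f (E - K))"
      using Suc.prems by (intro sum.remove) auto
    also have "split_sum {} = 1" by (simp add: split_sum_def empty)
    finally have "f E = - (\<Sum>K\<in>Pow E - {{}}. split_sum K * f (E - K))"
      using conv[OF Suc.prems(1) False] by (simp add: add_eq_0_iff2)
    also have "\<dots> = - (\<Sum>K\<in>Pow E - {{}}. \<Sum>k\<le>M. (- 2) ^ k * fact k * (split_sum K * pairing_sum k (E - K)))"
      by (intro arg_cong[where f = uminus] sum.cong refl) (simp add: IH sum_distrib_left mult_ac)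
    \<comment> \<open>The factor \<open>2 (k + 1)\<close> is what the next power of \<open>- 2\<close> and the next factorial absorb.\<close>
    also have "\<dots> = - (\<Sum>k\<le>M. (- 2) ^ k * fact k * (of_nat (2 * Suc k) * pairing_sum (Suc k) E))"
      by (subst sum.swap) (simp only: pairing_sum_Suc[OF Suc.prems(1)] sum_distrib_left)
    also have "\<dots> = (\<Sum>k\<le>M. (- 2) ^ Suc k * fact (Suc k) * pairing_sum (Suc k) E)"
      unfolding sum_negf[symmetric] by (intro sum.cong refl) (simp add: algebra_simps)
    also have "\<dots> = (\<Sum>k\<le>Suc M. (- 2) ^ k * fact k * pairing_sum k E)"
      using Suc.prems False
      by (simp add: sum.atMost_Suc_shift pairing_sum_0 del: sum.atMost_Suc power_Suc fact_Suc)
    finally show ?thesis .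
  qed
qed

end

section \<open>Complementary minors\<close>

lemma card_less_nth:
  assumes "sorted_wrt (<) c" "i < length (c :: nat list)"
  shows "card {a \<in> set c. a < c ! i} = i"
proof -
  have "{a \<in> set c. a < c ! i} = (!) c ` {..<i}"
  proof
    show "{a \<in> set c. a < c ! i} \<subseteq> (!) c ` {..<i}"
    proof
      fix a assume "a \<in> {a \<in> set c. a < c ! i}"
      then obtain j where j: "j < length c" "a = c ! j" "c ! j < c ! i"
        by (auto simp: in_set_conv_nth)
      have "j < i"
        using j assms by (metis linorder_neqE_nat not_less_iff_gr_or_eq sorted_wrt_nth_less)
      then show "a \<in> (!) c ` {..<i}" using j by auto
    qed
    show "(!) c ` {..<i} \<subseteq> {a \<in> set c. a < c ! i}"
      using assms by (auto simp: sorted_wrt_nth_less)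
  qed
  moreover have "inj_on ((!) c) {..<i}"
    using assms by (auto simp: inj_on_def nth_eq_iff_index_eq strict_sorted_iff)
  ultimately show ?thesis by (simp add: card_image)
qed

lemma pick_complement:
  assumes K: "set K \<subseteq> {0..<n}" and i: "i < card ({0..<n} - set K)"
  shows "pick (- set K) i = sorted_list_of_set ({0..<n} - set K) ! i"
proof -
  let ?c = "sorted_list_of_set ({0..<n} - set K)"
  have len: "i < length ?c" using i by simp
  have mem: "?c ! i \<in> {0..<n} - set K" using nth_mem[OF len] by simp
  have "{a \<in> - set K. a < ?c ! i} = {a \<in> set ?c. a < ?c ! i}" using mem by auto
  then have "card {a \<in> - set K. a < ?c ! i} = i"
    using card_less_nth[OF _ len] by (metis strict_sorted_list_of_set)
  then show ?thesis using pick_card_in_set[of "?c ! i" "- set K"] mem by auto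
qed

lemma delete_rows_cols_eq:
  assumes A: "A \<in> carrier_mat n n" and K: "set K \<subseteq> {0..<n}" and L: "set L \<subseteq> {0..<n}"
  shows "delete_rows_cols A K L = mat (card ({0..<n} - set K)) (card ({0..<n} - set L))
    (\<lambda>(i, j). A $$ (sorted_list_of_set ({0..<n} - set K) ! i, sorted_list_of_set ({0..<n} - set L) ! j))"
proof -
  have "{i. i < n \<and> i \<in> - set M} = {0..<n} - set M" for M by auto
  then show ?thesis
    using A K L unfolding delete_rows_cols_def submatrix_def
    by (intro eq_matI) (auto simp: pick_complement)
qed

text \<open>
  The sign of the permutation that sorts \<open>xs\<close>, if \<open>xs\<close> lists the elements of \<open>V\<close>.
\<close>

definition order_sign :: "nat list \<Rightarrow> nat set \<Rightarrow> int" where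
  "order_sign xs V = det (match_mat xs (sorted_list_of_set V))"

lemma order_sign_Cons:
  assumes V: "finite V" "a \<in> V" and len: "length xs = card (V - {a})"
  shows "order_sign (a # xs) V = (- 1) ^ card {x \<in> V. x < a} * order_sign xs (V - {a})"
proof -
  let ?v = "sorted_list_of_set V" and ?M = "match_mat (a # xs) (sorted_list_of_set V) :: int mat"
  obtain v1 v2 where v: "?v = v1 @ a # v2" using V by (metis set_sorted_list_of_set split_list)
  let ?k = "length v1" and ?N = "length ?v"
  have dist: "distinct ?v" by simp
  have k: "?k < ?N" "?v ! ?k = a" by (simp_all add: v)
  have rank: "card {x \<in> V. x < a} = ?k"
    using card_less_nth[OF strict_sorted_list_of_set, of ?k V] k V by simp
  have rem: "sorted_list_of_set (V - {a}) = v1 @ v2"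
    using V dist by (simp add: sorted_list_of_set_remove v remove1_append)
  have M: "?M \<in> carrier_mat ?N ?N" by (rule match_mat_carrier)
  have "det ?M = (\<Sum>c<?N. ?M $$ (0, c) * cofactor ?M 0 c)"
    using k by (intro laplace_expansion_row[OF M]) simp
  also have "\<dots> = (\<Sum>c\<in>{?k}. cofactor ?M 0 c)"
  proof (rule sum.mono_neutral_cong_right)
    show "\<forall>c\<in>{..<?N} - {?k}. ?M $$ (0, c) * cofactor ?M 0 c = 0"
    proof
      fix c assume c: "c \<in> {..<?N} - {?k}"
      then have "?v ! c \<noteq> a" using k nth_eq_iff_index_eq[OF dist, of c ?k] by auto
      then show "?M $$ (0, c) * cofactor ?M 0 c = 0" using c by (simp add: match_mat_def)
    qed
    show "?M $$ (0, c) * cofactor ?M 0 c = cofactor ?M 0 c" if "c \<in> {?k}" for c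
      using that k by (simp add: match_mat_def)
  qed (use k in auto)
  also have "\<dots> = (- 1) ^ ?k * det (mat_delete ?M 0 ?k)" by (simp add: cofactor_def)
  also have "mat_delete ?M 0 ?k = match_mat xs (sorted_list_of_set (V - {a}))"
  proof -
    have "length ?v = Suc (length (v1 @ v2))" by (simp add: v)
    then show ?thesis
      unfolding rem by (intro eq_matI) (auto simp: mat_delete_def match_mat_def v nth_append)
  qed
  finally show ?thesis by (simp add: order_sign_def rank)
qed

text \<open>
  The first entry \<open>a\<close> has to pass the smaller elements of \<open>V\<close> in the one list and the smaller elements of
  \<open>K\<close> in the other. Deleting \<open>a\<close> from \<open>V\<close> lowers the ranks of the larger elements of \<open>K\<close>. Every other
  entry of \<open>K\<close> is larger or smaller than \<open>a\<close>, which accounts for the binomial coefficient.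
\<close>

lemma order_sign_complement:
  assumes "finite V" "distinct K" "set K \<subseteq> V"
  shows "order_sign (K @ sorted_list_of_set (V - set K)) V * order_sign K (set K) =
    (- 1) ^ ((\<Sum>k\<leftarrow>K. card {x \<in> V. x < k}) + (length K choose 2))"
  using assms
proof (induction K arbitrary: V)
  case Nil
  have "match_mat (sorted_list_of_set V) (sorted_list_of_set V) = (1\<^sub>m (length (sorted_list_of_set V)) :: int mat)"
    using Nil by (intro eq_matI) (auto simp: match_mat_def nth_eq_iff_index_eq)
  moreover have "match_mat ([] :: nat list) [] = (1\<^sub>m 0 :: int mat)"
    by (intro eq_matI) (simp_all add: match_mat_def)
  ultimately show ?case by (simp add: order_sign_def binomial_eq_0)
next
  case (Cons a K)
  let ?W = "V - {a}"
  have VW: "V - set (a # K) = ?W - set K" by auto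
  have sub: "set K \<subseteq> ?W" "finite ?W" "distinct K" using Cons.prems by auto
  let ?r = "\<lambda>U k. card {x \<in> U. x < k}"
  have e1: "order_sign ((a # K) @ sorted_list_of_set (?W - set K)) V =
      (- 1) ^ ?r V a * order_sign (K @ sorted_list_of_set (?W - set K)) ?W"
    using Cons.prems sub card_mono[of ?W "set K"]
    by (simp only: append_Cons, intro order_sign_Cons)
      (auto simp: card_Diff_subset distinct_card)
  have e2: "order_sign (a # K) (set (a # K)) = (- 1) ^ ?r (set (a # K)) a * order_sign K (set K)"
    using Cons.prems order_sign_Cons[of "set (a # K)" a K] by (simp add: distinct_card)
  have "order_sign ((a # K) @ sorted_list_of_set (V - set (a # K))) V * order_sign (a # K) (set (a # K)) =
      (- 1) ^ (?r V a + ?r (set (a # K)) a) *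
      (order_sign (K @ sorted_list_of_set (?W - set K)) ?W * order_sign K (set K))"
    unfolding VW e1 e2 power_add by (simp only: mult_ac)
  also have "order_sign (K @ sorted_list_of_set (?W - set K)) ?W * order_sign K (set K) =
      (- 1) ^ ((\<Sum>k\<leftarrow>K. ?r ?W k) + (length K choose 2))"
    by (rule Cons.IH[OF sub(2,3,1)])
  also have "(- 1) ^ (?r V a + ?r (set (a # K)) a) * (- 1) ^ ((\<Sum>k\<leftarrow>K. ?r ?W k) + (length K choose 2)) =
      ((- 1) ^ (?r V a + ?r (set (a # K)) a + (\<Sum>k\<leftarrow>K. ?r ?W k) + (length K choose 2)) :: int)"
    by (simp only: power_add mult.assoc)
  also have "\<dots> = (- 1) ^ ((\<Sum>k\<leftarrow>a # K. ?r V k) + (length (a # K) choose 2))"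
  proof -
    \<comment> \<open>Deleting \<open>a\<close> lowers the rank of the larger elements by one.\<close>
    have step: "?r V k = ?r ?W k + (if a < k then 1 else 0)" for k
    proof (cases "a < k")
      case True
      then have "{x \<in> V. x < k} = insert a {x \<in> ?W. x < k}" using Cons.prems by auto
      then show ?thesis using True Cons.prems by simp
    next
      case False
      then have "{x \<in> V. x < k} = {x \<in> ?W. x < k}" by auto
      then show ?thesis using False by simp
    qed
    have sum: "(\<Sum>k\<leftarrow>K. ?r V k) = (\<Sum>k\<leftarrow>K. ?r ?W k) + (\<Sum>k\<leftarrow>K. if a < k then 1 else 0)"
      by (simp add: step[abs_def] sum_list_addf)
    have "(\<Sum>k\<leftarrow>K. if a < k then 1 else 0) = card {k \<in> set K. a < k}"
      using Cons.prems by (simp add: sum_list_distinct_conv_sum_set sum.If_cases Int_def)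
    moreover have "{x \<in> set (a # K). x < a} = {k \<in> set K. k < a}" by auto
    moreover have "card {k \<in> set K. a < k} + card {k \<in> set K. k < a} = length K"
    proof -
      have "a \<notin> set K" using Cons.prems by simp
      then have split: "{k \<in> set K. a < k} \<union> {k \<in> set K. k < a} = set K"
        by (auto simp: less_le intro: le_neq_trans)
      have "card ({k \<in> set K. a < k} \<union> {k \<in> set K. k < a}) =
          card {k \<in> set K. a < k} + card {k \<in> set K. k < a}"
        by (rule card_Un_disjoint) auto
      then show ?thesis unfolding split using Cons.prems by (simp add: distinct_card)
    qed
    ultimately have parity: "?r V a + ?r (set (a # K)) a + (\<Sum>k\<leftarrow>K. ?r ?W k) + (length K choose 2) + 2 * card {k \<in> set K. a < k} =
        (\<Sum>k\<leftarrow>a # K. ?r V k) + (length (a # K) choose 2)"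
      using sum by (simp add: numeral_2_eq_2)
    have "(- 1) ^ (e + 2 * f) = ((- 1) ^ e :: int)" for e f :: nat by (simp add: power_add)
    then show ?thesis unfolding parity[symmetric] by (rule sym)
  qed
  finally show ?case .
qed

lemma order_sign_sorting_perm:
  assumes "distinct K"
  shows "order_sign K (set K) = sign (sorting_perm K)"
proof -
  let ?n = "length K"
  have uniq: "permute_list \<pi> K = sort K" if "\<pi> permutes {..<?n}" "sorted (permute_list \<pi> K)" for \<pi>
    using that by (metis mset_permute_list properties_for_sort)
  obtain \<pi>0 where \<pi>0: "\<pi>0 permutes {..<?n}" "permute_list \<pi>0 K = sort K"
    using mset_eq_permutation[of "sort K" K] by auto
  have "\<exists>!\<pi>. \<pi> permutes {..<?n} \<and> sorted (permute_list \<pi> K)"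
  proof (rule ex1I[of _ \<pi>0])
    show "\<pi>0 permutes {..<?n} \<and> sorted (permute_list \<pi>0 K)" using \<pi>0 by simp
    fix \<pi> assume \<pi>: "\<pi> permutes {..<?n} \<and> sorted (permute_list \<pi> K)"
    show "\<pi> = \<pi>0"
    proof
      fix i
      show "\<pi> i = \<pi>0 i"
      proof (cases "i < ?n")
        case True
        have "permute_list \<pi> K = permute_list \<pi>0 K" unfolding \<pi>0(2) by (rule uniq) (use \<pi> in auto)
        then have "permute_list \<pi> K ! i = permute_list \<pi>0 K ! i" by simp
        then have "K ! \<pi> i = K ! \<pi>0 i" using True by (simp add: permute_list_def)
        moreover have "\<pi> i < ?n" "\<pi>0 i < ?n"
          using True \<pi> \<pi>0 permutes_in_image[of \<pi> "{..<?n}" i] permutes_in_image[of \<pi>0 "{..<?n}" i] by auto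
        ultimately show ?thesis using assms by (simp add: nth_eq_iff_index_eq)
      qed (use \<pi> \<pi>0 in \<open>auto simp: permutes_not_in\<close>)
    qed
  qed
  from theI'[OF this] have \<pi>: "sorting_perm K permutes {0..<?n}" "sorted (permute_list (sorting_perm K) K)"
    by (auto simp: sorting_perm_def lessThan_atLeast0)
  let ?\<pi> = "sorting_perm K" and ?M = "match_mat K (sorted_list_of_set (set K)) :: int mat"
  have srt: "sorted_list_of_set (set K) = permute_list ?\<pi> K"
    using uniq[of ?\<pi>] \<pi> assms by (simp add: lessThan_atLeast0 sorted_list_of_set_sort_remdups distinct_remdups_id)
  have M: "?M = mat ?n ?n (\<lambda>(i, j). if i = ?\<pi> j then 1 else 0)"
    using \<pi>(1) permutes_lt[OF \<pi>(1)] assms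
    by (intro eq_matI) (auto simp: match_mat_def srt permute_list_nth lessThan_atLeast0 nth_eq_iff_index_eq)
  have "det ?M = (\<Sum>p | p permutes {0..<?n}. sign p * (\<Prod>j<?n. if p j = ?\<pi> j then 1 else 0))"
    unfolding M by (subst det_col[of _ ?n]) (auto simp: permutes_lt intro!: sum.cong prod.cong)
  also have "\<dots> = (\<Sum>p\<in>{?\<pi>}. sign p)"
  proof (rule sum.mono_neutral_cong_right)
    show "\<forall>p\<in>{p. p permutes {0..<?n}} - {?\<pi>}. sign p * (\<Prod>j<?n. if p j = ?\<pi> j then 1 else 0) = 0"
    proof
      fix p assume p: "p \<in> {p. p permutes {0..<?n}} - {?\<pi>}"
      have "\<exists>j<?n. p j \<noteq> ?\<pi> j"
      proof (rule ccontr)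
        assume no: "\<not> (\<exists>j<?n. p j \<noteq> ?\<pi> j)"
        have "p = ?\<pi>"
        proof
          fix j show "p j = ?\<pi> j"
            using no p \<pi>(1) by (cases "j < ?n") (auto simp: permutes_not_in)
        qed
        then show False using p by simp
      qed
      then have "(\<Prod>j<?n. if p j = ?\<pi> j then 1 else 0 :: int) = 0" by (intro prod_zero) auto
      then show "sign p * (\<Prod>j<?n. if p j = ?\<pi> j then 1 else 0) = 0" by simp
    qed
  qed (use \<pi>(1) in \<open>auto simp: finite_permutations\<close>)
  finally show ?thesis by (simp add: order_sign_def)
qed

text \<open>
  For a list \<open>K\<close> the sign \<open>tuple_sign K\<close> and the sign of moving \<open>K\<close> in front of its complement differ by a
  factor that depends on the length only. So they agree in products of two lists of equal length.
\<close>

lemma tuple_sign_mult: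
  assumes K: "distinct K" "set K \<subseteq> {0..<n}" and L: "distinct L" "set L \<subseteq> {0..<n}" and len: "length K = length L"
  shows "tuple_sign K * tuple_sign L = order_sign (K @ sorted_list_of_set ({0..<n} - set K)) {0..<n} *
    order_sign (L @ sorted_list_of_set ({0..<n} - set L)) {0..<n}"
proof -
  have unit: "sign p * (sign p * x) = x" for p x by (cases p rule: sign_cases) auto
  have each: "order_sign (M @ sorted_list_of_set ({0..<n} - set M)) {0..<n} =
      tuple_sign M * (- 1) ^ (length M + (length M choose 2))" if M: "distinct M" "set M \<subseteq> {0..<n}" for M
  proof -
    have "(\<Sum>k\<leftarrow>M. card {x \<in> {0..<n}. x < k}) = sum_list M"
    proof (rule arg_cong[where f = sum_list], rule map_idI)
      fix k assume "k \<in> set M"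
      then have "{x \<in> {0..<n}. x < k} = {..<k}" using M by auto
      then show "card {x \<in> {0..<n}. x < k} = k" by simp
    qed
    then have "order_sign (M @ sorted_list_of_set ({0..<n} - set M)) {0..<n} * sign (sorting_perm M) =
        (- 1) ^ (sum_list M + (length M choose 2))"
      using order_sign_complement[of "{0..<n}" M] M by (simp add: order_sign_sorting_perm)
    then have "order_sign (M @ sorted_list_of_set ({0..<n} - set M)) {0..<n} =
        (- 1) ^ (sum_list M + (length M choose 2)) * sign (sorting_perm M)"
      using unit[of "sorting_perm M"] by (metis mult.commute)
    moreover have "sum_list (map Suc M) = sum_list M + length M" by (induction M) auto
    ultimately show ?thesis using M by (simp add: tuple_sign_def power_add mult_ac)
  qed
  show ?thesis unfolding each[OF K] each[OF L] len by (simp add: mult_ac)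
qed

text \<open>
  Jacobi's identity. Permute rows and columns so that \<open>K\<close> and \<open>L\<close> come first. Multiplying the permuted \<open>A\<close>
  by the first columns of its inverse, completed by unit vectors, gives a block triangular matrix
  whose determinant is the complementary minor.
\<close>

lemma complementary_minor_distinct:
  fixes A B :: "'a::field mat"
  assumes A: "A \<in> carrier_mat n n" and B: "B \<in> carrier_mat n n" and AB: "A * B = 1\<^sub>m n"
    and K: "distinct K" "set K \<subseteq> {0..<n}" and L: "distinct L" "set L \<subseteq> {0..<n}" and len: "length K = length L"
  shows "of_int (tuple_sign K * tuple_sign L) * det (delete_rows_cols A K L) =
    det A * minor (\<lambda>i j. B $$ (i, j)) L K"
proof -
  let ?p = "length K" and ?b = "\<lambda>i j. B $$ (i, j)"
  define cK cL where "cK = sorted_list_of_set ({0..<n} - set K)" and "cL = sorted_list_of_set ({0..<n} - set L)"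
  define \<kappa> \<mu> where "\<kappa> = K @ cK" and "\<mu> = L @ cL"
  have pn: "?p \<le> n" using K by (metis card_atLeastLessThan card_mono diff_zero distinct_card finite_atLeastLessThan)
  have lc: "length cK = n - ?p" "length cL = n - ?p"
    using K L len by (simp_all add: cK_def cL_def card_Diff_subset distinct_card)
  have perm: "length \<kappa> = n" "distinct \<kappa>" "set \<kappa> = {0..<n}" "length \<mu> = n" "distinct \<mu>" "set \<mu> = {0..<n}"
    using K L len pn lc by (auto simp: \<kappa>_def \<mu>_def) (auto simp: cK_def cL_def)
  have lt: "\<kappa> ! i < n" "\<mu> ! i < n" if "i < n" for i
    using nth_mem[of i \<kappa>] nth_mem[of i \<mu>] perm that by auto
  have slist: "sorted_list_of_set {0..<n} = [0..<n]" by simp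
  define A' where "A' = mat n n (\<lambda>(i, j). A $$ (\<kappa> ! i, \<mu> ! j))"
  have bij: "bij_betw ((!) \<mu>) {..<n} {..<n}"
    by (rule bij_betw_nth[OF perm(5)]) (simp_all add: perm(4,6) lessThan_atLeast0)
  have reindex: "(\<Sum>c<n. g (\<mu> ! c)) = (\<Sum>c<n. g c)" for g :: "nat \<Rightarrow> 'a"
    by (rule sum.reindex_bij_betw[OF bij])
  have detA': "det A' = of_int (tuple_sign K * tuple_sign L) * det A"
  proof -
    let ?PK = "match_mat \<kappa> [0..<n] :: 'a mat" and ?PL = "match_mat \<mu> [0..<n] :: 'a mat"
    have PK: "?PK \<in> carrier_mat n n" and PL: "?PL \<in> carrier_mat n n"
      by (simp_all add: match_mat_def)
    have "?PK * A * ?PL\<^sup>T = A'"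
    proof (rule eq_matI)
      fix i j assume "i < dim_row A'" "j < dim_col A'"
      then have ij: "i < n" "j < n" by (auto simp: A'_def)
      have MKA: "(?PK * A) $$ (i, c) = A $$ (\<kappa> ! i, c)" if "c < n" for c
      proof -
        have "(?PK * A) $$ (i, c) = (\<Sum>d<n. if d = \<kappa> ! i then A $$ (d, c) else 0)"
          unfolding mat_mult_entry[OF PK A ij(1) that]
          using ij by (intro sum.cong refl) (auto simp: match_mat_def)
        then show ?thesis using lt ij by (simp add: sum.delta)
      qed
      have "(?PK * A * ?PL\<^sup>T) $$ (i, j) = (\<Sum>c<n. if c = \<mu> ! j then A $$ (\<kappa> ! i, c) else 0)"
        unfolding mat_mult_entry[OF mult_carrier_mat[OF PK A] transpose_carrier_mat[THEN iffD2, OF PL] ij]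
        using ij PL by (intro sum.cong refl) (auto simp: MKA, auto simp: match_mat_def)
      then show "(?PK * A * ?PL\<^sup>T) $$ (i, j) = A' $$ (i, j)"
        using ij lt by (simp add: sum.delta A'_def)
    qed (use PK PL in \<open>auto simp: A'_def\<close>)
    then have "det A' = det ?PK * det A * det ?PL"
      using det_mult[OF mult_carrier_mat[OF PK A] transpose_carrier_mat[THEN iffD2, OF PL]]
      by (simp add: det_mult[OF PK A] det_transpose[OF PL])
    moreover have hom: "det (match_mat xs [0..<n] :: 'a mat) = of_int (order_sign xs {0..<n})" for xs
    proof -
      have "map_mat of_int (match_mat xs [0..<n] :: int mat) = (match_mat xs [0..<n] :: 'a mat)"
        by (intro eq_matI) (auto simp: match_mat_def)
      then show ?thesis unfolding order_sign_def slist by (metis of_int_hom.hom_det)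
    qed
    ultimately show ?thesis
      using tuple_sign_mult[OF K L len] by (simp add: \<kappa>_def \<mu>_def cK_def cL_def)
  qed
  define w where "w = mat ?p ?p (\<lambda>(i, j). B $$ (L ! i, K ! j))"
  \<comment> \<open>The first columns of the permuted inverse, completed by unit vectors.\<close>
  define W where "W = mat n n (\<lambda>(i, j). if j < ?p then B $$ (\<mu> ! i, \<kappa> ! j) else if i = j then 1 else 0)"
  define d where "d = mat (n - ?p) (n - ?p) (\<lambda>(i, j). A $$ (cK ! i, cL ! j))"
  have d: "delete_rows_cols A K L = d"
    unfolding delete_rows_cols_eq[OF A K(2) L(2)] d_def using lc by (simp add: cK_def cL_def)
  have W: "W \<in> carrier_mat n n" and A': "A' \<in> carrier_mat n n" by (simp_all add: W_def A'_def)
  have detW: "det W = det w"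
  proof -
    let ?y = "mat (n - ?p) ?p (\<lambda>(i, j). B $$ (\<mu> ! (?p + i), \<kappa> ! j))"
    have "W = four_block_mat w (0\<^sub>m ?p (n - ?p)) ?y (1\<^sub>m (n - ?p))"
      using pn len by (intro eq_matI) (auto simp: W_def w_def \<kappa>_def \<mu>_def nth_append)
    then show ?thesis
      using det_four_block_mat_upper_right_zero[of w ?p "0\<^sub>m ?p (n - ?p)" "n - ?p" ?y "1\<^sub>m (n - ?p)"]
      by (simp add: w_def)
  qed
  have detAW: "det (A' * W) = det d"
  proof -
    let ?x = "mat ?p (n - ?p) (\<lambda>(i, j). A $$ (K ! i, cL ! j))"
    have entry: "(A' * W) $$ (i, j) = (if j < ?p then if i = j then 1 else 0 else A' $$ (i, j))"
      if ij: "i < n" "j < n" for i j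
    proof (cases "j < ?p")
      case True
      have "(A' * W) $$ (i, j) = (\<Sum>c<n. A $$ (\<kappa> ! i, \<mu> ! c) * B $$ (\<mu> ! c, \<kappa> ! j))"
        unfolding mat_mult_entry[OF A' W ij]
        using True ij by (intro sum.cong refl) (simp add: A'_def W_def)
      also have "\<dots> = (\<Sum>c<n. A $$ (\<kappa> ! i, c) * B $$ (c, \<kappa> ! j))" by (rule reindex)
      also have "\<dots> = (A * B) $$ (\<kappa> ! i, \<kappa> ! j)"
        using ij lt by (simp add: mat_mult_entry[OF A B])
      finally show ?thesis
        using True ij lt perm by (simp add: AB nth_eq_iff_index_eq)
    next
      case False
      have "(A' * W) $$ (i, j) = (\<Sum>c<n. if c = j then A' $$ (i, c) else 0)"
        unfolding mat_mult_entry[OF A' W ij]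
        using False ij by (intro sum.cong refl) (simp add: W_def)
      then show ?thesis using False ij by (simp add: sum.delta)
    qed
    have "A' * W = four_block_mat (1\<^sub>m ?p) ?x (0\<^sub>m (n - ?p) ?p) d"
    proof (rule eq_matI)
      fix i j
      assume "i < dim_row (four_block_mat (1\<^sub>m ?p) ?x (0\<^sub>m (n - ?p) ?p) d)"
        "j < dim_col (four_block_mat (1\<^sub>m ?p) ?x (0\<^sub>m (n - ?p) ?p) d)"
      then have ij: "i < n" "j < n" using pn by (auto simp: d_def)
      show "(A' * W) $$ (i, j) = four_block_mat (1\<^sub>m ?p) ?x (0\<^sub>m (n - ?p) ?p) d $$ (i, j)"
        using ij pn len unfolding entry[OF ij] by (auto simp: d_def A'_def \<kappa>_def \<mu>_def nth_append)
    qed (use A' W pn in \<open>auto simp: d_def\<close>)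
    then show ?thesis
      using det_four_block_mat_lower_left_zero[of "1\<^sub>m ?p" ?p ?x "n - ?p" "0\<^sub>m (n - ?p) ?p" d]
      by (simp add: d_def)
  qed
  have "det d = of_int (tuple_sign K * tuple_sign L) * det A * det w"
    using detAW det_mult[OF A' W] by (simp add: detA' detW)
  moreover have "of_int (tuple_sign K * tuple_sign L) * of_int (tuple_sign K * tuple_sign L) = (1 :: 'a)"
  proof -
    have "tuple_sign M * tuple_sign M = 1" if "distinct M" for M
      using that by (cases "sorting_perm M" rule: sign_cases) (auto simp: tuple_sign_def simp flip: power_add)
    then have "(tuple_sign K * tuple_sign L) * (tuple_sign K * tuple_sign L) = 1"
      using K L by (metis mult.left_commute mult.assoc mult_1)
    then show ?thesis by (metis of_int_1 of_int_mult)
  qed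
  moreover have "minor ?b L K = det w" using len by (simp add: minor_def w_def)
  ultimately show ?thesis unfolding d by (simp add: mult.assoc[symmetric]) 
qed

lemma minor_repeated_column:
  assumes "\<not> distinct L"
  shows "minor b K L = 0"
proof (cases "length K = length L")
  case True
  let ?n = "length L"
  obtain i j where ij: "i < ?n" "j < ?n" "i \<noteq> j" "L ! i = L ! j"
    using assms by (auto simp: distinct_conv_nth)
  have "det (mat ?n ?n (\<lambda>(i, j). b (K ! i) (L ! j))) = 0"
    by (rule det_identical_columns[of _ ?n i j]) (use ij in \<open>auto intro!: eq_vecI\<close>)
  then show ?thesis using True by (simp add: minor_def)
qed (simp add: minor_def)

lemma minor_repeated_row:
  assumes "\<not> distinct K"
  shows "minor b K L = 0"
proof (cases "length K = length L")
  case True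
  let ?n = "length K"
  obtain i j where ij: "i < ?n" "j < ?n" "i \<noteq> j" "K ! i = K ! j"
    using assms by (auto simp: distinct_conv_nth)
  have "det (mat ?n ?n (\<lambda>(i, j). b (K ! i) (L ! j))) = 0"
    by (rule det_identical_rows[of _ ?n i j]) (use ij in \<open>auto intro!: eq_vecI\<close>)
  then show ?thesis using True by (simp add: minor_def)
qed (simp add: minor_def)

lemma complementary_minor:
  fixes A B :: "'a::field mat"
  assumes "A \<in> carrier_mat n n" "B \<in> carrier_mat n n" "A * B = 1\<^sub>m n"
    and "set K \<subseteq> {0..<n}" "set L \<subseteq> {0..<n}" "length K = length L"
  shows "of_int (tuple_sign K * tuple_sign L) * det (delete_rows_cols A K L) =
    det A * minor (\<lambda>i j. B $$ (i, j)) L K"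
proof (cases "distinct K \<and> distinct L")
  case True
  then show ?thesis using complementary_minor_distinct[OF assms(1-3)] assms(4-6) by blast
next
  case False
  then have "minor (\<lambda>i j. B $$ (i, j)) L K = 0"
    using minor_repeated_column minor_repeated_row by blast
  moreover have "tuple_sign K * tuple_sign L = 0" using False by (auto simp: tuple_sign_def)
  ultimately show ?thesis by (simp only: of_int_0 mult_zero_left mult_zero_right)
qed

section \<open>Sums of minors and the polynomials \<open>Q\<^sub>k\<close>\<close>

lemma nths_conv_map:
  assumes "I \<subseteq> {..<length xs}"
  shows "nths xs I = map ((!) xs) (sorted_list_of_set I)"
proof -
  have "zip xs [0..<length xs] = map (\<lambda>i. (xs ! i, i)) [0..<length xs]"
    by (intro nth_equalityI) auto
  then have "nths xs I = map ((!) xs) (filter (\<lambda>i. i \<in> I) [0..<length xs])"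
    by (simp add: nths_def filter_map comp_def)
  moreover have "filter (\<lambda>i. i \<in> I) [0..<length xs] = sorted_list_of_set I"
  proof -
    have "set (filter (\<lambda>i. i \<in> I) [0..<length xs]) = I" using assms by auto
    then show ?thesis
      using sorted_list_of_set.idem_if_sorted_distinct[of "filter (\<lambda>i. i \<in> I) [0..<length xs]"]
      by (simp add: sorted_wrt_filter)
  qed
  ultimately show ?thesis by simp
qed

lemma sub_tuple_eq_ends:
  assumes "I \<subseteq> {..<length L}"
  shows "sub_tuple L I = ends (\<lambda>i. fst (L ! i)) (\<lambda>i. snd (L ! i)) (sorted_list_of_set I)"
  unfolding sub_tuple_def nths_conv_map[OF assms] ends_def
  by (simp add: case_prod_unfold comp_def)

text \<open>
  By symmetry of the inverse the factor does not depend on the order in which the choice operator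
  presents \<open>I\<close> and \<open>J\<close>.
\<close>

lemma pair_factor_eq_minor:
  fixes A B :: "'a::field mat"
  assumes A: "A \<in> carrier_mat n n" and B: "B \<in> carrier_mat n n" and AB: "A * B = 1\<^sub>m n"
    and b: "\<And>i j. i < n \<Longrightarrow> j < n \<Longrightarrow> b i j = B $$ (i, j)" and sym: "\<And>i j. b i j = b j i"
    and L: "\<forall>x\<in>set L. fst x < n \<and> snd x < n"
    and IJ: "I \<subseteq> {..<length L}" "J \<subseteq> {..<length L}" "card I = card J"
  shows "pair_factor A L {I, J} = det A * minor b (sub_tuple L I) (sub_tuple L J)"
proof -
  have sub: "set (sub_tuple L I) \<subseteq> {0..<n}" for I
    using L by (auto simp: sub_tuple_def dest!: in_set_nthsD)
  have len: "length (sub_tuple L I) = 2 * card I" if "I \<subseteq> {..<length L}" for I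
    by (simp add: sub_tuple_eq_ends[OF that])
  have eq: "of_int (tuple_sign (sub_tuple L I) * tuple_sign (sub_tuple L J)) *
      det (delete_rows_cols A (sub_tuple L I) (sub_tuple L J)) = det A * minor b (sub_tuple L I) (sub_tuple L J)"
    if IJ: "I \<subseteq> {..<length L}" "J \<subseteq> {..<length L}" "card I = card J" for I J
  proof -
    have len': "length (sub_tuple L I) = length (sub_tuple L J)" using len IJ by simp
    have mem: "sub_tuple L I ! i < n" if "i < length (sub_tuple L I)" for i I
      using nth_mem[OF that] sub by fastforce
    have "minor (\<lambda>i j. B $$ (i, j)) (sub_tuple L J) (sub_tuple L I) = minor b (sub_tuple L J) (sub_tuple L I)"
      unfolding minor_def using len' mem by (auto intro!: arg_cong[where f = det] eq_matI simp: b)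
    then show ?thesis
      using complementary_minor[OF A B AB sub sub len'] minor_transpose[of b "sub_tuple L J" "sub_tuple L I", OF sym]
      by simp
  qed
  obtain I' J' where some: "(SOME (I', J'). {I, J} = {I', J'}) = (I', J')"
    by (cases "SOME (I', J'). {I, J} = {I', J'}")
  have "case (SOME (I', J'). {I, J} = {I', J'}) of (I', J') \<Rightarrow> {I, J} = {I', J'}"
    by (rule someI[of _ "(I, J)"]) simp
  then have "{I, J} = {I', J'}" by (simp add: some)
  then have "I' = I \<and> J' = J \<or> I' = J \<and> J' = I" by (auto simp: doubleton_eq_iff)
  then have "pair_factor A L {I, J} = det A * minor b (sub_tuple L I) (sub_tuple L J) \<or>
      pair_factor A L {I, J} = det A * minor b (sub_tuple L J) (sub_tuple L I)"
    unfolding pair_factor_def some Let_def prod.case using eq IJ by (elim disjE conjE) simp_all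
  then show ?thesis using minor_transpose[of b "sub_tuple L I" "sub_tuple L J", OF sym] by auto
qed

text \<open>
  Both sides invert the sums of minors under convolution. Each of the \<open>k\<close> pairs contributes a factor
  \<open>1 / det A\<close> when minors of the inverse are replaced by complementary minors of \<open>A\<close>.
\<close>

lemma oriented_permanent_eq_Q_poly:
  fixes A B :: "'a::field_char_0 mat"
  assumes A: "A \<in> carrier_mat n n" and B: "B \<in> carrier_mat n n" and AB: "A * B = 1\<^sub>m n"
    and sym: "\<And>i j. i < n \<Longrightarrow> j < n \<Longrightarrow> B $$ (i, j) = B $$ (j, i)" and det: "det A \<noteq> 0"
    and L: "\<forall>x\<in>set L. fst x < n \<and> snd x < n" "length L = m" and m: "m > 0"
  shows "oriented_permanent (\<lambda>i j. B $$ (i, j)) (\<lambda>i. fst (L ! i)) (\<lambda>i. snd (L ! i)) {..<m} =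
    (\<Sum>k = 1..m div 2. (- 2) ^ k * fact k * (Q_poly k A L / det A ^ k))"
proof -
  \<comment> \<open>Symmetric for all arguments, also where the entries of \<open>B\<close> are undefined.\<close>
  define b where "b i j = B $$ (min i j, max i j)" for i j
  have bB: "b i j = B $$ (i, j)" if "i < n" "j < n" for i j
    using sym[OF that] by (simp add: b_def min_def max_def)
  have bsym: "b i j = b j i" for i j by (simp add: b_def min.commute max.commute)
  let ?s = "\<lambda>i. fst (L ! i)" and ?t = "\<lambda>i. snd (L ! i)"
  let ?e = "\<lambda>I. ends ?s ?t (sorted_list_of_set I)"
  define d where "d I J = minor b (?e I) (?e J)" for I J
  define w where "w p = (SOME x. \<exists>I J. p = {I, J} \<and> x = d I J)" for p
  have dsym: "d I J = d J I" for I J unfolding d_def by (rule minor_transpose[OF bsym])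
  have w: "w {I, J} = d I J" for I J
  proof -
    have "\<exists>I' J'. {I, J} = {I', J'} \<and> w {I, J} = d I' J'"
      unfolding w_def by (rule someI[of _ "d I J"]) blast
    then obtain I' J' where "{I, J} = {I', J'}" "w {I, J} = d I' J'" by blast
    then show ?thesis using dsym by (auto simp: doubleton_eq_iff)
  qed
  interpret symmetric_weight d w
  proof
    show "w {I, J} = d I J" for I J by (rule w)
    show "d I J = 0" if "card I \<noteq> card J" for I J
      using that by (simp add: d_def minor_def)
  qed
  have "oriented_permanent (\<lambda>i j. B $$ (i, j)) ?s ?t {..<m} = oriented_permanent b ?s ?t {..<m}"
    unfolding oriented_permanent_def
  proof (intro sum.cong arg_cong2[where f = "(*)"] permanent_cong refl)
    fix F e f assume "e \<in> {..<m}" "f \<in> {..<m}"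
    then have "L ! e \<in> set L" "L ! f \<in> set L" using L by auto
    then have "?s e < n" "?t e < n" "?s f < n" "?t f < n" using L(1) by auto
    then show "B $$ (if e \<in> F then ?s e else ?t e, if f \<in> F then ?t f else ?s f) =
        b (if e \<in> F then ?s e else ?t e) (if f \<in> F then ?t f else ?s f)"
      by (auto simp: bB)
  qed
  also have "\<dots> = (\<Sum>k\<le>m. (- 2) ^ k * fact k * pairing_sum k {..<m})"
  proof (rule convolution_inverse)
    have "split_sum E = split_minors b ?s ?t E" for E
      by (simp add: split_sum_def split_minors_def d_def)
    then show "(\<Sum>K\<in>Pow E. split_sum K * oriented_permanent b ?s ?t (E - K)) = 0"
      if "finite E" "E \<noteq> {}" for E
      using split_minors_convolution[where b = b and s = ?s and t = ?t, OF bsym that] by simp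
  qed (simp_all add: d_def)
  also have "\<dots> = (\<Sum>k = 1..m div 2. (- 2) ^ k * fact k * pairing_sum k {..<m})"
  proof (rule sum.mono_neutral_right)
    show "\<forall>k\<in>{..m} - {1..m div 2}. (- 2) ^ k * fact k * pairing_sum k {..<m} = 0"
    proof
      fix k assume "k \<in> {..m} - {1..m div 2}"
      then have "k = 0 \<or> m < 2 * k" by auto
      then show "(- 2) ^ k * fact k * pairing_sum k {..<m} = 0"
        using m pairing_sum_0[of "{..<m}"] pairing_sum_large[of "{..<m}" k] by auto
    qed
  qed auto
  also have "\<dots> = (\<Sum>k = 1..m div 2. (- 2) ^ k * fact k * (Q_poly k A L / det A ^ k))"
  proof -
    have "Q_poly k A L = det A ^ k * pairing_sum k {..<m}" for k
      unfolding Q_poly_def pairings_eq L(2) pairing_sum_def sum_distrib_left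
    proof (intro sum.cong refl)
      fix P assume P: "P \<in> pairings_of {..<m} k"
      have each: "pair_factor A L p = det A * w p" if p: "p \<in> P" for p
      proof -
        have "\<forall>p\<in>P. \<exists>I J. p = {I, J} \<and> I \<noteq> J \<and> card I = card J" using P
          by (simp add: pairings_of_def)
        from bspec[OF this p] obtain I J where IJ: "p = {I, J}" "card I = card J"
          by (elim exE conjE)
        have "P \<subseteq> Pow (Pow {..<m})" by (rule finite_member_pairings_of(2)[OF _ P]) simp
        then have "I \<subseteq> {..<length L}" "J \<subseteq> {..<length L}" using p IJ(1) L(2) by auto
        from pair_factor_eq_minor[OF A B AB bB bsym L(1) this IJ(2)] show ?thesis
          unfolding IJ(1) w d_def by (simp add: sub_tuple_eq_ends[OF \<open>I \<subseteq> _\<close>] sub_tuple_eq_ends[OF \<open>J \<subseteq> _\<close>])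
      qed
      have "card P = k" using P by (simp add: pairings_of_def)
      then show "(\<Prod>p\<in>P. pair_factor A L p) = det A ^ k * (\<Prod>p\<in>P. w p)"
        by (simp add: each prod.distrib)
    qed
    then show ?thesis using det by simp
  qed
  finally show ?thesis .
qed

lemma int_polys_sum: "(\<And>x. x \<in> X \<Longrightarrow> f x \<in> int_polys A) \<Longrightarrow> sum f X \<in> int_polys A"
  by (induction X rule: infinite_finite_induct)
    (auto intro: int_polys.add int_polys.const[of 0, simplified])

lemma int_polys_prod: "(\<And>x. x \<in> X \<Longrightarrow> f x \<in> int_polys A) \<Longrightarrow> prod f X \<in> int_polys A"
  by (induction X rule: infinite_finite_induct)
    (auto intro: int_polys.mult int_polys.const[of 1, simplified])

lemma Q_poly_int_polys: "Q_poly k A L \<in> int_polys A"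
proof -
  have det: "det (submatrix A R C) \<in> int_polys A" for R C
  proof (cases "dim_row (submatrix A R C) = dim_col (submatrix A R C)")
    case True
    have "det (submatrix A R C) = (\<Sum>p | p permutes {0..<dim_row (submatrix A R C)}.
        signof p * (\<Prod>i = 0..<dim_row (submatrix A R C). submatrix A R C $$ (i, p i)))"
      using True by (simp add: det_def)
    also have "\<dots> \<in> int_polys A"
    proof (intro int_polys_sum int_polys.mult int_polys.const int_polys_prod)
      fix p i assume "p \<in> {p. p permutes {0..<dim_row (submatrix A R C)}}"
        and i: "i \<in> {0..<dim_row (submatrix A R C)}"
      then have "p i < dim_col (submatrix A R C)" using permutes_lt True by auto
      then have rc: "i < card {i. i < dim_row A \<and> i \<in> R}" "p i < card {j. j < dim_col A \<and> j \<in> C}"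
        using i by (simp_all add: dim_submatrix)
      show "submatrix A R C $$ (i, p i) \<in> int_polys A"
        unfolding submatrix_index[OF rc] by (intro int_polys.entry pick_le rc)
    qed
    finally show ?thesis .
  next
    case False
    then show ?thesis using int_polys.const[of 0 A] by (simp add: det_def)
  qed
  show ?thesis
    unfolding Q_poly_def pair_factor_def delete_rows_cols_def Let_def case_prod_unfold
    by (intro int_polys_sum int_polys_prod int_polys.mult int_polys.const det)
qed

section \<open>The expansion of the trace form\<close>

lemma da_prod_eq_gens:
  assumes "\<forall>x\<in>set v. fst x \<le> snd x"
  shows "da_prod v = prod_list (map form_gen v)"
proof -
  have "map (\<lambda>(i, j). da i j) v = map form_gen v"
    using assms by (intro map_cong refl) (auto simp: da_def)
  then show ?thesis unfolding da_prod_def by (rule arg_cong)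
qed

text \<open>
  This coefficient is a product of shuffle signs.
\<close>

lemma gen_prod_coeff_square:
  "distinct v \<Longrightarrow> form_coeff (prod_list (map form_gen v)) (set v) *
    form_coeff (prod_list (map form_gen v)) (set v) = (1 :: 'a::comm_ring_1)"
proof (induction v)
  case Nil
  then show ?case by (simp add: one_form.rep_eq)
next
  case (Cons x v)
  have S: "set (x # v) - {x} = set v" using Cons.prems by auto
  have sq: "shuffle_sign T U * shuffle_sign T U = (1 :: 'a)" for T U
    by (simp add: shuffle_sign_def flip: power_add)
  have "shuffle_sign T U * y * (shuffle_sign T U * y) = (shuffle_sign T U * shuffle_sign T U) * (y * y)"
    for T U and y :: 'a by (simp only: mult_ac)
  then show ?case
    using gen_mult_coeff[of "set (x # v)" x "prod_list (map form_gen v) :: 'a form"] Cons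
    unfolding S by (simp add: sq)
qed

text \<open>
  A form is the sum of its monomials, and each monomial is \<open>\<plusminus>\<close> a product of differentials in some
  order. Multiplying by the same sign again recovers the coefficient.
\<close>

lemma diag_degree_lessI:
  fixes f :: "'a::comm_ring_1 form"
  assumes "\<And>S. form_coeff f S \<noteq> 0 \<Longrightarrow> S \<subseteq> sym_pairs n \<and> card (S \<inter> diag_pairs n) < d"
  shows "f \<in> diag_degree_less n d"
proof -
  let ?X = "{S. form_coeff f S \<noteq> 0}"
  have "\<exists>l. set l = S \<and> distinct l" if "S \<in> ?X" for S
  proof (rule finite_distinct_list)
    show "finite S" using that form_coeff_infinite[of S f] by (cases "finite S") simp_all
  qed
  then have "\<forall>S\<in>?X. \<exists>l. set l = S \<and> distinct l" by simp
  from bchoice[OF this] obtain l where l: "\<And>S. S \<in> ?X \<Longrightarrow> set (l S) = S \<and> distinct (l S)" by blast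
  \<comment> \<open>The second factor is the sign with which the list \<open>v\<close> represents its monomial.\<close>
  define c where "c v = form_coeff f (set v) * form_coeff (da_prod v) (set v)" for v
  have le: "\<forall>x\<in>set (l S). fst x \<le> snd x" if "S \<in> ?X" for S
    using assms[of S] l[OF that] that by (auto simp: sym_pairs_def)
  have inj: "inj_on l ?X" by (rule inj_on_inverseI[of _ set]) (simp add: l)
  have "f = (\<Sum>v\<in>l ` ?X. scalar_form (c v) * da_prod v)"
  proof (rule form_eqI)
    fix T :: "(nat \<times> nat) set"
    have coeff: "form_coeff (scalar_form (c (l S)) * da_prod (l S)) T = (if S = T then form_coeff f S else 0)"
      if S: "S \<in> ?X" for S
    proof (cases "S = T")
      case True
      then show ?thesis
        using gen_prod_coeff_square[of "l S", where ?'a = 'a] l[OF S] da_prod_eq_gens[OF le[OF S], where ?'a = 'a]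
        by (simp add: form_coeff_scalar_times c_def mult.assoc)
    next
      case False
      then have "form_coeff (da_prod (l S) :: 'a form) T = 0"
        using gen_prod_support[of "l S" T, where ?'a = 'a] l[OF S]
          unfolding da_prod_eq_gens[OF le[OF S]] by blast
      then show ?thesis using False by (simp add: form_coeff_scalar_times)
    qed
    have "form_coeff (\<Sum>v\<in>l ` ?X. scalar_form (c v) * da_prod v) T =
        (\<Sum>S\<in>?X. if S = T then form_coeff f S else 0)"
      unfolding sum.reindex[OF inj] form_coeff_sum comp_def by (intro sum.cong refl coeff)
    also have "\<dots> = form_coeff f T" by (simp add: sum.delta')
    finally show "form_coeff f T = form_coeff (\<Sum>v\<in>l ` ?X. scalar_form (c v) * da_prod v) T" ..
  qed
  moreover have "(\<forall>(i, j)\<in>set v. i \<le> j \<and> j < n) \<and> length (filter (\<lambda>(i, j). i = j) v) < d"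
    if "v \<in> l ` ?X" for v
  proof -
    from that obtain S where S: "S \<in> ?X" "v = l S" by auto
    then have v: "set v = S" "distinct v" using l by auto
    have sub: "S \<subseteq> sym_pairs n" "card (S \<inter> diag_pairs n) < d" using assms S by auto
    have "length (filter (\<lambda>(i, j). i = j) v) = card (set (filter (\<lambda>(i, j). i = j) v))"
      by (rule distinct_card[symmetric]) (simp add: v)
    also have "set (filter (\<lambda>(i, j). i = j) v) = S \<inter> diag_pairs n"
      using sub v by (auto simp: sym_pairs_def diag_pairs_def)
    finally show ?thesis using sub v by (auto simp: sym_pairs_def)
  qed
  ultimately show ?thesis
    unfolding diag_degree_less_def da_prod_def
      by (intro CollectI exI[of _ "l ` ?X"] exI[of _ c]) auto
qed

lemma omega_cases:
  assumes "finite \<nu>" "n > 0"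
  obtains v k where "distinct v" "set v = \<nu>" "k < 2 * n" "omega n \<nu> = omega_seq n v k"
proof -
  obtain v where "set v = \<nu>" "distinct v" using finite_distinct_list[OF assms(1)] by blast
  then have "\<exists>w. \<exists>v k. distinct v \<and> set v = \<nu> \<and> k < 2 * n \<and> w = omega_seq n v k"
    using assms(2) by (intro exI[of _ "omega_seq n v 0"] exI[of _ v] exI[of _ 0]) auto
  from someI_ex[OF this] show ?thesis using that unfolding omega_def by blast
qed

lemma omega_support:
  assumes "E \<subseteq> upper_pairs n" "n > 0"
    and S: "form_coeff (omega n (diag_pairs n \<union> E) :: 'a::comm_ring_1 form) S \<noteq> 0"
  shows "S = diag_pairs n \<union> E"
proof -
  have "finite (diag_pairs n \<union> E)" using assms(1) finite_subset[of E "upper_pairs n"] by simp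
  from this \<open>n > 0\<close> obtain v k where v: "set v = diag_pairs n \<union> E" "k < 2 * n"
    "omega n (diag_pairs n \<union> E) = (omega_seq n v k :: 'a form)"
    by (rule omega_cases)
  have "\<forall>x\<in>set v. fst x \<le> snd x"
    unfolding v(1) using assms(1) by (auto simp: diag_pairs_def upper_pairs_def)
  moreover have "form_coeff (da_prod v :: 'a form) S \<noteq> 0"
    using S unfolding v(3) form_coeff_omega_seq[OF v(2)] by auto
  ultimately show ?thesis
    using gen_prod_support[of v S, where ?'a = 'a] v(1) by (simp add: da_prod_eq_gens)
qed

lemma symmetric_invertible_inverse:
  fixes A :: "'a::field mat"
  assumes A: "A \<in> carrier_mat n n" and "A\<^sup>T = A" "invertible_mat A"
  obtains B where "mat_inverse A = Some B" "B \<in> carrier_mat n n" "A * B = 1\<^sub>m n" "B * A = 1\<^sub>m n"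
    "\<forall>i<n. \<forall>j<n. B $$ (i, j) = B $$ (j, i)" "det A \<noteq> 0"
proof -
  obtain A' where A': "A * A' = 1\<^sub>m n" "A' * A = 1\<^sub>m (dim_row A')"
    using assms(3) A by (auto simp: invertible_mat_def inverts_mat_def)
  have "dim_col (A * A') = n" "dim_col (A' * A) = dim_row A'" unfolding A' by simp_all
  then have "A' \<in> carrier_mat n n" using A by auto
  then have "det A * det A' = 1" using det_mult[OF A, of A'] A' by simp
  then have det: "det A \<noteq> 0" by auto
  obtain B where inv: "mat_inverse A = Some B"
  proof (cases "mat_inverse A")
    case None
    then have "A \<notin> Units (ring_mat TYPE('a) n ())" by (rule mat_inverse(1)[OF A])
    moreover have "A \<in> Units (ring_mat TYPE('a) n ())" by (rule det_non_zero_imp_unit[OF A det])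
    ultimately show ?thesis by simp
  qed
  have AB: "A * B = 1\<^sub>m n" and BA: "B * A = 1\<^sub>m n" and B: "B \<in> carrier_mat n n"
    using mat_inverse(2)[OF A inv] by auto
  have "B\<^sup>T * A = 1\<^sub>m n"
    using arg_cong[OF AB, of transpose_mat] transpose_mult[OF A B] assms(2) by simp
  then have "B\<^sup>T * (A * B) = 1\<^sub>m n * B"
    using A B by (simp flip: assoc_mult_mat[of "B\<^sup>T" n n A n B n])
  then have BT: "B\<^sup>T = B" using B by (simp add: AB)
  have sym: "B $$ (i, j) = B $$ (j, i)" if "i < n" "j < n" for i j
    using arg_cong[OF BT, of "\<lambda>M. M $$ (i, j)"] that B by simp
  then have "\<forall>i<n. \<forall>j<n. B $$ (i, j) = B $$ (j, i)" by blast
  from that[OF inv B AB BA this det] show ?thesis .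
qed

text \<open>
  The form \<open>omega\<close> is given by some ordering and some deleted column; \<open>adj_trace_top_coeff\<close> holds for every
  choice, in particular for this one.
\<close>

lemma trace_form_top_coeff:
  fixes A B :: "'a::field_char_0 mat"
  assumes A: "A \<in> carrier_mat n n" and B: "B \<in> carrier_mat n n"
    and AB: "A * B = 1\<^sub>m n" and BA: "B * A = 1\<^sub>m n" and inv: "mat_inverse A = Some B"
    and sym: "\<And>i j. i < n \<Longrightarrow> j < n \<Longrightarrow> B $$ (i, j) = B $$ (j, i)" and det: "det A \<noteq> 0"
    and n: "odd n" "n = m + 1" "n > 1"
    and E: "E \<subseteq> upper_pairs n" "card E = m" and L: "distinct L" "set L = E"
  shows "form_coeff (trace_form A (2 * n - 1)) (diag_pairs n \<union> E) = of_nat (2 * n - 1) *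
    ((\<Sum>k = 1..m div 2. (- 2) ^ k * fact k * (Q_poly k A L / det A ^ (k + 1))) *
      form_coeff (omega n (diag_pairs n \<union> E)) (diag_pairs n \<union> E))"
proof -
  let ?T = "trace_form A (2 * n - 1)" and ?\<nu> = "diag_pairs n \<union> E"
  let ?c = "\<lambda>k. (- 2) ^ k * fact k * (Q_poly k A L / det A ^ (k + 1))"
  have "finite ?\<nu>" using E(1) finite_subset[of E "upper_pairs n"] by simp
  then obtain v k where v: "distinct v" "set v = ?\<nu>" "k < 2 * n" "omega n ?\<nu> = (omega_seq n v k :: 'a form)"
    by (rule omega_cases[of _ n]) (use n in auto)
  have lenL: "length L = m" using distinct_card[OF L(1)] L(2) E by simp
  have bound: "\<forall>x\<in>set L. fst x < n \<and> snd x < n"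
    unfolding L(2) using E by (auto simp: upper_pairs_def)
  let ?P = "oriented_permanent (\<lambda>i j. B $$ (i, j)) (\<lambda>i. fst (L ! i)) (\<lambda>i. snd (L ! i)) {..<m}"
  have Suc: "n = Suc m" and even: "even m" using n by auto
  have "det A * form_coeff ?T ?\<nu> = form_coeff (scalar_form (det A) * ?T) ?\<nu>"
    by (simp add: form_coeff_scalar_times)
  also have "\<dots> = form_coeff (\<Sum>k<Suc m. \<Sum>j<Suc m.
      form_of_even (adj_mat (quad_mat (Suc m) B) $$ (k, j)) * da j k) (set v)"
    using trace_form_eq_adj[OF A B AB BA inv] even v(2)
    by (simp add: Suc del: sum.lessThan_Suc)
  also have "\<dots> = of_nat (2 * m + 1) * ?P * form_coeff (omega_seq n v k) (set v)"
    using adj_trace_top_coeff[OF v(1) v(2)[unfolded Suc] E(1)[unfolded Suc] E(2) even v(3)[unfolded Suc] L, of B]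
    by (simp add: Suc del: sum.lessThan_Suc)
  also have "?P = (\<Sum>k = 1..m div 2. (- 2) ^ k * fact k * (Q_poly k A L / det A ^ k))"
    using n by (intro oriented_permanent_eq_Q_poly[OF A B AB sym det bound lenL]) auto
  also have "\<dots> = det A * (\<Sum>k = 1..m div 2. ?c k)"
    unfolding sum_distrib_left using det by (intro sum.cong refl) simp
  finally have "det A * form_coeff ?T ?\<nu> =
      det A * (of_nat (2 * m + 1) * ((\<Sum>k = 1..m div 2. ?c k) * form_coeff (omega n ?\<nu>) ?\<nu>))"
    by (simp add: v(2,4) mult_ac)
  moreover have N: "2 * n - 1 = 2 * m + 1" using n by simp
  ultimately show ?thesis using det unfolding N by (simp only: mult_cancel_left) simp
qed

theorem theorem49:
  fixes A :: "'a::field_char_0 mat"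
    and n m :: nat
    and ord :: "(nat \<times> nat) set \<Rightarrow> (nat \<times> nat) list"
  assumes "n \<ge> 1"
    and "A \<in> carrier_mat n n"
    and "A\<^sup>T = A"
    and "invertible_mat A"
    and ord: "\<And>E. E \<subseteq> upper_pairs n \<Longrightarrow> distinct (ord E) \<and> set (ord E) = E"
  shows "(odd n \<and> n = m + 1 \<and> n > 1 \<longrightarrow>
      (\<exists>R \<in> diag_degree_less n n.
        trace_form A (2 * n - 1) =
          of_nat (2 * n - 1) *
          (\<Sum>E | E \<subseteq> upper_pairs n \<and> card E = m. \<Sum>k = 1..m div 2.
             scalar_form ((- 2) ^ k * fact k * (Q_poly k A (ord E) / det A ^ (k + 1))) *
             omega n (diag_pairs n \<union> E))
          + R) \<and>
      (\<forall>E k. E \<subseteq> upper_pairs n \<and> card E = m \<and> k \<in> {1..m div 2} \<longrightarrow>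
        Q_poly k A (ord E) \<in> int_polys A)) \<and>
    (even n \<longrightarrow> trace_form A (2 * n - 1) \<in> diag_degree_less n n)"
proof -
  note A = \<open>A \<in> carrier_mat n n\<close>
  obtain B where inv: "mat_inverse A = Some B" and B: "B \<in> carrier_mat n n"
    and AB: "A * B = 1\<^sub>m n" and BA: "B * A = 1\<^sub>m n"
    and sym': "\<forall>i<n. \<forall>j<n. B $$ (i, j) = B $$ (j, i)" and det: "det A \<noteq> 0"
    by (rule symmetric_invertible_inverse[OF A assms(3,4)])
  have sym: "B $$ (i, j) = B $$ (j, i)" if "i < n" "j < n" for i j using sym' that by blast
  have hom: "homogeneous (sym_pairs n) (2 * n - 1) (trace_form A (2 * n - 1))"
    by (rule homogeneous_trace_form[OF A B inv])
  have "trace_form A (2 * n - 1) \<in> diag_degree_less n n" if "even n"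
    using trace_form_even_zero[OF A B AB BA inv sym \<open>n \<ge> 1\<close> that det]
    by (auto intro: diag_degree_lessI simp: zero_form.rep_eq)
  moreover have "\<exists>R \<in> diag_degree_less n n.
        trace_form A (2 * n - 1) = of_nat (2 * n - 1) *
          (\<Sum>E | E \<subseteq> upper_pairs n \<and> card E = m. \<Sum>k = 1..m div 2.
             scalar_form ((- 2) ^ k * fact k * (Q_poly k A (ord E) / det A ^ (k + 1))) *
             omega n (diag_pairs n \<union> E)) + R" if n: "odd n" "n = m + 1" "n > 1"
  proof -
    let ?T = "trace_form A (2 * n - 1)"
    let ?c = "\<lambda>E k. (- 2) ^ k * fact k * (Q_poly k A (ord E) / det A ^ (k + 1))"
    let ?X = "{E. E \<subseteq> upper_pairs n \<and> card E = m}"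
    define main where "main = of_nat (2 * n - 1) *
      (\<Sum>E\<in>?X. \<Sum>k = 1..m div 2. scalar_form (?c E k) * omega n (diag_pairs n \<union> E))"
    have finX: "finite ?X" by (rule finite_subset[of _ "Pow (upper_pairs n)"]) auto
    have support: "S = diag_pairs n \<union> E"
      if "E \<in> ?X" "form_coeff (omega n (diag_pairs n \<union> E) :: 'a form) S \<noteq> 0" for E S
      by (rule omega_support) (use that n in auto)
    have coeff_main: "form_coeff main S = of_nat (2 * n - 1) *
        (\<Sum>E\<in>?X. \<Sum>k = 1..m div 2. ?c E k * form_coeff (omega n (diag_pairs n \<union> E)) S)" for S
      unfolding main_def of_nat_form[where ?'a = 'a] form_coeff_scalar_times form_coeff_sum ..
    have top: "form_coeff ?T (diag_pairs n \<union> E) = form_coeff main (diag_pairs n \<union> E)" if E: "E \<in> ?X" for E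
    proof -
      let ?\<nu> = "diag_pairs n \<union> E"
      have other: "form_coeff (omega n (diag_pairs n \<union> E') :: 'a form) ?\<nu> = 0" if "E' \<in> ?X" "E' \<noteq> E" for E'
      proof (rule ccontr)
        assume "form_coeff (omega n (diag_pairs n \<union> E') :: 'a form) ?\<nu> \<noteq> 0"
        then have "?\<nu> = diag_pairs n \<union> E'" by (rule support[OF that(1)])
        moreover have "diag_pairs n \<inter> E = {}" "diag_pairs n \<inter> E' = {}"
          using diag_upper_disjoint E that(1) by auto
        ultimately show False using that(2) by blast
      qed
      have "(\<Sum>E'\<in>?X. \<Sum>k = 1..m div 2. ?c E' k * form_coeff (omega n (diag_pairs n \<union> E')) ?\<nu>) =
          (\<Sum>E'\<in>{E}. \<Sum>k = 1..m div 2. ?c E' k * form_coeff (omega n (diag_pairs n \<union> E')) ?\<nu>)"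
        using finX E other by (intro sum.mono_neutral_right) (auto intro!: sum.neutral)
      then have "form_coeff main ?\<nu> =
          of_nat (2 * n - 1) * ((\<Sum>k = 1..m div 2. ?c E k) * form_coeff (omega n ?\<nu>) ?\<nu>)"
        unfolding coeff_main by (simp add: sum_distrib_right)
      also have "\<dots> = form_coeff ?T ?\<nu>"
        using E ord[of E] by (intro trace_form_top_coeff[OF A B AB BA inv sym det n, symmetric]) auto
      finally show ?thesis ..
    qed
    have "?T - main \<in> diag_degree_less n n"
    proof (rule diag_degree_lessI)
      fix S assume nz: "form_coeff (?T - main) S \<noteq> 0"
      have S: "S \<subseteq> sym_pairs n \<and> card S = 2 * n - 1"
      proof (cases "form_coeff ?T S = 0")
        case False
        then show ?thesis using hom by (simp add: homogeneous_def)
      next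
        case True
        then have "form_coeff main S \<noteq> 0" using nz by (simp add: minus_form.rep_eq)
        then obtain E where E: "E \<in> ?X" "form_coeff (omega n (diag_pairs n \<union> E) :: 'a form) S \<noteq> 0"
          unfolding coeff_main by (metis (no_types, lifting) mult_zero_right sum.neutral)
        have "S = diag_pairs n \<union> E" by (rule support[OF E])
        moreover have "card (diag_pairs n \<union> E) = n + m"
          using E(1) diag_upper_disjoint[of E n] finite_subset[of E "upper_pairs n"]
          by (subst card_Un_disjoint) auto
        moreover have "diag_pairs n \<union> E \<subseteq> sym_pairs n"
          using E(1) by (auto simp: diag_pairs_def upper_pairs_def sym_pairs_def)
        ultimately show ?thesis using n by simp
      qed
      have "\<not> diag_pairs n \<subseteq> S"
      proof
        assume diag: "diag_pairs n \<subseteq> S"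
        define E where "E = S - diag_pairs n"
        have "card E = m" unfolding E_def using S diag n by (simp add: card_Diff_subset)
        moreover have "E \<subseteq> upper_pairs n"
          using S by (auto simp: E_def sym_pairs_def upper_pairs_def diag_pairs_def)
        ultimately have "form_coeff ?T S = form_coeff main S"
          using top[of E] diag by (simp add: E_def Un_absorb1)
        then show False using nz by (simp add: minus_form.rep_eq)
      qed
      then have "S \<inter> diag_pairs n \<subset> diag_pairs n" by auto
      from psubset_card_mono[OF finite_diag_pairs this] have "card (S \<inter> diag_pairs n) < n" by simp
      then show "S \<subseteq> sym_pairs n \<and> card (S \<inter> diag_pairs n) < n" using S by simp
    qed
    then show ?thesis unfolding main_def by (intro bexI[of _ "?T - main"]) (simp_all add: main_def)
  qed
  ultimately show ?thesis using Q_poly_int_polys by blast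
qed

end
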